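(* Let $M$ be a finite monoid of Lie type with Weyl group $(W,S)$, Renner monoid $R$ and cross-section lattice $\Lambda$, and let $e\in\Lambda$. Let $\theta\le\sigma$ in $WeW$ (Bruhat-Chevalley order). If $R_{\theta,\sigma}(0)=0$, then the interval $[\theta,\sigma]\subseteq WeW$ cannot be embedded into any Weyl group as a subinterval; that is, there are no Weyl group $W'$ and elements $u\le v$ in $W'$ (Bruhat order) such that $[\theta,\sigma]$ is isomorphic as a poset to the interval $[u,v]\subseteq W'$.
   Context: Monoid setting. A finite monoid of Lie type (Putcha) is a finite regular monoid $M$ whose unit group $G$ is a finite group of Lie type, generated by $G$ and its idempotent set $E(M)$, such that for every $e\in E(M)$ the sets $P(e)=\{x\in G: xe=exe\}$ and $P^-(e)=\{x\in G: ex=exe\}$ are opposite parabolic subgroups with $R_u(P(e))e=\{e\}=eR_u(P^-(e))$ ($R_u$ = unipotent radical), and any two $\mathcal J$-equivalent idempotents are $G$-conjugate. Fix a Borel subgroup $B\subseteq G$ with opposite $B^-$ and maximal torus $T=B\cap B^-$; let $W$ be the (finite) Weyl group of $T$, $S$ its set of simple reflections determined by $B$, and $\ell$, $\le$ the length function and Bruhat order of $(W,S)$. The cross-section lattice is $\Lambda=\{e\in E(M): B\subseteq P(e),\ B^-\subseteq P^-(e)\}$. The Renner monoid $R$ is the finite inverse monoid with unit group $W$, consisting of the classes modulo $T$ of the products of representatives of elements of $W$ with $W$-conjugates of elements of $\Lambda$; one has $R=\bigsqcup_{e\in\Lambda}WeW$. Orbit combinatorics. For $e\in\Lambda$ put $W(e)=\{x\in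 W: xe=ex\}$ and $W_e=\{x\in W: xe=e\}$; these are standard parabolic subgroups of $W$ and $W_e$ is normal in $W(e)$. In $WeW$, $aeb^{-1}=a'eb'^{-1}$ iff there is $w\in W(e)$ with $a'\in awW_e$ and $b'\in bwW_e$. Let $D(e)$ (resp. $D_e$) be the set of minimal length representatives of the cosets $xW(e)$ (resp. $xW_e$). Every $\sigma\in WeW$ has a unique standard form $\sigma=xey^{-1}$ with $x\in D_e$, $y\in D(e)$. Set $\ell(e)=\ell(w_0)-\ell(v_0)$, with $w_0,v_0$ the longest elements of $W$, $W(e)$, and $\ell(\sigma)=\ell(x)+\ell(e)-\ell(y)$. The Bruhat-Chevalley order on $WeW$ is: for standard forms $\theta=uev^{-1}$, $\sigma=xey^{-1}$, $\theta\le\sigma$ iff there is $w\in W(e)$ with $u\le xw$ and $yw\le v$ in $W$. Intervals are $[\theta,\sigma]=\{\tau\in WeW:\theta\le\tau\le\sigma\}$. $R$-polynomials. Let $q$ be an indeterminate. $\mathcal H(W)$ is the $\mathbb{Z}[q^{\pm1/2}]$-algebra with basis $\{A_w\}_{w\in W}$ and, for $s\in S$, $A_sA_w=A_{sw}$ if $\ell(sw)>\ell(w)$ and $A_sA_w=q^{-1}A_{sw}+(1-q^{-1})A_w$ if $\ell(sw)<\ell(w)$ (so $A_w=q^{-\ell(w)}T_w$ for the usual Hecke basis). Its bar involution is the ring involution with $\overline{q^{1/2}}=q^{-1/2}$, $\overline{A_w}=(A_{w^{-1}})^{-1}$. The Kazhdan-Lusztig $R$-polynomials $R_{x,w}\in\mathbb{Z}[q]$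 of $W$ are given by $\overline{A_w}=q^{\ell(w)}\sum_{x\in W}\overline{R_{x,w}}A_x$. The orbit Hecke algebra $\mathcal H(e)$ has $\mathbb{Z}[q^{\pm1/2}]$-basis $\{A_\sigma\}_{\sigma\in WeW}$, on which $\mathcal H(W)$ acts on the left by, for $s\in S$: $A_sA_\sigma=A_\sigma$ if $\ell(s\sigma)=\ell(\sigma)$; $A_sA_\sigma=A_{s\sigma}$ if $\ell(s\sigma)=\ell(\sigma)+1$; $A_sA_\sigma=q^{-1}A_{s\sigma}+(1-q^{-1})A_\sigma$ if $\ell(s\sigma)=\ell(\sigma)-1$ (similarly on the right). The involution extends to $\mathcal H(e)$ (Putcha) by: for $\sigma=xet^{-1}$ in standard form, $\overline{A_\sigma}=q^{-\ell(t)}\,\overline{A_x}\sum_{z\in W(e),\,y\in D(e)}\overline{R_{tz,y}}\,A_{zey^{-1}}$. The $R$-polynomials $R_{\theta,\sigma}\in\mathbb{Z}[q]$ ($\theta,\sigma\in WeW$) are defined by $\overline{A_\sigma}=q^{\ell(\sigma)-\ell(e)}\sum_{\theta\in WeW}\overline{R_{\theta,\sigma}}\,A_\theta$; by Putcha, $R_{\theta,\sigma}\ne0$ only if $\theta\le\sigma$, and $R_{\theta,\theta}=1$. *)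

theory Defs
  imports
    "HOL-Algebra.Bij"
    "HOL-Algebra.Generated_Groups"
    "HOL-Library.Poly_Mapping"
    "HOL-Computational_Algebra.Polynomial"
    "HOL-Analysis.Inner_Product"
    "HOL-Analysis.Euclidean_Space"
    "HOL-Computational_Algebra.Primes"
begin

section \<open>Coefficients\<close>

text \<open>Laurent polynomials over the integers in \<open>q^(1/2)\<close>: the monomial of exponent \<open>k\<close>
  is \<open>q^(k/2)\<close>.\<close>

type_synonym laurent = "int \<Rightarrow>\<^sub>0 int"

definition qpow :: "int \<Rightarrow> laurent" where
  "qpow k = Poly_Mapping.single (2 * k) 1"

definition laurent_bar :: "laurent \<Rightarrow> laurent" where
  "laurent_bar f = Poly_Mapping.map_key uminus f"

definition laurent_of_poly :: "int poly \<Rightarrow> laurent" where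
  "laurent_of_poly r = poly (map_poly of_int r) (qpow 1)"

text \<open>Elements of a free module with finite basis \<open>X\<close> are coefficient functions that vanish
  outside \<open>X\<close>.\<close>

definition basis_vec :: "'b \<Rightarrow> 'b \<Rightarrow> laurent" where
  "basis_vec a = (\<lambda>x. if x = a then 1 else 0)"


section \<open>Length, Bruhat order and Hecke algebra of a group with generating involutions\<close>

locale coxeter_data =
  fixes W :: "'w monoid" and S :: "'w set"
begin

definition word_prod :: "'w list \<Rightarrow> 'w" where
  "word_prod ws = foldr (\<otimes>\<^bsub>W\<^esub>) ws \<one>\<^bsub>W\<^esub>"

definition len :: "'w \<Rightarrow> nat" where
  "len w = (LEAST n. \<exists>ws. set ws \<subseteq> S \<and> length ws = n \<and> word_prod ws = w)"

definition reduced_word :: "'w \<Rightarrow> 'w list" where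
  "reduced_word w = (SOME ws. set ws \<subseteq> S \<and> length ws = len w \<and> word_prod ws = w)"

definition bruhat_step :: "'w \<Rightarrow> 'w \<Rightarrow> bool" where
  "bruhat_step u v \<longleftrightarrow>
     (\<exists>w\<in>carrier W. \<exists>s\<in>S. v = u \<otimes>\<^bsub>W\<^esub> (w \<otimes>\<^bsub>W\<^esub> s \<otimes>\<^bsub>W\<^esub> inv\<^bsub>W\<^esub> w)) \<and> len u < len v"

definition bruhat :: "'w \<Rightarrow> 'w \<Rightarrow> bool" where
  "bruhat u v \<longleftrightarrow> u \<in> carrier W \<and> v \<in> carrier W \<and> bruhat_step\<^sup>*\<^sup>* u v"

definition bruhat_interval :: "'w \<Rightarrow> 'w \<Rightarrow> 'w set" where
  "bruhat_interval u v = {w. bruhat u w \<and> bruhat w v}"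

definition standard_parabolic :: "'w set \<Rightarrow> bool" where
  "standard_parabolic X \<longleftrightarrow> (\<exists>I\<subseteq>S. X = generate W I)"

definition longest :: "'w set \<Rightarrow> 'w" where
  "longest X = (ARG_MAX len w. w \<in> X)"

definition min_coset_reps :: "'w set \<Rightarrow> 'w set" where
  "min_coset_reps X = {x \<in> carrier W. \<forall>w\<in>X. len x \<le> len (x \<otimes>\<^bsub>W\<^esub> w)}"

definition gen_times_basis :: "'w \<Rightarrow> 'w \<Rightarrow> 'w \<Rightarrow> laurent" where
  "gen_times_basis s w =
     (if len (s \<otimes>\<^bsub>W\<^esub> w) > len w then basis_vec (s \<otimes>\<^bsub>W\<^esub> w)
      else (\<lambda>x. qpow (-1) * basis_vec (s \<otimes>\<^bsub>W\<^esub> w) x + (1 - qpow (-1)) * basis_vec w x))"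

definition gen_act :: "'w \<Rightarrow> ('w \<Rightarrow> laurent) \<Rightarrow> 'w \<Rightarrow> laurent" where
  "gen_act s h = (\<lambda>x. \<Sum>w\<in>carrier W. h w * gen_times_basis s w x)"

text \<open>\<open>A\<^sub>w\<close> is the product of the generators \<open>A\<^sub>s\<close> along any reduced word of \<open>w\<close>, which
  together with the products \<open>A\<^sub>s A\<^sub>w\<close> determines the multiplication.\<close>

definition hecke_mult :: "('w \<Rightarrow> laurent) \<Rightarrow> ('w \<Rightarrow> laurent) \<Rightarrow> 'w \<Rightarrow> laurent" where
  "hecke_mult f h = (\<lambda>x. \<Sum>w\<in>carrier W. f w * foldr gen_act (reduced_word w) h x)"

text \<open>The bar involution on basis elements: the inverse of \<open>A\<close> at \<open>w\<^sup>-\<^sup>1\<close>.\<close>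

definition hecke_bar :: "'w \<Rightarrow> 'w \<Rightarrow> laurent" where
  "hecke_bar w =
     (THE h. (\<forall>x. x \<notin> carrier W \<longrightarrow> h x = 0) \<and>
             hecke_mult (basis_vec (inv\<^bsub>W\<^esub> w)) h = basis_vec \<one>\<^bsub>W\<^esub> \<and>
             hecke_mult h (basis_vec (inv\<^bsub>W\<^esub> w)) = basis_vec \<one>\<^bsub>W\<^esub>)"

definition KL_R :: "'w \<Rightarrow> 'w \<Rightarrow> int poly" where
  "KL_R x w = (THE r. hecke_bar w x = qpow (int (len w)) * laurent_bar (laurent_of_poly r))"

end


section \<open>The orbit \<open>WeW\<close> in a monoid \<open>R\<close> containing \<open>W\<close>\<close>

locale renner_orbit = coxeter_data W S for W :: "'w monoid" and S :: "'w set" +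
  fixes R :: "'w monoid" and e :: 'w
begin

definition orbit :: "'w set" where
  "orbit = {x \<otimes>\<^bsub>R\<^esub> e \<otimes>\<^bsub>R\<^esub> y | x y. x \<in> carrier W \<and> y \<in> carrier W}"

definition centralizer :: "'w set" where
  "centralizer = {x \<in> carrier W. x \<otimes>\<^bsub>R\<^esub> e = e \<otimes>\<^bsub>R\<^esub> x}"

definition stabilizer :: "'w set" where
  "stabilizer = {x \<in> carrier W. x \<otimes>\<^bsub>R\<^esub> e = e}"

definition standard_form :: "'w \<Rightarrow> 'w \<times> 'w" where
  "standard_form \<sigma> =
     (THE (x, y). x \<in> min_coset_reps stabilizer \<and> y \<in> min_coset_reps centralizer \<and>
        \<sigma> = x \<otimes>\<^bsub>R\<^esub> e \<otimes>\<^bsub>R\<^esub> inv\<^bsub>W\<^esub> y)"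

definition idem_length :: int where
  "idem_length = int (len (longest (carrier W))) - int (len (longest centralizer))"

definition orbit_length :: "'w \<Rightarrow> int" where
  "orbit_length \<sigma> =
     (case standard_form \<sigma> of (x, y) \<Rightarrow> int (len x) + idem_length - int (len y))"

definition bruhat_chevalley :: "'w \<Rightarrow> 'w \<Rightarrow> bool" where
  "bruhat_chevalley \<theta> \<sigma> \<longleftrightarrow> \<theta> \<in> orbit \<and> \<sigma> \<in> orbit \<and>
     (case standard_form \<theta> of (u, v) \<Rightarrow> case standard_form \<sigma> of (x, y) \<Rightarrow>
        \<exists>w\<in>centralizer. bruhat u (x \<otimes>\<^bsub>W\<^esub> w) \<and> bruhat (y \<otimes>\<^bsub>W\<^esub> w) v)"

definition orbit_gen_times_basis :: "'w \<Rightarrow> 'w \<Rightarrow> 'w \<Rightarrow> laurent" where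
  "orbit_gen_times_basis s \<sigma> =
     (if orbit_length (s \<otimes>\<^bsub>R\<^esub> \<sigma>) = orbit_length \<sigma> then basis_vec \<sigma>
      else if orbit_length (s \<otimes>\<^bsub>R\<^esub> \<sigma>) = orbit_length \<sigma> + 1 then basis_vec (s \<otimes>\<^bsub>R\<^esub> \<sigma>)
      else (\<lambda>\<tau>. qpow (-1) * basis_vec (s \<otimes>\<^bsub>R\<^esub> \<sigma>) \<tau> + (1 - qpow (-1)) * basis_vec \<sigma> \<tau>))"

definition orbit_gen_act :: "'w \<Rightarrow> ('w \<Rightarrow> laurent) \<Rightarrow> 'w \<Rightarrow> laurent" where
  "orbit_gen_act s h = (\<lambda>\<tau>. \<Sum>\<sigma>\<in>orbit. h \<sigma> * orbit_gen_times_basis s \<sigma> \<tau>)"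

definition hecke_act :: "('w \<Rightarrow> laurent) \<Rightarrow> ('w \<Rightarrow> laurent) \<Rightarrow> 'w \<Rightarrow> laurent" where
  "hecke_act f h = (\<lambda>\<tau>. \<Sum>w\<in>carrier W. f w * foldr orbit_gen_act (reduced_word w) h \<tau>)"

definition orbit_bar :: "'w \<Rightarrow> 'w \<Rightarrow> laurent" where
  "orbit_bar \<sigma> =
     (case standard_form \<sigma> of (x, t) \<Rightarrow> \<lambda>\<theta>. qpow (- int (len t)) *
        hecke_act (hecke_bar x)
          (\<lambda>\<tau>. \<Sum>z\<in>centralizer. \<Sum>y\<in>min_coset_reps centralizer.
             laurent_bar (laurent_of_poly (KL_R (t \<otimes>\<^bsub>W\<^esub> z) y)) *
             basis_vec (z \<otimes>\<^bsub>R\<^esub> e \<otimes>\<^bsub>R\<^esub> inv\<^bsub>W\<^esub> y) \<tau>) \<theta>)"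

definition R_poly :: "'w \<Rightarrow> 'w \<Rightarrow> int poly" where
  "R_poly \<theta> \<sigma> =
     (THE r. orbit_bar \<sigma> \<theta> =
        qpow (orbit_length \<sigma> - idem_length) * laurent_bar (laurent_of_poly r))"

end


section \<open>Finite groups of Lie type\<close>

text \<open>A finite group of Lie type is a finite group with a split BN-pair of characteristic \<open>p\<close>.
  Elements of \<open>W = N/T\<close> are cosets of \<open>T\<close>, that is, subsets of \<open>G\<close>, so that products such as
  \<open>BwB\<close> are products of sets.\<close>

locale BN_data =
  fixes G :: "'a monoid" and p :: nat and B N :: "'a set" and S :: "'a set set"
begin

definition torus :: "'a set" where
  "torus = B \<inter> N"

definition weyl_group :: "'a set monoid" where
  "weyl_group = (G\<lparr>carrier := N\<rparr>) Mod torus"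

definition opposite_borel :: "'a set" where
  "opposite_borel =
     (let w0 = coxeter_data.longest weyl_group S (carrier weyl_group)
      in w0 <#>\<^bsub>G\<^esub> B <#>\<^bsub>G\<^esub> inv\<^bsub>weyl_group\<^esub> w0)"

text \<open>\<open>double_cosets C I\<close> is \<open>C W\<^sub>I C\<close>, a standard parabolic for \<open>C = B\<close> and its opposite for
  \<open>C = B\<^sup>-\<close>.\<close>

definition double_cosets :: "'a set \<Rightarrow> 'a set set \<Rightarrow> 'a set" where
  "double_cosets C I = (\<Union>w\<in>generate weyl_group I. C <#>\<^bsub>G\<^esub> w <#>\<^bsub>G\<^esub> C)"

definition conjugate :: "'a \<Rightarrow> 'a set \<Rightarrow> 'a set" where
  "conjugate g P = (\<lambda>x. g \<otimes>\<^bsub>G\<^esub> x \<otimes>\<^bsub>G\<^esub> inv\<^bsub>G\<^esub> g) ` P"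

definition opposite_parabolics :: "'a set \<Rightarrow> 'a set \<Rightarrow> bool" where
  "opposite_parabolics P Q \<longleftrightarrow>
     (\<exists>g\<in>carrier G. \<exists>I\<subseteq>S. P = conjugate g (double_cosets B I) \<and>
        Q = conjugate g (double_cosets opposite_borel I))"

text \<open>The unipotent radical of a parabolic subgroup \<open>P\<close> is its largest normal \<open>p\<close>-subgroup.\<close>

definition unipotent_radical :: "'a set \<Rightarrow> 'a set" where
  "unipotent_radical P =
     generate G (\<Union>{Q. Q \<lhd> (G\<lparr>carrier := P\<rparr>) \<and> (\<exists>k. card Q = p ^ k)})"

end

locale finite_group_of_Lie_type = group G + BN_data G p B N S
  for G :: "'a monoid" and p :: nat and B N U :: "'a set" and S :: "'a set set" +
  assumes finite_carrier: "finite (carrier G)"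
    and prime_char: "prime p"
    and subgroup_B: "subgroup B G"
    and subgroup_N: "subgroup N G"
    and generate_BN: "generate G (B \<union> N) = carrier G"
    and torus_normal: "torus \<lhd> (G\<lparr>carrier := N\<rparr>)"
    and S_subset: "S \<subseteq> carrier weyl_group"
    and S_generates: "generate weyl_group S = carrier weyl_group"
    and S_involution: "s \<in> S \<Longrightarrow> s \<noteq> \<one>\<^bsub>weyl_group\<^esub> \<and> s \<otimes>\<^bsub>weyl_group\<^esub> s = \<one>\<^bsub>weyl_group\<^esub>"
    and BN_exchange: "\<lbrakk>s \<in> S; w \<in> carrier weyl_group\<rbrakk> \<Longrightarrow>
      s <#>\<^bsub>G\<^esub> B <#>\<^bsub>G\<^esub> w \<subseteq>
        (B <#>\<^bsub>G\<^esub> w <#>\<^bsub>G\<^esub> B) \<union> (B <#>\<^bsub>G\<^esub> (s \<otimes>\<^bsub>weyl_group\<^esub> w) <#>\<^bsub>G\<^esub> B)"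
    and BN_thick: "s \<in> S \<Longrightarrow> s <#>\<^bsub>G\<^esub> B <#>\<^bsub>G\<^esub> s \<noteq> B"
    and U_normal: "U \<lhd> (G\<lparr>carrier := B\<rparr>)"
    and U_card: "\<exists>k. card U = p ^ k"
    and B_split: "B = U <#>\<^bsub>G\<^esub> torus" "U \<inter> torus = {\<one>\<^bsub>G\<^esub>}"
    and torus_comm: "\<lbrakk>x \<in> torus; y \<in> torus\<rbrakk> \<Longrightarrow> x \<otimes>\<^bsub>G\<^esub> y = y \<otimes>\<^bsub>G\<^esub> x"
    and torus_card: "\<not> p dvd card torus"
    and saturated: "(\<Inter>n\<in>N. conjugate n B) = torus"


section \<open>Finite monoids of Lie type\<close>

locale lie_monoid_data =
  fixes M :: "'a monoid" and p :: nat and B N :: "'a set" and S :: "'a set set"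
begin

sublocale BN_data "units_of M" p B N S .

definition idempotents :: "'a set" where
  "idempotents = {e \<in> carrier M. e \<otimes>\<^bsub>M\<^esub> e = e}"

definition par :: "'a \<Rightarrow> 'a set" where
  "par e = {x \<in> Units M. x \<otimes>\<^bsub>M\<^esub> e = e \<otimes>\<^bsub>M\<^esub> x \<otimes>\<^bsub>M\<^esub> e}"

definition par_minus :: "'a \<Rightarrow> 'a set" where
  "par_minus e = {x \<in> Units M. e \<otimes>\<^bsub>M\<^esub> x = e \<otimes>\<^bsub>M\<^esub> x \<otimes>\<^bsub>M\<^esub> e}"

definition two_sided_ideal :: "'a \<Rightarrow> 'a set" where
  "two_sided_ideal a = {x \<otimes>\<^bsub>M\<^esub> a \<otimes>\<^bsub>M\<^esub> y | x y. x \<in> carrier M \<and> y \<in> carrier M}"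

definition cross_section_lattice :: "'a set" where
  "cross_section_lattice = {e \<in> idempotents. B \<subseteq> par e \<and> opposite_borel \<subseteq> par_minus e}"

text \<open>The class of \<open>a\<close> modulo \<open>T\<close> is \<open>aT\<close>. Such classes are multiplied as sets, and \<open>W = N/T\<close>
  is a subset of \<open>R\<close>.\<close>

definition renner_monoid :: "'a set monoid" where
  "renner_monoid =
     \<lparr>carrier = {x <#>\<^bsub>M\<^esub> (w <#>\<^bsub>M\<^esub> (e <#\<^bsub>M\<^esub> torus) <#>\<^bsub>M\<^esub> inv\<^bsub>weyl_group\<^esub> w) | x w e.
        x \<in> carrier weyl_group \<and> w \<in> carrier weyl_group \<and> e \<in> cross_section_lattice},
      monoid.mult = set_mult M, one = torus\<rparr>"

text \<open>This is \<open>W\<^sub>e\<close>. It need not be a standard parabolic over very small fields: take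
  \<open>G = GL\<^sub>2(F\<^sub>2) \<times> GL\<^sub>2(F\<^sub>2)\<close>, with \<open>T = 1\<close>, and \<open>M = G \<union> eG\<close> with \<open>e\<close> a central idempotent fixed by
  the normal subgroup of pairs of equal sign in \<open>S\<^sub>3 \<times> S\<^sub>3\<close>. The unique standard forms need
  it to be standard parabolic.\<close>

definition orbit_stabilizer :: "'a \<Rightarrow> 'a set set" where
  "orbit_stabilizer e = renner_orbit.stabilizer weyl_group renner_monoid (e <#\<^bsub>M\<^esub> torus)"

definition bruhat_chevalley :: "'a \<Rightarrow> 'a set \<Rightarrow> 'a set \<Rightarrow> bool" where
  "bruhat_chevalley e =
     renner_orbit.bruhat_chevalley weyl_group S renner_monoid (e <#\<^bsub>M\<^esub> torus)"

definition bruhat_chevalley_interval :: "'a \<Rightarrow> 'a set \<Rightarrow> 'a set \<Rightarrow> 'a set set" where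
  "bruhat_chevalley_interval e \<theta> \<sigma> =
     {\<tau>. bruhat_chevalley e \<theta> \<tau> \<and> bruhat_chevalley e \<tau> \<sigma>}"

definition R_polynomial :: "'a \<Rightarrow> 'a set \<Rightarrow> 'a set \<Rightarrow> int poly" where
  "R_polynomial e = renner_orbit.R_poly weyl_group S renner_monoid (e <#\<^bsub>M\<^esub> torus)"

end

locale finite_monoid_of_Lie_type =
  monoid M + lie_monoid_data M p B N S + units: finite_group_of_Lie_type "units_of M" p B N U S
  for M :: "'a monoid" and p :: nat and B N U :: "'a set" and S :: "'a set set" +
  assumes finite_monoid: "finite (carrier M)"
    and regular: "a \<in> carrier M \<Longrightarrow> \<exists>x\<in>carrier M. a \<otimes>\<^bsub>M\<^esub> x \<otimes>\<^bsub>M\<^esub> a = a"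
    and generated: "\<lbrakk>submonoid H M; Units M \<union> idempotents \<subseteq> H\<rbrakk> \<Longrightarrow> H = carrier M"
    and par_opposite: "e \<in> idempotents \<Longrightarrow> opposite_parabolics (par e) (par_minus e)"
    and radical_par: "\<lbrakk>e \<in> idempotents; x \<in> unipotent_radical (par e)\<rbrakk> \<Longrightarrow> x \<otimes>\<^bsub>M\<^esub> e = e"
    and radical_par_minus:
      "\<lbrakk>e \<in> idempotents; x \<in> unipotent_radical (par_minus e)\<rbrakk> \<Longrightarrow> e \<otimes>\<^bsub>M\<^esub> x = e"
    and J_conjugate:
      "\<lbrakk>e \<in> idempotents; f \<in> idempotents; two_sided_ideal e = two_sided_ideal f\<rbrakk>
        \<Longrightarrow> \<exists>g\<in>Units M. f = g \<otimes>\<^bsub>M\<^esub> e \<otimes>\<^bsub>M\<^esub> inv\<^bsub>M\<^esub> g"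


section \<open>Weyl groups of root systems\<close>

definition root_reflection :: "'v::euclidean_space \<Rightarrow> 'v \<Rightarrow> 'v" where
  "root_reflection \<alpha> x = x - (2 * inner x \<alpha> / inner \<alpha> \<alpha>) *\<^sub>R \<alpha>"

text \<open>A reduced crystallographic root system, not required to span the ambient space.\<close>

definition root_system :: "'v::euclidean_space set \<Rightarrow> bool" where
  "root_system \<Phi> \<longleftrightarrow> finite \<Phi> \<and> 0 \<notin> \<Phi> \<and>
     (\<forall>\<alpha>\<in>\<Phi>. root_reflection \<alpha> ` \<Phi> \<subseteq> \<Phi>) \<and>
     (\<forall>\<alpha>\<in>\<Phi>. \<forall>\<beta>\<in>\<Phi>. 2 * inner \<beta> \<alpha> / inner \<alpha> \<alpha> \<in> \<int>) \<and>
     (\<forall>\<alpha>\<in>\<Phi>. \<forall>c. c *\<^sub>R \<alpha> \<in> \<Phi> \<longrightarrow> c = 1 \<or> c = - 1)"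

definition root_base :: "'v::euclidean_space set \<Rightarrow> 'v set \<Rightarrow> bool" where
  "root_base \<Phi> \<Delta> \<longleftrightarrow> \<Delta> \<subseteq> \<Phi> \<and> independent \<Delta> \<and>
     (\<forall>\<beta>\<in>\<Phi>. \<exists>c :: 'v \<Rightarrow> int. \<beta> = (\<Sum>\<alpha>\<in>\<Delta>. of_int (c \<alpha>) *\<^sub>R \<alpha>) \<and>
        ((\<forall>\<alpha>\<in>\<Delta>. c \<alpha> \<ge> 0) \<or> (\<forall>\<alpha>\<in>\<Delta>. c \<alpha> \<le> 0)))"

definition root_weyl_group :: "'v::euclidean_space set \<Rightarrow> ('v \<Rightarrow> 'v) monoid" where
  "root_weyl_group \<Phi> =
     (BijGroup UNIV)\<lparr>carrier := generate (BijGroup UNIV) (root_reflection ` \<Phi>)\<rparr>"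


section \<open>Isomorphism of intervals\<close>

definition poset_isomorphic ::
    "('x \<Rightarrow> 'x \<Rightarrow> bool) \<Rightarrow> 'x set \<Rightarrow> ('y \<Rightarrow> 'y \<Rightarrow> bool) \<Rightarrow> 'y set \<Rightarrow> bool" where
  "poset_isomorphic r X r' Y \<longleftrightarrow>
     (\<exists>f. bij_betw f X Y \<and> (\<forall>x\<in>X. \<forall>y\<in>X. r x y \<longleftrightarrow> r' (f x) (f y)))"

end

theory Submission
  imports Defs
begin

text \<open>At \<open>q\<^sup>-\<^sup>1 = 0\<close> the Hecke algebra becomes the 0-Hecke algebra, the algebra of the monoid \<open>W\<close> with
  the Demazure product, and \<open>q^(- len w)\<close> times the bar of \<open>A\<^sub>w\<close> becomes the product \<open>K\<^sub>w\<close> of the \<open>A\<^sub>s - 1\<close>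
  along a reduced word, which is the signed sum of the \<open>A\<^sub>a\<close> with \<open>a \<le> w\<close>. So the constant terms of the
  \<open>R\<close>-polynomials of \<open>WeW\<close> are computed in a 0-Hecke module. There the transition matrices between
  the bases \<open>A\<close> and \<open>K\<close>, for minimal coset representatives over \<open>W(e)\<close>, are mutually inverse, and it
  follows that the sum of \<open>R\<^sub>\<tau>\<^sub>,\<^sub>\<sigma>(0)\<close> over \<open>\<eta> \<le> \<tau> \<le> \<sigma>\<close> is 1 if \<open>\<eta> = \<sigma>\<close> and 0 otherwise. Hence \<open>R\<^sub>\<theta>\<^sub>,\<^sub>\<sigma>(0)\<close>
  is the Moebius function of the interval. By Verma's theorem the Moebius function of a Bruhat
  interval is 1 or -1, so it is not 0.\<close>


section \<open>Groups generated by involutions\<close>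

text \<open>The combinatorics rests on one adjunction: if \<open>up s w\<close> and
  \<open>dn s w\<close> are the larger and the smaller of \<open>w\<close> and
  \<open>s \<otimes> w\<close>, then \<open>u \<le> up s w\<close> iff
  \<open>dn s u \<le> w\<close>. Hence the preimage of a principal filter under
  \<open>dem a\<close>, the Demazure product with \<open>a\<close>, is again a principal filter, and
  Verma's theorem says that \<open>K w\<close>, paired with the indicator of a principal filter,
  only detects its least element. Sums of \<open>K w\<close> over lower sets thus become existence
  statements, which is the shape of the Bruhat-Chevalley order. The obstacle is that a Demazure
  product need not be a minimal representative modulo \<open>W_e\<close>. The description of the
  order has to be extended to arbitrary left factors; this is where normality of \<open>W_e\<close>
  in \<open>W(e)\<close> enters. Of the Renner monoid the argument only needs how
  \<open>W(e)\<close> and \<open>W_e\<close> move through products \<open>x e y\<close>. Deriving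
  this requires that P(e) and its opposite are standard of one common type with respect to B and its
  opposite, whereas the axioms give them only up to a common conjugation.\<close>

lemma (in group) conj_cancel:
  assumes "x \<in> carrier G" "y \<in> carrier G"
  shows "inv x \<otimes> (x \<otimes> y) = y" "x \<otimes> (inv x \<otimes> y) = y"
  using assms by (simp_all add: m_assoc [symmetric])

locale involution_generated = coxeter_data W S + group W for W :: "'w monoid" (structure) and S +
  assumes S_carrier: "S \<subseteq> carrier W"
    and S_square: "s \<in> S \<Longrightarrow> s \<otimes> s = \<one>"
    and S_gen: "generate W S = carrier W"
begin

lemma S_closed [simp, intro]: "s \<in> S \<Longrightarrow> s \<in> carrier W"
  using S_carrier by blast

lemma S_inv [simp]: "s \<in> S \<Longrightarrow> inv s = s"
  by (simp add: S_square inv_equality)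

lemma S_cancel_left [simp]: "s \<in> S \<Longrightarrow> w \<in> carrier W \<Longrightarrow> s \<otimes> (s \<otimes> w) = w"
  by (simp add: S_square m_assoc [symmetric])

lemma S_cancel_right [simp]: "s \<in> S \<Longrightarrow> w \<in> carrier W \<Longrightarrow> w \<otimes> s \<otimes> s = w"
  by (simp add: S_square m_assoc)

lemma word_prod_Nil [simp]: "word_prod [] = \<one>"
  and word_prod_Cons [simp]: "word_prod (s # ws) = s \<otimes> word_prod ws"
  by (simp_all add: word_prod_def)

lemma word_prod_closed [simp, intro]: "set ws \<subseteq> S \<Longrightarrow> word_prod ws \<in> carrier W"
  by (induction ws) auto

lemma word_prod_append:
  "set us \<subseteq> S \<Longrightarrow> set ws \<subseteq> S \<Longrightarrow> word_prod (us @ ws) = word_prod us \<otimes> word_prod ws"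
  by (induction us) (auto simp: m_assoc)

lemma word_prod_rev: "set ws \<subseteq> S \<Longrightarrow> word_prod (rev ws) = inv (word_prod ws)"
  by (induction ws) (auto simp: word_prod_append inv_mult_group)

lemma generate_words:
  assumes "J \<subseteq> S"
  shows "w \<in> generate W J \<longleftrightarrow> (\<exists>ws. set ws \<subseteq> J \<and> word_prod ws = w)"
proof
  assume "w \<in> generate W J"
  then show "\<exists>ws. set ws \<subseteq> J \<and> word_prod ws = w"
  proof induction
    case one
    show ?case by (rule exI [of _ "[]"]) auto
  next
    case (incl h)
    then show ?case using assms by (intro exI [of _ "[h]"]) auto
  next
    case (inv h)
    then show ?case using assms by (intro exI [of _ "[h]"]) (auto simp: subset_iff)
  next
    case (eng h1 h2)
    then obtain us vs where "set us \<subseteq> J" "word_prod us = h1" "set vs \<subseteq> J" "word_prod vs = h2"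
      by blast
    then show ?case using assms
      by (intro exI [of _ "us @ vs"]) (auto simp: word_prod_append subset_trans)
  qed
next
  assume "\<exists>ws. set ws \<subseteq> J \<and> word_prod ws = w"
  then obtain ws where "set ws \<subseteq> J" "word_prod ws = w" by blast
  then show "w \<in> generate W J"
    by (induction ws arbitrary: w) (auto intro: generate.intros)
qed

lemma words_exist: "w \<in> carrier W \<Longrightarrow> \<exists>ws. set ws \<subseteq> S \<and> word_prod ws = w"
  using generate_words [of S w] S_gen by simp

lemma reduced_exists:
  assumes "w \<in> carrier W"
  shows "\<exists>ws. set ws \<subseteq> S \<and> length ws = len w \<and> word_prod ws = w"
  unfolding len_def by (rule LeastI_ex) (use words_exist [OF assms] in blast)

lemma reduced_word:
  assumes "w \<in> carrier W"
  shows "set (reduced_word w) \<subseteq> S" "length (reduced_word w) = len w"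
    "word_prod (reduced_word w) = w"
  using someI_ex [OF reduced_exists [OF assms]] unfolding reduced_word_def by auto

lemma len_word_le: "set ws \<subseteq> S \<Longrightarrow> len (word_prod ws) \<le> length ws"
  unfolding len_def by (rule Least_le) blast

lemma len_one [simp]: "len \<one> = 0"
  using len_word_le [of "[]"] by simp

lemma len_zero: "w \<in> carrier W \<Longrightarrow> len w = 0 \<Longrightarrow> w = \<one>"
  using reduced_word [of w] by auto

lemma len_gen_le: "s \<in> S \<Longrightarrow> len s \<le> 1"
  using len_word_le [of "[s]"] by simp

lemma len_mult_le:
  assumes "x \<in> carrier W" "y \<in> carrier W"
  shows "len (x \<otimes> y) \<le> len x + len y"
  using len_word_le [of "reduced_word x @ reduced_word y"] reduced_word [OF assms(1)]
    reduced_word [OF assms(2)] by (simp add: word_prod_append)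

lemma len_inv [simp]:
  assumes "w \<in> carrier W"
  shows "len (inv w) = len w"
proof -
  have le: "len (inv x) \<le> len x" if "x \<in> carrier W" for x
    using len_word_le [of "rev (reduced_word x)"] reduced_word [OF that]
    by (simp add: word_prod_rev)
  then show ?thesis using le [OF assms] le [of "inv w"] assms by (simp add: le_antisym)
qed

lemma len_gen_mult_le: "s \<in> S \<Longrightarrow> w \<in> carrier W \<Longrightarrow> len (s \<otimes> w) \<le> Suc (len w)"
  using len_mult_le [of s w] len_gen_le [of s] by force

lemma len_le_gen_mult: "s \<in> S \<Longrightarrow> w \<in> carrier W \<Longrightarrow> len w \<le> Suc (len (s \<otimes> w))"
  using len_gen_mult_le [of s "s \<otimes> w"] by simp

lemma len_mult_gen_le: "s \<in> S \<Longrightarrow> w \<in> carrier W \<Longrightarrow> len (w \<otimes> s) \<le> Suc (len w)"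
  using len_mult_le [of w s] len_gen_le [of s] by force

lemma len_le_mult_gen: "s \<in> S \<Longrightarrow> w \<in> carrier W \<Longrightarrow> len w \<le> Suc (len (w \<otimes> s))"
  using len_mult_gen_le [of s "w \<otimes> s"] by simp

lemma finite_bounded_len:
  assumes "finite S"
  shows "finite {w \<in> carrier W. len w \<le> n}"
proof (rule finite_subset)
  show "{w \<in> carrier W. len w \<le> n} \<subseteq> word_prod ` {ws. set ws \<subseteq> S \<and> length ws \<le> n}"
    using reduced_word by (auto simp: image_iff) metis
  show "finite (word_prod ` {ws. set ws \<subseteq> S \<and> length ws \<le> n})"
    using assms by (intro finite_imageI finite_lists_length_le)
qed

lemma reduced_tail:
  assumes "set (s # ws) \<subseteq> S" "len (word_prod (s # ws)) = length (s # ws)"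
  shows "len (word_prod ws) = length ws" "len (word_prod ws) < len (s \<otimes> word_prod ws)"
proof -
  have "len (word_prod ws) \<le> length ws" using assms(1) by (intro len_word_le) auto
  moreover have "len (s \<otimes> word_prod ws) \<le> Suc (len (word_prod ws))"
    using assms(1) by (intro len_gen_mult_le) auto
  ultimately show "len (word_prod ws) = length ws" "len (word_prod ws) < len (s \<otimes> word_prod ws)"
    using assms(2) by auto
qed

lemma reduced_init:
  assumes "set (ws @ [r]) \<subseteq> S" "len (word_prod (ws @ [r])) = length (ws @ [r])"
  shows "len (word_prod ws) = length ws" "len (word_prod ws) < len (word_prod ws \<otimes> r)"
    "word_prod (ws @ [r]) = word_prod ws \<otimes> r"
proof -
  show e: "word_prod (ws @ [r]) = word_prod ws \<otimes> r" using assms(1) by (simp add: word_prod_append)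
  have "len (word_prod ws) \<le> length ws" "len (word_prod ws \<otimes> r) \<le> Suc (len (word_prod ws))"
    using assms(1) by (auto intro: len_word_le len_mult_gen_le)
  then show "len (word_prod ws) = length ws" "len (word_prod ws) < len (word_prod ws \<otimes> r)"
    using assms(2) e by auto
qed

text \<open>Multiplication by \<open>s\<close> cancels the letter with which the word last leaves
  \<open>P\<close>: there \<open>fold\<close> gives \<open>s \<otimes> w = w \<otimes> r\<close>, so
  \<open>s \<otimes> (w \<otimes> r) = w\<close>. Each letter after it adds at most one to the
  length.\<close>

lemma halfspace_crossing:
  assumes s: "s \<in> S" and ws: "set ws \<subseteq> S" and start: "\<one> \<in> P" and stop: "word_prod ws \<notin> P"
    and fold: "\<And>w r. \<lbrakk>w \<in> P; w \<in> carrier W; r \<in> S; w \<otimes> r \<notin> P\<rbrakk> \<Longrightarrow> s \<otimes> w = w \<otimes> r"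
  shows "len (s \<otimes> word_prod ws) < length ws"
  using ws stop
proof (induction ws rule: rev_induct)
  case Nil
  then show ?case using start by simp
next
  case (snoc r ws)
  then have cl: "set ws \<subseteq> S" "r \<in> S" "word_prod ws \<in> carrier W" by auto
  show ?case
  proof (cases "word_prod ws \<in> P")
    case True
    then have "s \<otimes> word_prod ws = word_prod ws \<otimes> r"
      using snoc.prems cl by (intro fold) (auto simp: word_prod_append)
    then have "s \<otimes> word_prod (ws @ [r]) = word_prod ws"
      using cl s by (simp add: word_prod_append m_assoc [symmetric])
    then show ?thesis using len_word_le [OF cl(1)] by simp
  next
    case False
    then have "len (s \<otimes> word_prod ws) < length ws" using snoc cl by simp
    moreover have "len (s \<otimes> word_prod (ws @ [r])) \<le> Suc (len (s \<otimes> word_prod ws))"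
      using cl s len_mult_gen_le [of r "s \<otimes> word_prod ws"] by (simp add: word_prod_append m_assoc)
    ultimately show ?thesis by simp
  qed
qed

text \<open>This is the criterion of Bourbaki, Lie IV.1.7, for the exchange condition.\<close>

lemma halfspace_len:
  assumes s: "s \<in> S" and one: "\<one> \<in> P"
    and disj: "\<And>w. w \<in> carrier W \<Longrightarrow> w \<in> P \<Longrightarrow> s \<otimes> w \<notin> P"
    and fold: "\<And>w r. \<lbrakk>w \<in> P; w \<in> carrier W; r \<in> S; w \<otimes> r \<notin> P\<rbrakk> \<Longrightarrow> s \<otimes> w = w \<otimes> r"
    and w: "w \<in> carrier W"
  shows "(w \<in> P \<longrightarrow> len w < len (s \<otimes> w)) \<and> (w \<notin> P \<longrightarrow> len (s \<otimes> w) < len w)"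
proof -
  have out: "len (s \<otimes> x) < len x" if "x \<in> carrier W" "x \<notin> P" for x
  proof -
    have "len (s \<otimes> word_prod (reduced_word x)) < length (reduced_word x)"
      by (rule halfspace_crossing [where P = P]) (use reduced_word [OF that(1)] that s one fold in auto)
    then show ?thesis using reduced_word [OF that(1)] by simp
  qed
  \<comment> \<open>An element of \<open>P\<close> is moved out of \<open>P\<close> by
    \<open>s\<close>, so the bound for outside elements, applied to \<open>s \<otimes> w\<close>,
    gives the other half.\<close>
  show ?thesis using out [OF w] out [of "s \<otimes> w"] disj [OF w] w s by auto
qed

end


section \<open>Coxeter groups\<close>

text \<open>The folding condition says that an edge of the Cayley graph leaving the half-space
  \<open>len w < len (s \<otimes> w)\<close> is flipped by \<open>s\<close>; it is equivalent to the exchange condition.\<close>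

locale coxeter_group = involution_generated W S for W :: "'w monoid" (structure) and S +
  assumes S_finite: "finite S"
    and len_gen_neq: "s \<in> S \<Longrightarrow> w \<in> carrier W \<Longrightarrow> len (s \<otimes> w) \<noteq> len w"
    and folding: "\<lbrakk>s \<in> S; r \<in> S; w \<in> carrier W; len w < len (s \<otimes> w);
      len (s \<otimes> w \<otimes> r) < len (w \<otimes> r)\<rbrakk> \<Longrightarrow> s \<otimes> w = w \<otimes> r"

text \<open>Only the half-spaces \<open>P s\<close> have to be found: by
  \<open>halfspace_len\<close> they coincide with those defined by length, so \<open>folding\<close>
  becomes the hypothesis on \<open>P\<close>. They come from positive roots for root systems and
  from double cosets for BN-pairs.\<close>

lemma (in involution_generated) coxeter_groupI:
  assumes "finite S"
    and one: "\<And>s. s \<in> S \<Longrightarrow> \<one> \<in> P s"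
    and disj: "\<And>s w. s \<in> S \<Longrightarrow> w \<in> carrier W \<Longrightarrow> w \<in> P s \<Longrightarrow> s \<otimes> w \<notin> P s"
    and fold: "\<And>s w r. \<lbrakk>s \<in> S; w \<in> P s; w \<in> carrier W; r \<in> S; w \<otimes> r \<notin> P s\<rbrakk> \<Longrightarrow> s \<otimes> w = w \<otimes> r"
  shows "coxeter_group W S"
proof unfold_locales
  have half: "(w \<in> P s \<longrightarrow> len w < len (s \<otimes> w)) \<and> (w \<notin> P s \<longrightarrow> len (s \<otimes> w) < len w)"
    if "s \<in> S" "w \<in> carrier W" for s w
    by (rule halfspace_len) (use assms that in auto)
  show "len (s \<otimes> w) \<noteq> len w" if "s \<in> S" "w \<in> carrier W" for s w
    using half [OF that] by auto
  show "s \<otimes> w = w \<otimes> r" if "s \<in> S" "r \<in> S" "w \<in> carrier W" "len w < len (s \<otimes> w)"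
      "len (s \<otimes> w \<otimes> r) < len (w \<otimes> r)" for s r w
  proof (rule fold [of s w r])
    show "w \<in> P s" using half [of s w] that by auto
    show "w \<otimes> r \<notin> P s" using half [of s "w \<otimes> r"] that by (auto simp: m_assoc)
  qed (use that in auto)
qed (rule assms(1))

context coxeter_group
begin

lemma len_gen_cases:
  assumes "s \<in> S" "w \<in> carrier W"
  obtains "len (s \<otimes> w) = Suc (len w)" | "len w = Suc (len (s \<otimes> w))"
  using len_gen_mult_le [OF assms] len_le_gen_mult [OF assms] len_gen_neq [OF assms] by force

lemma len_gen_neq_right: "s \<in> S \<Longrightarrow> w \<in> carrier W \<Longrightarrow> len (w \<otimes> s) \<noteq> len w"
  using len_gen_neq [of s "inv w"] len_inv [of "w \<otimes> s"] by (simp add: inv_mult_group)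

lemma len_gen_cases_right:
  assumes "s \<in> S" "w \<in> carrier W"
  obtains "len (w \<otimes> s) = Suc (len w)" | "len w = Suc (len (w \<otimes> s))"
  using len_mult_gen_le [OF assms] len_le_mult_gen [OF assms] len_gen_neq_right [OF assms] by force

lemma len_gen [simp]: "s \<in> S \<Longrightarrow> len s = 1"
  using len_gen_le [of s] len_gen_neq [of s \<one>] by simp

section \<open>Reflections and the strong exchange condition\<close>

definition reflections :: "'w set" where
  "reflections = {g \<otimes> s \<otimes> inv g | g s. g \<in> carrier W \<and> s \<in> S}"

lemma reflection_closed [simp, intro]: "t \<in> reflections \<Longrightarrow> t \<in> carrier W"
  by (auto simp: reflections_def)

lemma gen_reflection: "s \<in> S \<Longrightarrow> s \<in> reflections"
  unfolding reflections_def by (intro CollectI exI [of _ \<one>] exI [of _ s]) auto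

lemma reflection_conj:
  assumes "t \<in> reflections" "x \<in> carrier W"
  shows "x \<otimes> t \<otimes> inv x \<in> reflections"
proof -
  obtain g s where "t = g \<otimes> s \<otimes> inv g" "g \<in> carrier W" "s \<in> S"
    using assms unfolding reflections_def by blast
  then show ?thesis using assms unfolding reflections_def
    by (intro CollectI exI [of _ "x \<otimes> g"] exI [of _ s]) (simp add: m_assoc inv_mult_group)
qed

lemma reflection_square:
  assumes "t \<in> reflections" "x \<in> carrier W"
  shows "t \<otimes> (t \<otimes> x) = x"
proof -
  obtain g s where "t = g \<otimes> s \<otimes> inv g" "g \<in> carrier W" "s \<in> S"
    using assms unfolding reflections_def by blast
  then show ?thesis using assms by (simp add: m_assoc conj_cancel)
qed

text \<open>For \<open>t = g \<otimes> s \<otimes> inv g\<close> the side is the translate by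
  \<open>g\<close> of the half-space \<open>len w < len (s \<otimes> w)\<close>. The translate need
  not contain the identity, so both sides are treated symmetrically.\<close>

lemma reflection_sides:
  assumes "t \<in> reflections"
  obtains P where "\<And>x. x \<in> carrier W \<Longrightarrow> t \<otimes> x \<in> P \<longleftrightarrow> x \<notin> P"
    "\<And>x r. \<lbrakk>x \<in> carrier W; r \<in> S; (x \<in> P) \<noteq> (x \<otimes> r \<in> P)\<rbrakk> \<Longrightarrow> t \<otimes> x = x \<otimes> r"
proof -
  obtain g s where t: "t = g \<otimes> s \<otimes> inv g" and g: "g \<in> carrier W" and s: "s \<in> S"
    using assms unfolding reflections_def by blast
  define P where "P = {x. len (inv g \<otimes> x) < len (s \<otimes> (inv g \<otimes> x))}"
  have neq: "len (inv g \<otimes> x) \<noteq> len (s \<otimes> (inv g \<otimes> x))" if "x \<in> carrier W" for x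
    using len_gen_neq [of s "inv g \<otimes> x"] s g that by auto
  have flip: "t \<otimes> x \<in> P \<longleftrightarrow> x \<notin> P" if "x \<in> carrier W" for x
    using neq [OF that] s g that by (auto simp: P_def t m_assoc conj_cancel)
  have cross: "t \<otimes> x = x \<otimes> r" if "x \<in> carrier W" "r \<in> S" "x \<in> P" "x \<otimes> r \<notin> P" for x r
  proof -
    have "s \<otimes> (inv g \<otimes> x) = inv g \<otimes> x \<otimes> r"
      using that s g neq [of "x \<otimes> r"]
      by (intro folding) (auto simp: P_def m_assoc)
    then have "g \<otimes> (s \<otimes> (inv g \<otimes> x)) = g \<otimes> (inv g \<otimes> x \<otimes> r)" by simp
    then show ?thesis using that s g by (simp add: t m_assoc conj_cancel)
  qed
  have cross': "t \<otimes> x = x \<otimes> r"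
    if "x \<in> carrier W" "r \<in> S" "(x \<in> P) \<noteq> (x \<otimes> r \<in> P)" for x r
  proof (cases "x \<in> P")
    case True
    then show ?thesis using that by (intro cross) auto
  next
    case False
    then have "t \<otimes> (x \<otimes> r) = x \<otimes> r \<otimes> r" using that by (intro cross) auto
    then have "t \<otimes> (t \<otimes> (x \<otimes> r)) = t \<otimes> x" using that by simp
    then show ?thesis using that assms reflection_square [of t "x \<otimes> r"] by simp
  qed
  show thesis by (rule that [OF flip cross'])
qed

text \<open>The letter that disappears is the one at the last crossing of the wall of
  \<open>t\<close>: there \<open>t\<close> exchanges the positions before and after the letter. The
  word need not be reduced and may cross the wall several times.\<close>

lemma crossing_omits:
  assumes "t \<in> reflections" "set ws \<subseteq> S" "(\<one> \<in> P) \<noteq> (word_prod ws \<in> P)"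
    and cross: "\<And>x r. \<lbrakk>x \<in> carrier W; r \<in> S; (x \<in> P) \<noteq> (x \<otimes> r \<in> P)\<rbrakk> \<Longrightarrow> t \<otimes> x = x \<otimes> r"
  shows "\<exists>us r vs. ws = us @ r # vs \<and> t \<otimes> word_prod ws = word_prod (us @ vs)"
  using assms(2,3)
proof (induction ws rule: rev_induct)
  case Nil
  then show ?case by simp
next
  case (snoc r ws)
  then have cl: "set ws \<subseteq> S" "r \<in> S" "word_prod ws \<in> carrier W" by auto
  show ?case
  proof (cases "(word_prod ws \<in> P) = (\<one> \<in> P)")
    case True
    then have "t \<otimes> word_prod ws = word_prod ws \<otimes> r"
      using snoc.prems cl by (intro cross) (auto simp: word_prod_append)
    then have "t \<otimes> word_prod (ws @ [r]) = word_prod (ws @ [])"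
      using cl assms(1) by (simp add: word_prod_append m_assoc [symmetric])
    then show ?thesis by blast
  next
    case False
    then obtain us r' vs where
      o: "ws = us @ r' # vs" "t \<otimes> word_prod ws = word_prod (us @ vs)"
      using snoc cl by blast
    then have "t \<otimes> word_prod (ws @ [r]) = word_prod (us @ vs @ [r])"
      using cl assms(1) by (simp add: word_prod_append m_assoc [symmetric])
    then show ?thesis using o by (metis append.assoc append_Cons)
  qed
qed

text \<open>\<open>t\<close> shortens exactly the elements that its wall separates from the
  identity. For those a letter of a reduced word is omitted; for the others the same is applied to
  \<open>t \<otimes> w\<close>. Both claims use the same side \<open>P\<close>, hence the joint
  statement.\<close>

lemma reflection_len_neq_omit:
  assumes t: "t \<in> reflections" and w: "w \<in> carrier W"
  shows "len (t \<otimes> w) \<noteq> len w"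
    "len (t \<otimes> w) < len w \<Longrightarrow> set ws \<subseteq> S \<Longrightarrow> word_prod ws = w \<Longrightarrow>
      \<exists>us r vs. ws = us @ r # vs \<and> t \<otimes> w = word_prod (us @ vs)"
proof -
  obtain P where flip: "\<And>x. x \<in> carrier W \<Longrightarrow> t \<otimes> x \<in> P \<longleftrightarrow> x \<notin> P"
    and cross: "\<And>x r. \<lbrakk>x \<in> carrier W; r \<in> S; (x \<in> P) \<noteq> (x \<otimes> r \<in> P)\<rbrakk> \<Longrightarrow> t \<otimes> x = x \<otimes> r"
    using reflection_sides [OF t] by metis
  have far: "len (t \<otimes> x) < len x" if x: "x \<in> carrier W" "(\<one> \<in> P) \<noteq> (x \<in> P)" for x
  proof -
    obtain us r vs where us: "reduced_word x = us @ r # vs" "t \<otimes> x = word_prod (us @ vs)"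
      using crossing_omits [OF t, of "reduced_word x" P] reduced_word [OF x(1)] x cross by auto
    have "set (us @ vs) \<subseteq> S" using us reduced_word [OF x(1)] by auto
    then have "len (t \<otimes> x) \<le> length (us @ vs)" using us len_word_le [of "us @ vs"] by auto
    then show ?thesis using us reduced_word [OF x(1)] by (metis add_Suc_right length_Cons length_append less_Suc_eq_le)
  qed
  have near: "len w < len (t \<otimes> w)" if "(\<one> \<in> P) = (w \<in> P)"
    using far [of "t \<otimes> w"] flip [OF w] that t w by (auto simp: reflection_square)
  show "len (t \<otimes> w) \<noteq> len w" using far [OF w] near by fastforce
  show "\<exists>us r vs. ws = us @ r # vs \<and> t \<otimes> w = word_prod (us @ vs)"
    if "len (t \<otimes> w) < len w" "set ws \<subseteq> S" "word_prod ws = w"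
  proof -
    have "(\<one> \<in> P) \<noteq> (word_prod ws \<in> P)" using near that by fastforce
    then show ?thesis using crossing_omits [OF t that(2) _ cross] that(3) by blast
  qed
qed

lemmas reflection_len_neq = reflection_len_neq_omit(1)
lemmas strong_exchange = reflection_len_neq_omit(2)

text \<open>Right multiplication of \<open>w\<close> by \<open>s\<close> is left multiplication by
  the reflection \<open>w \<otimes> s \<otimes> inv w\<close>.\<close>

lemma exchange_right:
  assumes "s \<in> S" "set ws \<subseteq> S" "len (word_prod ws \<otimes> s) < len (word_prod ws)"
  shows "\<exists>us r vs. ws = us @ r # vs \<and> word_prod ws \<otimes> s = word_prod (us @ vs)"
proof -
  have cl: "word_prod ws \<in> carrier W" using assms by auto
  let ?t = "word_prod ws \<otimes> s \<otimes> inv (word_prod ws)"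
  have "?t \<in> reflections" using reflection_conj gen_reflection assms cl by blast
  moreover have "?t \<otimes> word_prod ws = word_prod ws \<otimes> s"
    using cl assms by (simp add: m_assoc)
  ultimately show ?thesis using strong_exchange [of ?t "word_prod ws" ws] assms cl by auto
qed

text \<open>The mirror image of \<open>folding\<close>. Neighbouring lengths differ by at most one,
  which turns the two right-hand comparisons into the left-hand ones.\<close>

lemma folding_right:
  assumes "s \<in> S" "r \<in> S" "w \<in> carrier W" "len w < len (w \<otimes> r)"
    "len (s \<otimes> w \<otimes> r) < len (s \<otimes> w)"
  shows "s \<otimes> w = w \<otimes> r"
proof -
  have "len (w \<otimes> r) \<le> Suc (len (s \<otimes> w \<otimes> r))"
    using len_le_gen_mult [of s "w \<otimes> r"] assms by (simp add: m_assoc)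
  moreover have "len (s \<otimes> w) \<le> Suc (len w)" using len_gen_mult_le assms by auto
  ultimately show ?thesis using assms by (intro folding) auto
qed

end

context coxeter_group
begin

subsection \<open>Bruhat order\<close>

text \<open>The reflection in \<open>bruhat_step\<close> multiplies on the right; conjugation by
  \<open>u\<close> moves it to the left, the side on which \<open>strong_exchange\<close> is
  stated.\<close>

lemma bruhat_step_iff:
  assumes "u \<in> carrier W"
  shows "bruhat_step u v \<longleftrightarrow> (\<exists>t\<in>reflections. v = t \<otimes> u) \<and> len u < len v"
proof -
  have "(\<exists>w\<in>carrier W. \<exists>s\<in>S. v = u \<otimes> (w \<otimes> s \<otimes> inv w)) \<longleftrightarrow> (\<exists>t\<in>reflections. v = u \<otimes> t)"
    unfolding reflections_def by blast
  also have "\<dots> \<longleftrightarrow> (\<exists>t\<in>reflections. v = t \<otimes> u)"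
  proof
    assume "\<exists>t\<in>reflections. v = u \<otimes> t"
    then obtain t where "t \<in> reflections" "v = u \<otimes> t" by blast
    then show "\<exists>t\<in>reflections. v = t \<otimes> u"
      using assms by (intro bexI [of _ "u \<otimes> t \<otimes> inv u"] reflection_conj) (auto simp: m_assoc)
  next
    assume "\<exists>t\<in>reflections. v = t \<otimes> u"
    then obtain t where t: "t \<in> reflections" "v = t \<otimes> u" by blast
    then show "\<exists>t\<in>reflections. v = u \<otimes> t"
      using assms reflection_conj [of t "inv u"]
      by (intro bexI [of _ "inv u \<otimes> t \<otimes> u"]) (auto simp: m_assoc conj_cancel)
  qed
  finally show ?thesis unfolding bruhat_step_def by blast
qed

lemma bruhat_stepI:
  "t \<in> reflections \<Longrightarrow> u \<in> carrier W \<Longrightarrow> len u < len (t \<otimes> u) \<Longrightarrow> bruhat_step u (t \<otimes> u)"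
  using bruhat_step_iff by blast

lemma bruhat_carrier: "bruhat u v \<Longrightarrow> u \<in> carrier W \<and> v \<in> carrier W"
  unfolding bruhat_def by blast

lemma bruhat_refl [simp]: "u \<in> carrier W \<Longrightarrow> bruhat u u"
  unfolding bruhat_def by blast

lemma bruhat_trans: "bruhat u v \<Longrightarrow> bruhat v w \<Longrightarrow> bruhat u w"
  unfolding bruhat_def by (meson rtranclp_trans)

lemma bruhat_step_closed: "bruhat_step u v \<Longrightarrow> u \<in> carrier W \<Longrightarrow> v \<in> carrier W"
  using bruhat_step_iff by auto

lemma bruhat_step_bruhat: "bruhat_step u v \<Longrightarrow> u \<in> carrier W \<Longrightarrow> bruhat u v"
  using bruhat_step_closed unfolding bruhat_def by blast

lemma bruhat_induct [consumes 1, case_names refl step]: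
  assumes "bruhat u v" and "u \<in> carrier W \<Longrightarrow> P u"
    and "\<And>x y. \<lbrakk>bruhat u x; bruhat_step x y; x \<in> carrier W; y \<in> carrier W; P x\<rbrakk> \<Longrightarrow> P y"
  shows "P v"
proof -
  have u: "u \<in> carrier W" using assms(1) bruhat_carrier by blast
  have "bruhat_step\<^sup>*\<^sup>* u v" using assms(1) unfolding bruhat_def by blast
  then have "v \<in> carrier W \<and> bruhat u v \<and> P v"
  proof induction
    case base
    then show ?case using assms(2) u by simp
  next
    case (step y z)
    then show ?case using assms(3) bruhat_step_closed bruhat_trans bruhat_step_bruhat by metis
  qed
  then show ?thesis by blast
qed

lemma bruhat_len: "bruhat u v \<Longrightarrow> len u \<le> len v"
  by (induction rule: bruhat_induct) (auto simp: bruhat_step_def)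

lemma bruhat_len_eq:
  assumes "bruhat u v" "len v \<le> len u"
  shows "u = v"
proof -
  have "u = v \<or> len u < len v"
    using assms(1) by (induction rule: bruhat_induct) (auto simp: bruhat_step_def)
  then show ?thesis using assms by auto
qed

lemma bruhat_antisym: "bruhat u v \<Longrightarrow> bruhat v u \<Longrightarrow> u = v"
  using bruhat_len_eq bruhat_len by blast

lemma bruhat_inv:
  assumes "bruhat u v"
  shows "bruhat (inv u) (inv v)"
  using assms
proof (induction rule: bruhat_induct)
  case refl
  then show ?case using assms bruhat_carrier by auto
next
  case (step x y)
  then obtain t where t: "t \<in> reflections" "y = t \<otimes> x" "len x < len y"
    using bruhat_step_iff by blast
  have r: "inv x \<otimes> t \<otimes> inv (inv x) \<in> reflections"
    using t step by (intro reflection_conj) auto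
  have t_inv: "inv t = t"
    using reflection_square [OF t(1), of \<one>] t(1) by (simp add: inv_equality)
  have "inv y = (inv x \<otimes> t \<otimes> inv (inv x)) \<otimes> inv x"
    using t step by (simp add: inv_mult_group t_inv m_assoc conj_cancel)
  then have "bruhat_step (inv x) (inv y)"
    using r t step len_inv [of x] len_inv [of y] by (simp only: bruhat_step_iff inv_closed) auto
  then show ?case using step bruhat_trans bruhat_step_bruhat by blast
qed

lemma finite_lower: "finite {a. bruhat a w}"
  by (rule finite_subset [OF _ finite_bounded_len [OF S_finite, of "len w"]])
    (auto dest: bruhat_len bruhat_carrier)

section \<open>The lifting property as an adjunction\<close>

definition up :: "'w \<Rightarrow> 'w \<Rightarrow> 'w" where
  "up s w = (if len w < len (s \<otimes> w) then s \<otimes> w else w)"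

definition dn :: "'w \<Rightarrow> 'w \<Rightarrow> 'w" where
  "dn s w = (if len w < len (s \<otimes> w) then w else s \<otimes> w)"

lemma up_closed [simp, intro]: "s \<in> S \<Longrightarrow> w \<in> carrier W \<Longrightarrow> up s w \<in> carrier W"
  and dn_closed [simp, intro]: "s \<in> S \<Longrightarrow> w \<in> carrier W \<Longrightarrow> dn s w \<in> carrier W"
  by (auto simp: up_def dn_def)

lemma gen_bruhat_cases:
  assumes "s \<in> S" "w \<in> carrier W"
  shows "len w < len (s \<otimes> w) \<Longrightarrow> bruhat w (s \<otimes> w)"
    "\<not> len w < len (s \<otimes> w) \<Longrightarrow> bruhat (s \<otimes> w) w"
proof -
  show "len w < len (s \<otimes> w) \<Longrightarrow> bruhat w (s \<otimes> w)"
    using assms by (intro bruhat_step_bruhat bruhat_stepI gen_reflection) auto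
  assume "\<not> len w < len (s \<otimes> w)"
  then have "len (s \<otimes> w) < len (s \<otimes> (s \<otimes> w))" using len_gen_neq [OF assms] assms by auto
  then have "bruhat (s \<otimes> w) (s \<otimes> (s \<otimes> w))"
    using assms by (intro bruhat_step_bruhat bruhat_stepI gen_reflection) auto
  then show "bruhat (s \<otimes> w) w" using assms by simp
qed

lemma le_up: "s \<in> S \<Longrightarrow> w \<in> carrier W \<Longrightarrow> bruhat w (up s w)"
  and gen_le_up: "s \<in> S \<Longrightarrow> w \<in> carrier W \<Longrightarrow> bruhat (s \<otimes> w) (up s w)"
  and dn_le: "s \<in> S \<Longrightarrow> w \<in> carrier W \<Longrightarrow> bruhat (dn s w) w"
  and dn_le_gen: "s \<in> S \<Longrightarrow> w \<in> carrier W \<Longrightarrow> bruhat (dn s w) (s \<otimes> w)"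
  using gen_bruhat_cases [of s w] by (auto simp: up_def dn_def)

lemma up_idem [simp]: "s \<in> S \<Longrightarrow> w \<in> carrier W \<Longrightarrow> up s (up s w) = up s w"
  by (auto simp: up_def)

lemma up_dn: "s \<in> S \<Longrightarrow> w \<in> carrier W \<Longrightarrow> up s (dn s w) = up s w"
  and dn_up: "s \<in> S \<Longrightarrow> w \<in> carrier W \<Longrightarrow> dn s (up s w) = dn s w"
  and up_gen: "s \<in> S \<Longrightarrow> w \<in> carrier W \<Longrightarrow> up s (s \<otimes> w) = up s w"
  and dn_gen: "s \<in> S \<Longrightarrow> w \<in> carrier W \<Longrightarrow> dn s (s \<otimes> w) = dn s w"
  using len_gen_neq [of s w] by (auto simp: up_def dn_def)

text \<open>Multiplication by \<open>s\<close> turns the edge from \<open>u\<close> to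
  \<open>t \<otimes> u\<close> into an edge along the reflection
  \<open>s \<otimes> t \<otimes> s\<close>. If that edge pointed downwards, strong exchange would
  delete a letter of the possibly unreduced word made of \<open>s\<close> and a reduced word of
  \<open>u\<close>: deleting \<open>s\<close> gives \<open>v = s \<otimes> u\<close>, deleting any
  other letter writes \<open>v\<close> with fewer than \<open>len u\<close> letters.\<close>

lemma step_gen:
  assumes "bruhat_step u v" "u \<in> carrier W" "s \<in> S"
  shows "v = s \<otimes> u \<or> bruhat (s \<otimes> u) (s \<otimes> v)"
proof -
  obtain t where t: "t \<in> reflections" "v = t \<otimes> u" and less: "len u < len v"
    using bruhat_step_iff assms by blast
  let ?t = "s \<otimes> t \<otimes> inv s"
  have r: "?t \<in> reflections" using t assms by (intro reflection_conj) auto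
  have sv: "s \<otimes> v = ?t \<otimes> (s \<otimes> u)" using t assms by (simp add: m_assoc)
  have cl: "s \<otimes> u \<in> carrier W" "v \<in> carrier W" using t assms by auto
  show ?thesis
  proof (cases "len (s \<otimes> u) < len (s \<otimes> v)")
    case True
    then show ?thesis using sv r cl bruhat_stepI bruhat_step_bruhat by metis
  next
    case False
    then have lt: "len (?t \<otimes> (s \<otimes> u)) < len (s \<otimes> u)"
      using reflection_len_neq [OF r cl(1)] sv by auto
    obtain us r' vs where o: "s # reduced_word u = us @ r' # vs" "s \<otimes> v = word_prod (us @ vs)"
      using strong_exchange [OF r cl(1) lt, of "s # reduced_word u"] reduced_word [OF assms(2)]
        assms(3) sv by auto
    show ?thesis
    proof (cases us)
      case Nil
      then have "s \<otimes> v = u" using o reduced_word [OF assms(2)] by simp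
      then show ?thesis using assms cl by (metis S_cancel_left)
    next
      case (Cons a us')
      then have u: "reduced_word u = us' @ r' # vs" "s \<otimes> v = s \<otimes> word_prod (us' @ vs)"
        using o by auto
      then have sub: "set (us' @ vs) \<subseteq> S" using reduced_word [OF assms(2)] by auto
      then have "v = word_prod (us' @ vs)"
        using u cl assms by (metis S_cancel_left word_prod_closed)
      then have "len v \<le> length (us' @ vs)" using len_word_le [OF sub] by simp
      also have "\<dots> < len u" using u reduced_word(2) [OF assms(2)] by simp
      finally show ?thesis using less by simp
    qed
  qed
qed

lemma up_dn_mono_step:
  assumes "bruhat_step u v" "u \<in> carrier W" "s \<in> S"
  shows "bruhat (up s u) (up s v) \<and> bruhat (dn s u) (dn s v)"
proof -
  have uv: "bruhat u v" "v \<in> carrier W" using assms bruhat_step_bruhat bruhat_step_closed by auto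
  from step_gen [OF assms] show ?thesis
  proof
    assume "v = s \<otimes> u"
    then show ?thesis using assms by (auto simp: up_gen dn_gen)
  next
    assume s: "bruhat (s \<otimes> u) (s \<otimes> v)"
    have "bruhat (up s u) (up s v)"
      using bruhat_trans [OF uv(1) le_up [OF assms(3) uv(2)]]
        bruhat_trans [OF s gen_le_up [OF assms(3) uv(2)]] by (auto simp: up_def [of s u])
    moreover have "bruhat (dn s u) (dn s v)"
      using bruhat_trans [OF dn_le [OF assms(3,2)] uv(1)]
        bruhat_trans [OF dn_le_gen [OF assms(3,2)] s] by (auto simp: dn_def [of s v])
    ultimately show ?thesis by blast
  qed
qed

lemma up_mono: "bruhat u v \<Longrightarrow> s \<in> S \<Longrightarrow> bruhat (up s u) (up s v)"
proof (induction rule: bruhat_induct)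
  case refl
  then show ?case by simp
next
  case (step x y)
  then show ?case using up_dn_mono_step bruhat_trans by blast
qed

lemma dn_mono: "bruhat u v \<Longrightarrow> s \<in> S \<Longrightarrow> bruhat (dn s u) (dn s v)"
proof (induction rule: bruhat_induct)
  case refl
  then show ?case by simp
next
  case (step x y)
  then show ?case using up_dn_mono_step bruhat_trans by blast
qed

text \<open>A Galois connection: both operators are monotone, and each absorbs the other through
  \<open>dn s (up s w) = dn s w\<close> and \<open>up s (dn s w) = up s w\<close>.\<close>

lemma le_up_iff_dn_le:
  assumes "s \<in> S" "u \<in> carrier W" "w \<in> carrier W"
  shows "bruhat u (up s w) \<longleftrightarrow> bruhat (dn s u) w"
proof
  assume "bruhat u (up s w)"
  then have "bruhat (dn s u) (dn s w)" using dn_mono assms dn_up by metis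
  then show "bruhat (dn s u) w" using dn_le assms bruhat_trans by blast
next
  assume "bruhat (dn s u) w"
  then have "bruhat (up s u) (up s w)" using up_mono assms up_dn by metis
  then show "bruhat u (up s w)" using le_up assms bruhat_trans by blast
qed

definition rup :: "'w \<Rightarrow> 'w \<Rightarrow> 'w" where
  "rup r w = (if len w < len (w \<otimes> r) then w \<otimes> r else w)"

lemma rup_closed [simp, intro]: "s \<in> S \<Longrightarrow> w \<in> carrier W \<Longrightarrow> rup s w \<in> carrier W"
  by (auto simp: rup_def)

lemma rup_up:
  assumes "r \<in> S" "w \<in> carrier W"
  shows "rup r w = inv (up r (inv w))"
proof -
  have "inv (w \<otimes> r) = r \<otimes> inv w" using assms by (simp add: inv_mult_group)
  then show ?thesis using assms len_inv [of "w \<otimes> r"]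
    by (auto simp: rup_def up_def inv_mult_group)
qed

lemma rup_mono: "bruhat u v \<Longrightarrow> r \<in> S \<Longrightarrow> bruhat (rup r u) (rup r v)"
  using bruhat_inv up_mono bruhat_carrier rup_up by metis

lemma le_rup: "r \<in> S \<Longrightarrow> w \<in> carrier W \<Longrightarrow> bruhat w (rup r w)"
  using bruhat_inv [OF le_up [of r "inv w"]] by (simp add: rup_up)

lemma mult_gen_le_rup: "r \<in> S \<Longrightarrow> w \<in> carrier W \<Longrightarrow> bruhat (w \<otimes> r) (rup r w)"
  using bruhat_inv [OF gen_le_up [of r "inv w"]] by (simp add: rup_up inv_mult_group)

text \<open>After inversion this is the adjunction for an element that \<open>dn r\<close>
  fixes.\<close>

lemma le_rup_ascent:
  assumes "r \<in> S" "u \<in> carrier W" "w \<in> carrier W" "bruhat u (rup r w)" "len u < len (u \<otimes> r)"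
  shows "bruhat u w"
proof -
  have "bruhat (inv u) (up r (inv w))" using bruhat_inv [OF assms(4)] assms by (simp add: rup_up)
  then have "bruhat (dn r (inv u)) (inv w)" using le_up_iff_dn_le assms by auto
  moreover have "dn r (inv u) = inv u"
    using assms len_inv [of "u \<otimes> r"] by (simp add: dn_def inv_mult_group)
  ultimately show ?thesis using bruhat_inv [of "inv u" "inv w"] assms by simp
qed


subsection \<open>Demazure product\<close>

text \<open>The delicate case is that \<open>s\<close> and \<open>r\<close> both raise
  \<open>w\<close> but do not both raise the other product. Then folding forces
  \<open>s \<otimes> w = w \<otimes> r\<close>, and both sides equal this element. The commutation
  is what makes the Demazure product independent of words and associative.\<close>

lemma up_rup_commute:
  assumes "s \<in> S" "r \<in> S" "w \<in> carrier W"
  shows "rup r (up s w) = up s (rup r w)"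
proof (cases "len w < len (s \<otimes> w)"; cases "len w < len (w \<otimes> r)")
  assume a: "len w < len (s \<otimes> w)" "len w < len (w \<otimes> r)"
  have e: "s \<otimes> w = w \<otimes> r" if "\<not> (len (s \<otimes> w) < len (s \<otimes> w \<otimes> r) \<and> len (w \<otimes> r) < len (s \<otimes> w \<otimes> r))"
  proof -
    have "len (s \<otimes> w \<otimes> r) \<noteq> len (s \<otimes> w)" "len (s \<otimes> w \<otimes> r) \<noteq> len (w \<otimes> r)"
      using len_gen_neq_right [of r "s \<otimes> w"] len_gen_neq [of s "w \<otimes> r"] assms
      by (auto simp: m_assoc)
    then have "len (s \<otimes> w \<otimes> r) < len (s \<otimes> w) \<or> len (s \<otimes> w \<otimes> r) < len (w \<otimes> r)"
      using that by linarith
    then show ?thesis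
      using folding [OF assms(1,2,3) a(1)] folding_right [OF assms(1,2,3) a(2)] by blast
  qed
  show ?thesis
  proof (cases "s \<otimes> w = w \<otimes> r")
    case True
    then have "s \<otimes> (w \<otimes> r) = w" "s \<otimes> w \<otimes> r = w" using assms by (metis S_cancel_left, metis S_cancel_right)
    then show ?thesis using a True by (simp add: up_def rup_def)
  next
    case False
    then show ?thesis using a e assms by (auto simp: up_def rup_def m_assoc)
  qed
next
  assume a: "len w < len (s \<otimes> w)" "\<not> len w < len (w \<otimes> r)"
  then have "len (w \<otimes> r) < len w" using len_gen_neq_right [of r w] assms by force
  then have "\<not> len (s \<otimes> w) < len (s \<otimes> w \<otimes> r)"
    using len_gen_mult_le [of s "w \<otimes> r"] assms a by (simp add: m_assoc)
  then show ?thesis using a by (simp add: up_def rup_def)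
next
  assume a: "\<not> len w < len (s \<otimes> w)" "len w < len (w \<otimes> r)"
  then have "len (s \<otimes> w) < len w" using len_gen_neq [of s w] assms by force
  then have "\<not> len (w \<otimes> r) < len (s \<otimes> (w \<otimes> r))"
    using len_mult_gen_le [of r "s \<otimes> w"] assms a by (simp add: m_assoc)
  then show ?thesis using a by (simp add: up_def rup_def)
next
  assume "\<not> len w < len (s \<otimes> w)" "\<not> len w < len (w \<otimes> r)"
  then show ?thesis by (simp add: up_def rup_def)
qed

definition up_word :: "'w list \<Rightarrow> 'w \<Rightarrow> 'w" where
  "up_word = foldr up"

definition rup_word :: "'w \<Rightarrow> 'w list \<Rightarrow> 'w" where
  "rup_word = foldl (\<lambda>w r. rup r w)"

text \<open>The Demazure product, by a chosen reduced word of \<open>a\<close>;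
  \<open>dem_word\<close> shows that every reduced word of \<open>a\<close> gives the same
  result.\<close>

definition dem :: "'w \<Rightarrow> 'w \<Rightarrow> 'w" where
  "dem a b = up_word (reduced_word a) b"

lemma up_word_simps [simp]: "up_word [] b = b" "up_word (s # ws) b = up s (up_word ws b)"
  "up_word (us @ ws) b = up_word us (up_word ws b)"
  by (simp_all add: up_word_def)

lemma rup_word_simps [simp]: "rup_word b [] = b" "rup_word b (ws @ [r]) = rup r (rup_word b ws)"
  by (simp_all add: rup_word_def)

lemma up_word_closed [simp, intro]: "set ws \<subseteq> S \<Longrightarrow> b \<in> carrier W \<Longrightarrow> up_word ws b \<in> carrier W"
  by (induction ws) auto

lemma rup_word_closed [simp, intro]: "set ws \<subseteq> S \<Longrightarrow> b \<in> carrier W \<Longrightarrow> rup_word b ws \<in> carrier W"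
  by (induction ws rule: rev_induct) auto

lemma up_word_rup:
  "set ws \<subseteq> S \<Longrightarrow> r \<in> S \<Longrightarrow> b \<in> carrier W \<Longrightarrow> up_word ws (rup r b) = rup r (up_word ws b)"
  by (induction ws) (auto simp: up_rup_commute)

lemma up_word_rup_word:
  "set ws \<subseteq> S \<Longrightarrow> set bs \<subseteq> S \<Longrightarrow> b \<in> carrier W \<Longrightarrow>
    up_word ws (rup_word b bs) = rup_word (up_word ws b) bs"
  by (induction bs rule: rev_induct) (auto simp: up_word_rup)

lemma up_word_one:
  "set ws \<subseteq> S \<Longrightarrow> len (word_prod ws) = length ws \<Longrightarrow> up_word ws \<one> = word_prod ws"
proof (induction ws)
  case (Cons s ws)
  then have "up_word ws \<one> = word_prod ws" using reduced_tail [OF Cons.prems] by simp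
  then show ?case using reduced_tail [OF Cons.prems] by (simp add: up_def)
qed simp

lemma rup_word_one:
  "set ws \<subseteq> S \<Longrightarrow> len (word_prod ws) = length ws \<Longrightarrow> rup_word \<one> ws = word_prod ws"
proof (induction ws rule: rev_induct)
  case (snoc r ws)
  note l = reduced_init [OF snoc.prems]
  have "rup_word \<one> ws = word_prod ws" using snoc.IH snoc.prems(1) l(1) by simp
  then show ?case unfolding l(3) using l(2) by (simp add: rup_def)
qed simp

text \<open>Building \<open>b\<close> from the identity by right operators and moving the left
  operators past them leaves a right-hand side that depends on \<open>ws\<close> only through its
  product.\<close>

lemma up_word_dem:
  assumes "set ws \<subseteq> S" "len (word_prod ws) = length ws" "b \<in> carrier W"
  shows "up_word ws b = rup_word (word_prod ws) (reduced_word b)"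
proof -
  have "up_word ws b = up_word ws (rup_word \<one> (reduced_word b))"
    using rup_word_one [of "reduced_word b"] reduced_word [OF assms(3)] by simp
  also have "\<dots> = rup_word (word_prod ws) (reduced_word b)"
    using up_word_rup_word [of ws "reduced_word b" \<one>] up_word_one assms reduced_word [OF assms(3)]
    by simp
  finally show ?thesis .
qed

lemma dem_rup_word:
  "a \<in> carrier W \<Longrightarrow> b \<in> carrier W \<Longrightarrow> dem a b = rup_word a (reduced_word b)"
  unfolding dem_def using up_word_dem [of "reduced_word a" b] reduced_word [of a] by simp

lemma dem_word:
  "set ws \<subseteq> S \<Longrightarrow> len (word_prod ws) = length ws \<Longrightarrow> b \<in> carrier W \<Longrightarrow>
    dem (word_prod ws) b = up_word ws b"
  by (simp add: up_word_dem dem_rup_word)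

lemma dem_closed [simp, intro]: "a \<in> carrier W \<Longrightarrow> b \<in> carrier W \<Longrightarrow> dem a b \<in> carrier W"
  unfolding dem_def using reduced_word by auto

lemma dem_one_right [simp]: "a \<in> carrier W \<Longrightarrow> dem a \<one> = a"
  unfolding dem_def using up_word_one [of "reduced_word a"] reduced_word [of a] by simp

lemma dem_one_left [simp]: "b \<in> carrier W \<Longrightarrow> dem \<one> b = b"
  using dem_word [of "[]" b] by simp

lemma dem_gen_mult:
  assumes "s \<in> S" "a \<in> carrier W" "b \<in> carrier W" "len a < len (s \<otimes> a)"
  shows "dem (s \<otimes> a) b = up s (dem a b)"
proof -
  have "len (s \<otimes> a) = Suc (len a)" using len_gen_mult_le [of s a] assms by simp
  then show ?thesis
    using dem_word [of "s # reduced_word a" b] reduced_word [of a] assms by (simp add: dem_def)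
qed

lemma dem_up:
  assumes "s \<in> S" "a \<in> carrier W" "b \<in> carrier W"
  shows "dem (up s a) b = up s (dem a b)"
proof (cases "len a < len (s \<otimes> a)")
  case True
  then show ?thesis using dem_gen_mult assms by (simp add: up_def [of s a])
next
  case False
  then have "len (s \<otimes> a) < len (s \<otimes> (s \<otimes> a))" using len_gen_neq [of s a] assms by auto
  then have "dem a b = up s (dem (s \<otimes> a) b)" using dem_gen_mult [of s "s \<otimes> a" b] assms by simp
  then show ?thesis using False assms by (simp add: up_def [of s a])
qed

lemma dem_assoc:
  assumes "a \<in> carrier W" "b \<in> carrier W" "c \<in> carrier W"
  shows "dem (dem a b) c = dem a (dem b c)"
proof -
  have "set ws \<subseteq> S \<Longrightarrow> dem (up_word ws b) c = up_word ws (dem b c)" for ws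
    using assms by (induction ws) (auto simp: dem_up)
  then show ?thesis unfolding dem_def [of a] using reduced_word [OF assms(1)] by simp
qed

lemma up_word_mono: "set ws \<subseteq> S \<Longrightarrow> bruhat b c \<Longrightarrow> bruhat (up_word ws b) (up_word ws c)"
  by (induction ws) (auto intro: up_mono)

lemma rup_word_mono: "set ws \<subseteq> S \<Longrightarrow> bruhat b c \<Longrightarrow> bruhat (rup_word b ws) (rup_word c ws)"
  by (induction ws rule: rev_induct) (auto intro: rup_mono)

lemma dem_mono_right: "a \<in> carrier W \<Longrightarrow> bruhat b c \<Longrightarrow> bruhat (dem a b) (dem a c)"
  by (simp add: dem_def up_word_mono reduced_word)

lemma dem_mono_left: "b \<in> carrier W \<Longrightarrow> bruhat a c \<Longrightarrow> bruhat (dem a b) (dem c b)"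
  using dem_rup_word rup_word_mono reduced_word bruhat_carrier by metis

lemma mult_le_dem:
  assumes "a \<in> carrier W" "b \<in> carrier W"
  shows "bruhat (a \<otimes> b) (dem a b)"
proof -
  have "set ws \<subseteq> S \<Longrightarrow> bruhat (word_prod ws \<otimes> b) (up_word ws b)" for ws
  proof (induction ws)
    case Nil
    then show ?case using assms by simp
  next
    case (Cons s ws)
    then have IH: "bruhat (word_prod ws \<otimes> b) (up_word ws b)" by simp
    have "bruhat (s \<otimes> (word_prod ws \<otimes> b)) (up s (word_prod ws \<otimes> b))"
      using Cons assms by (intro gen_le_up) auto
    moreover have "bruhat (up s (word_prod ws \<otimes> b)) (up s (up_word ws b))"
      using Cons IH by (intro up_mono) auto
    ultimately have "bruhat (s \<otimes> (word_prod ws \<otimes> b)) (up s (up_word ws b))"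
      by (rule bruhat_trans)
    then show ?case using Cons assms by (simp add: m_assoc)
  qed
  then show ?thesis unfolding dem_def using reduced_word [OF assms(1)] by metis
qed

lemma one_le:
  assumes "b \<in> carrier W"
  shows "bruhat \<one> b"
proof -
  have "set ws \<subseteq> S \<Longrightarrow> bruhat \<one> (up_word ws \<one>)" for ws
  proof (induction ws)
    case (Cons s ws)
    then show ?case using le_up [of s "up_word ws \<one>"] by (auto intro: bruhat_trans)
  qed simp
  from this [of "reduced_word b"] show ?thesis
    using reduced_word [OF assms] dem_one_right [OF assms] by (simp add: dem_def)
qed

text \<open>A letter of \<open>b\<close> is kept when it raises the product and skipped otherwise;
  the kept letters multiply to \<open>c\<close>, which stays below the part of \<open>b\<close>
  already read.\<close>

lemma dem_factor:
  assumes "a \<in> carrier W" "b \<in> carrier W"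
  shows "\<exists>c. bruhat c b \<and> dem a b = a \<otimes> c"
proof -
  have "set ws \<subseteq> S \<Longrightarrow> len (word_prod ws) = length ws \<Longrightarrow>
    \<exists>c. bruhat c (word_prod ws) \<and> rup_word a ws = a \<otimes> c" for ws
  proof (induction ws rule: rev_induct)
    case Nil
    then show ?case using assms by (intro exI [of _ \<one>]) auto
  next
    case (snoc r ws)
    have cl: "set ws \<subseteq> S" "r \<in> S" "word_prod ws \<in> carrier W" using snoc.prems by auto
    note l = reduced_init [OF snoc.prems]
    note e = l(3)
    have r: "rup r (word_prod ws) = word_prod ws \<otimes> r" using l(2) by (simp add: rup_def)
    obtain c where c: "bruhat c (word_prod ws)" "rup_word a ws = a \<otimes> c"
      using snoc.IH cl l by blast
    have cc: "c \<in> carrier W" using c bruhat_carrier by blast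
    have "bruhat (rup r c) (word_prod ws \<otimes> r)" using rup_mono [OF c(1) cl(2)] r by simp
    then have "bruhat c (word_prod ws \<otimes> r)" "bruhat (c \<otimes> r) (word_prod ws \<otimes> r)"
      using le_rup mult_gen_le_rup cc cl bruhat_trans by blast+
    then show ?case using c cc e assms cl
      by (cases "len (a \<otimes> c) < len (a \<otimes> c \<otimes> r)") (auto simp: rup_def m_assoc)
  qed
  from this [of "reduced_word b"] show ?thesis
    using reduced_word [OF assms(2)] dem_rup_word [OF assms] by auto
qed

lemma dem_factor_left:
  assumes "a \<in> carrier W" "b \<in> carrier W"
  shows "\<exists>c. bruhat c a \<and> dem a b = c \<otimes> b"
proof -
  have "set ws \<subseteq> S \<Longrightarrow> len (word_prod ws) = length ws \<Longrightarrow>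
    \<exists>c. bruhat c (word_prod ws) \<and> up_word ws b = c \<otimes> b" for ws
  proof (induction ws)
    case Nil
    then show ?case using assms by (intro exI [of _ \<one>]) auto
  next
    case (Cons s ws)
    have cl: "set ws \<subseteq> S" "s \<in> S" "word_prod ws \<in> carrier W" using Cons.prems by auto
    have l: "len (word_prod ws) = length ws" "len (word_prod ws) < len (s \<otimes> word_prod ws)"
      using reduced_tail [OF Cons.prems] by auto
    then have r: "up s (word_prod ws) = s \<otimes> word_prod ws" by (simp add: up_def)
    obtain c where c: "bruhat c (word_prod ws)" "up_word ws b = c \<otimes> b"
      using Cons.IH cl l by blast
    have cc: "c \<in> carrier W" using c bruhat_carrier by blast
    have "bruhat (up s c) (s \<otimes> word_prod ws)" using up_mono [OF c(1) cl(2)] r by simp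
    then have "bruhat c (s \<otimes> word_prod ws)" "bruhat (s \<otimes> c) (s \<otimes> word_prod ws)"
      using le_up gen_le_up cc cl bruhat_trans by blast+
    then show ?case using c cc assms cl
      by (cases "len (c \<otimes> b) < len (s \<otimes> (c \<otimes> b))") (auto simp: up_def m_assoc)
  qed
  from this [of "reduced_word a"] show ?thesis
    using reduced_word [OF assms(1)] by (auto simp: dem_def)
qed

lemma dem_additive:
  assumes "a \<in> carrier W" "b \<in> carrier W" "len (a \<otimes> b) = len a + len b"
  shows "dem a b = a \<otimes> b"
proof -
  obtain c where c: "bruhat c b" "dem a b = a \<otimes> c" using dem_factor assms by blast
  have cc: "c \<in> carrier W" using c bruhat_carrier by blast
  have "len (dem a b) \<le> len a + len c" using c len_mult_le assms cc by simp
  also have "\<dots> \<le> len (a \<otimes> b)" using assms bruhat_len [OF c(1)] by simp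
  finally show ?thesis using bruhat_len_eq [OF mult_le_dem [OF assms(1,2)]] by simp
qed

lemma le_dem_left: "a \<in> carrier W \<Longrightarrow> b \<in> carrier W \<Longrightarrow> bruhat a (dem a b)"
  using dem_mono_right [of a \<one> b] one_le by simp

end

context coxeter_group
begin

subsection \<open>Moebius inversion for the Bruhat order\<close>

text \<open>The coefficient of \<open>A\<^sub>a\<close> in \<open>K\<^sub>w\<close>, which by
  Verma's theorem is also the Moebius function of the interval from \<open>a\<close> to
  \<open>w\<close>.\<close>

definition mob :: "'w \<Rightarrow> 'w \<Rightarrow> int" where
  "mob w a = (if bruhat a w then (-1) ^ (len w + len a) else 0)"

text \<open>\<open>K w\<close> is the element \<open>\<Prod>(A\<^sub>s - 1)\<close> of the 0-Hecke algebra, taken along a reduced word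
  of \<open>w\<close> and regarded as a functional in the basis \<open>A\<close>.\<close>

definition K :: "'w \<Rightarrow> ('w \<Rightarrow> int) \<Rightarrow> int" where
  "K w \<phi> = (\<Sum>a\<in>{a. bruhat a w}. (-1) ^ (len w + len a) * \<phi> a)"

lemma coxeter_induct [consumes 1, case_names one gen]:
  assumes "w \<in> carrier W" and "P \<one>"
    and gen: "\<And>s w. \<lbrakk>s \<in> S; w \<in> carrier W; len w < len (s \<otimes> w); P w\<rbrakk> \<Longrightarrow> P (s \<otimes> w)"
  shows "P w"
proof -
  have "set ws \<subseteq> S \<Longrightarrow> len (word_prod ws) = length ws \<Longrightarrow> P (word_prod ws)" for ws
  proof (induction ws)
    case (Cons s ws)
    then show ?case using reduced_tail [OF Cons.prems] gen [of s "word_prod ws"] by auto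
  qed (use assms in simp)
  then show ?thesis using reduced_word [OF assms(1)] by metis
qed

lemma K_cong: "(\<And>a. a \<in> carrier W \<Longrightarrow> \<phi> a = \<psi> a) \<Longrightarrow> K w \<phi> = K w \<psi>"
  unfolding K_def by (intro sum.cong) (auto dest: bruhat_carrier)

lemma K_mob: "finite (carrier W) \<Longrightarrow> K w \<phi> = (\<Sum>a\<in>carrier W. mob w a * \<phi> a)"
  unfolding K_def mob_def
  by (intro sum.mono_neutral_cong_left) (auto dest: bruhat_carrier)

lemma K_one: "K \<one> \<phi> = \<phi> \<one>"
proof -
  have "{a. bruhat a \<one>} = {\<one>}"
    using bruhat_len_eq [of _ \<one>] by auto
  then show ?thesis by (simp add: K_def)
qed

lemma lower_gen_mult:
  assumes "s \<in> S" "w \<in> carrier W" "len w < len (s \<otimes> w)" "x \<in> carrier W"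
  shows "bruhat x (s \<otimes> w) \<longleftrightarrow> bruhat (dn s x) w"
  using le_up_iff_dn_le [OF assms(1,4,2)] assms(3) by (simp add: up_def)

text \<open>The product formula \<open>(A\<^sub>s - 1) K\<^sub>w\<close>, with
  \<open>A\<^sub>s\<close> acting on the basis by \<open>up s\<close>. By the adjunction the
  elements below \<open>s \<otimes> w\<close> are the \<open>a\<close> below \<open>w\<close> that
  \<open>s\<close> raises, together with their products \<open>s \<otimes> a\<close>. The remaining
  \<open>a\<close> below \<open>w\<close> satisfy \<open>up s a = a\<close> and cancel on the
  right.\<close>

lemma K_gen_mult:
  assumes s: "s \<in> S" and w: "w \<in> carrier W" and l: "len w < len (s \<otimes> w)"
  shows "K (s \<otimes> w) \<phi> = K w (\<lambda>a. \<phi> (up s a)) - K w \<phi>"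
proof -
  define A where "A = {a. bruhat a w \<and> len a < len (s \<otimes> a)}"
  have Ac: "A \<subseteq> carrier W" using bruhat_carrier by (auto simp: A_def)
  have fin: "finite A" using finite_lower [of w] unfolding A_def by simp
  have inj: "inj_on ((\<otimes>) s) A" using Ac s by (intro inj_onI) (metis S_cancel_left subsetD)
  have ls: "len (s \<otimes> w) = Suc (len w)" using len_gen_mult_le [OF s w] l by simp
  have la: "len (s \<otimes> a) = Suc (len a)" if "a \<in> A" for a
    using len_gen_mult_le [OF s, of a] that Ac by (auto simp: A_def)
  have "{a. bruhat a (s \<otimes> w)} = A \<union> (\<otimes>) s ` A"
  proof (intro equalityI subsetI)
    fix x assume x: "x \<in> {a. bruhat a (s \<otimes> w)}"
    then have xc: "x \<in> carrier W" using bruhat_carrier by auto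
    have d: "bruhat (dn s x) w" using x lower_gen_mult [OF s w l xc] by simp
    show "x \<in> A \<union> (\<otimes>) s ` A"
    proof (cases "len x < len (s \<otimes> x)")
      case True
      then show ?thesis using d by (simp add: dn_def A_def)
    next
      case False
      then have "s \<otimes> x \<in> A" using d len_gen_neq [OF s xc] s xc by (simp add: dn_def A_def)
      moreover have "x = s \<otimes> (s \<otimes> x)" using s xc by simp
      ultimately show ?thesis by blast
    qed
  next
    fix x assume "x \<in> A \<union> (\<otimes>) s ` A"
    then obtain a where a: "a \<in> A" "x = a \<or> x = s \<otimes> a" by blast
    then have ac: "a \<in> carrier W" using Ac by blast
    have "x \<in> carrier W" "dn s x = a" using a ac s by (auto simp: A_def dn_def)
    then show "x \<in> {a. bruhat a (s \<otimes> w)}"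
      using lower_gen_mult [OF s w l, of x] a ac s by (auto simp: A_def)
  qed
  moreover have "A \<inter> (\<otimes>) s ` A = {}" using Ac s by (auto simp: A_def)
  ultimately have "K (s \<otimes> w) \<phi> =
      (\<Sum>a\<in>A. (-1) ^ (len (s \<otimes> w) + len a) * \<phi> a) +
      (\<Sum>a\<in>A. (-1) ^ (len (s \<otimes> w) + len (s \<otimes> a)) * \<phi> (s \<otimes> a))"
    unfolding K_def by (simp add: sum.union_disjoint fin sum.reindex inj)
  also have "\<dots> = (\<Sum>a\<in>A. (-1) ^ (len w + len a) * (\<phi> (s \<otimes> a) - \<phi> a))"
    by (simp add: ls la algebra_simps sum.distrib [symmetric] cong: sum.cong)
  also have "\<dots> = (\<Sum>a\<in>{a. bruhat a w}. (-1) ^ (len w + len a) * (\<phi> (up s a) - \<phi> a))"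
    by (rule sum.mono_neutral_cong_left) (auto simp: A_def finite_lower up_def)
  also have "\<dots> = K w (\<lambda>a. \<phi> (up s a)) - K w \<phi>"
    by (simp add: K_def right_diff_distrib sum_subtractf)
  finally show ?thesis .
qed

text \<open>Pulled back along \<open>up s\<close>, the filter above \<open>u\<close> becomes the
  filter above \<open>dn s u\<close>. The recursion for \<open>K\<close> therefore yields
  \<open>of_bool (dn s u = w) - of_bool (u = w)\<close>, and \<open>dn s u = w\<close> holds exactly
  for \<open>u = w\<close> and \<open>u = s \<otimes> w\<close>.\<close>

lemma verma:
  assumes "w \<in> carrier W" "u \<in> carrier W"
  shows "K w (\<lambda>a. of_bool (bruhat u a)) = of_bool (u = w)"
  using assms
proof (induction arbitrary: u rule: coxeter_induct)
  case one
  then show ?case using one_le bruhat_antisym by (auto simp: K_one)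
next
  case (gen s w)
  have "K w (\<lambda>a. of_bool (bruhat u (up s a))) = K w (\<lambda>a. of_bool (bruhat (dn s u) a))"
    using gen by (intro K_cong) (simp add: le_up_iff_dn_le)
  then have e: "K (s \<otimes> w) (\<lambda>a. of_bool (bruhat u a)) = of_bool (dn s u = w) - of_bool (u = w)"
    using gen by (simp add: K_gen_mult)
  have "dn s u = w \<longleftrightarrow> u = w \<or> u = s \<otimes> w"
    using gen len_gen_neq [of s u] by (auto simp: dn_def)
  moreover have "w \<noteq> s \<otimes> w" using gen by auto
  ultimately show ?case using e by auto
qed

text \<open>Exchanging the two sums leaves, for every \<open>b\<close>, a signed count of the
  elements between \<open>b\<close> and \<open>w\<close>, which \<open>verma\<close>
  evaluates.\<close>

lemma K_inversion:
  assumes w: "w \<in> carrier W"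
  shows "(\<Sum>a\<in>{a. bruhat a w}. K a \<phi>) = \<phi> w"
proof -
  let ?L = "{a. bruhat a w}"
  have fin: "finite ?L" by (rule finite_lower)
  have "(\<Sum>a\<in>?L. K a \<phi>) = (\<Sum>a\<in>?L. \<Sum>b\<in>{b. b \<in> ?L \<and> bruhat b a}. (-1) ^ (len a + len b) * \<phi> b)"
    unfolding K_def by (intro sum.cong) (auto intro: bruhat_trans)
  also have "\<dots> = (\<Sum>b\<in>?L. \<Sum>a\<in>{a. a \<in> ?L \<and> bruhat b a}. (-1) ^ (len a + len b) * \<phi> b)"
    by (rule sum.swap_restrict [OF fin fin])
  also have "\<dots> = (\<Sum>b\<in>?L. of_bool (b = w) * \<phi> b)"
  proof (intro sum.cong refl)
    fix b assume "b \<in> ?L"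
    then have b: "b \<in> carrier W" using bruhat_carrier by blast
    have sgn: "(-1) ^ (len a + len b) = (-1) ^ (len w + len b) * ((-1) ^ (len w + len a) :: int)" for a
      by (simp add: power_add)
    have "(\<Sum>a\<in>{a. a \<in> ?L \<and> bruhat b a}. (-1) ^ (len a + len b) * \<phi> b) =
        (\<Sum>a\<in>?L. (-1) ^ (len w + len b) * ((-1) ^ (len w + len a) * of_bool (bruhat b a)) * \<phi> b)"
      by (rule sum.mono_neutral_cong_left) (auto simp: fin power_add)
    also have "\<dots> = (-1) ^ (len w + len b) * K w (\<lambda>a. of_bool (bruhat b a)) * \<phi> b"
      by (simp add: K_def sum_distrib_left sum_distrib_right)
    also have "\<dots> = of_bool (b = w) * \<phi> b" by (simp add: verma [OF w b])
    finally show "(\<Sum>a\<in>{a. a \<in> ?L \<and> bruhat b a}. (-1) ^ (len a + len b) * \<phi> b) =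
        of_bool (b = w) * \<phi> b" .
  qed
  also have "\<dots> = \<phi> w" using fin w
    by (simp add: of_bool_def if_distrib [of "\<lambda>x. x * _"] cong: if_cong)
  finally show ?thesis .
qed

text \<open>The adjoint of \<open>dem a\<close> is obtained by applying \<open>dn s\<close>
  successively for the letters \<open>s\<close> of a reduced word of \<open>a\<close>, starting from
  the left.\<close>

lemma dem_adjoint:
  assumes "a \<in> carrier W" "u \<in> carrier W"
  obtains u' where "u' \<in> carrier W" "\<And>c. c \<in> carrier W \<Longrightarrow> bruhat u (dem a c) \<longleftrightarrow> bruhat u' c"
proof -
  have "\<exists>u'\<in>carrier W. \<forall>c\<in>carrier W. bruhat u (dem a c) \<longleftrightarrow> bruhat u' c"
    using assms
  proof (induction arbitrary: u rule: coxeter_induct)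
    case one
    then show ?case by auto
  next
    case (gen s w)
    obtain u' where "u' \<in> carrier W" "\<forall>c\<in>carrier W. bruhat (dn s u) (dem w c) \<longleftrightarrow> bruhat u' c"
      using gen.IH [of "dn s u"] gen by blast
    then show ?case using gen by (auto simp: dem_gen_mult le_up_iff_dn_le)
  qed
  then show thesis using that by blast
qed

text \<open>The \<open>c\<close> with \<open>u\<close> below \<open>dem a c\<close> form a principal
  filter, so by \<open>verma\<close> only the \<open>K w\<close> at its least element
  \<open>u'\<close> contributes. As \<open>I\<close> is a lower set, it meets the filter iff it
  contains \<open>u'\<close>.\<close>

lemma K_lower_set:
  assumes I: "I \<subseteq> carrier W" "finite I" "\<And>x y. y \<in> I \<Longrightarrow> bruhat x y \<Longrightarrow> x \<in> I"
    and a: "a \<in> carrier W" "u \<in> carrier W"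
  shows "(\<Sum>w\<in>I. K w (\<lambda>c. of_bool (bruhat u (dem a c)))) = of_bool (\<exists>w\<in>I. bruhat u (dem a w))"
proof -
  obtain u' where u': "u' \<in> carrier W"
    "\<And>c. c \<in> carrier W \<Longrightarrow> bruhat u (dem a c) \<longleftrightarrow> bruhat u' c"
    using dem_adjoint [OF a] by blast
  have "(\<Sum>w\<in>I. K w (\<lambda>c. of_bool (bruhat u (dem a c)))) = (\<Sum>w\<in>I. of_bool (u' = w))"
  proof (intro sum.cong refl)
    fix w assume "w \<in> I"
    have "K w (\<lambda>c. of_bool (bruhat u (dem a c))) = K w (\<lambda>c. of_bool (bruhat u' c))"
      using u' by (intro K_cong) simp
    then show "K w (\<lambda>c. of_bool (bruhat u (dem a c))) = of_bool (u' = w)"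
      using verma [of w u'] \<open>w \<in> I\<close> I u' by auto
  qed
  also have "\<dots> = of_bool (u' \<in> I)" using I by (simp add: of_bool_def)
  also have "u' \<in> I \<longleftrightarrow> (\<exists>w\<in>I. bruhat u (dem a w))"
    using u' I by (metis bruhat_refl subsetD)
  finally show ?thesis .
qed


subsection \<open>Parabolic subgroups\<close>

lemma parabolic_closed:
  assumes "J \<subseteq> S" "x \<in> generate W J"
  shows "x \<in> carrier W"
  using assms generate_in_carrier [of J x] S_carrier by blast

lemma parabolic_mult: "x \<in> generate W J \<Longrightarrow> y \<in> generate W J \<Longrightarrow> x \<otimes> y \<in> generate W J"
  by (rule generate.eng)

lemma parabolic_inv: "J \<subseteq> S \<Longrightarrow> x \<in> generate W J \<Longrightarrow> inv x \<in> generate W J"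
  using generate_m_inv_closed [of J x] S_carrier by blast

lemma min_coset_reps_closed: "d \<in> min_coset_reps X \<Longrightarrow> d \<in> carrier W"
  by (simp add: min_coset_reps_def)

lemma one_min_coset_reps: "\<one> \<in> min_coset_reps X"
  by (simp add: min_coset_reps_def)

text \<open>If a letter failed to lengthen the product, exchange would delete a letter from the word
  of \<open>d\<close>, giving a shorter element of the same coset, or one from \<open>ws\<close>,
  giving a shorter word over \<open>J\<close>. The word \<open>ws\<close> is assumed shortest only
  among words over \<open>J\<close>, so that the agreement of the two length functions comes out as
  the case \<open>d = \<one>\<close>.\<close>

lemma min_coset_rep_word_len:
  assumes J: "J \<subseteq> S" and d: "d \<in> min_coset_reps (generate W J)"
    and "set ws \<subseteq> J"
    and "\<And>vs. set vs \<subseteq> J \<Longrightarrow> word_prod vs = word_prod ws \<Longrightarrow> length ws \<le> length vs"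
  shows "len (d \<otimes> word_prod ws) = len d + length ws"
  using assms(3,4)
proof (induction ws rule: rev_induct)
  case Nil
  then show ?case using min_coset_reps_closed [OF d] by simp
next
  case (snoc r ws)
  have dc: "d \<in> carrier W" by (rule min_coset_reps_closed [OF d])
  have cl: "set ws \<subseteq> J" "r \<in> J" "set ws \<subseteq> S" "r \<in> S" "word_prod ws \<in> carrier W"
    using snoc.prems J by auto
  have e: "word_prod (ws @ [r]) = word_prod ws \<otimes> r" using cl by (simp add: word_prod_append)
  have min: "length ws \<le> length vs" if "set vs \<subseteq> J" "word_prod vs = word_prod ws" for vs
  proof -
    have "set vs \<subseteq> S" using that J by blast
    then show ?thesis
      using snoc.prems(2) [of "vs @ [r]"] that cl e by (simp add: word_prod_append)
  qed
  have IH: "len (d \<otimes> word_prod ws) = len d + length ws" by (rule snoc.IH [OF cl(1) min])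
  show ?case
  proof (rule len_gen_cases_right [of r "d \<otimes> word_prod ws"])
    assume "len (d \<otimes> word_prod ws \<otimes> r) = Suc (len (d \<otimes> word_prod ws))"
    then show ?thesis using IH e cl dc by (simp add: m_assoc)
  next
    assume shorter: "len (d \<otimes> word_prod ws) = Suc (len (d \<otimes> word_prod ws \<otimes> r))"
    let ?d = "reduced_word d"
    have dw: "set ?d \<subseteq> S" "word_prod ?d = d" "length ?d = len d" using reduced_word [OF dc] by auto
    have wp: "word_prod (?d @ ws) = d \<otimes> word_prod ws" using dw cl by (simp add: word_prod_append)
    obtain us q vs where o: "?d @ ws = us @ q # vs"
      "d \<otimes> word_prod ws \<otimes> r = word_prod (us @ vs)"
      using exchange_right [of r "?d @ ws"] wp shorter dw cl by auto
    have sub: "set us \<subseteq> S" "set vs \<subseteq> S"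
      using arg_cong [OF o(1), of set] dw cl by auto
    from o(1) consider vs' where "?d = us @ q # vs'" "vs = vs' @ ws"
      | us' where "us = ?d @ us'" "ws = us' @ q # vs"
      unfolding append_eq_append_conv2 append_eq_Cons_conv Cons_eq_append_conv by auto
    then have False
    proof cases
      case 1
      let ?x = "word_prod ws \<otimes> r \<otimes> inv (word_prod ws)"
      have s': "set (us @ vs') \<subseteq> S" using 1 sub by auto
      have "word_prod (us @ vs') \<otimes> word_prod ws = d \<otimes> word_prod ws \<otimes> r"
        using o 1 s' cl by (simp add: word_prod_append m_assoc)
      then have "word_prod (us @ vs') = d \<otimes> ?x"
        using s' cl dc by (metis inv_solve_right m_assoc m_closed S_closed inv_closed word_prod_closed)
      moreover have "word_prod ws \<in> generate W J" using generate_words [OF J] cl(1) by blast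
      then have "?x \<in> generate W J"
        using generate.incl [OF cl(2)] J by (intro parabolic_mult parabolic_inv)
      ultimately have "len d \<le> len (word_prod (us @ vs'))"
        using d by (simp add: min_coset_reps_def)
      also have "\<dots> \<le> length (us @ vs')" by (rule len_word_le [OF s'])
      also have "\<dots> < len d" using 1 dw by (metis add_Suc_right length_Cons length_append lessI)
      finally show False by simp
    next
      case 2
      have s': "set (us' @ vs) \<subseteq> S" using 2 cl by auto
      have "d \<otimes> (word_prod ws \<otimes> r) = d \<otimes> word_prod (us' @ vs)"
        using o 2 s' cl dc dw by (simp add: word_prod_append m_assoc)
      then have "word_prod (us' @ vs) = word_prod (ws @ [r])"
        using s' cl dc e by (metis conj_cancel(1) m_closed S_closed word_prod_closed)
      then have "length (ws @ [r]) \<le> length (us' @ vs)"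
        using 2 cl by (intro snoc.prems(2)) auto
      then show False using 2 by simp
    qed
    then show ?thesis ..
  qed (use cl dc in auto)
qed

lemma parabolic_reduced:
  assumes J: "J \<subseteq> S" and u: "u \<in> generate W J"
  shows "\<exists>ws. set ws \<subseteq> J \<and> word_prod ws = u \<and> length ws = len u \<and>
    (\<forall>d\<in>min_coset_reps (generate W J). len (d \<otimes> u) = len d + len u)"
proof -
  let ?P = "\<lambda>ws. set ws \<subseteq> J \<and> word_prod ws = u"
  have "\<exists>ws. ?P ws" using generate_words [OF J] u by blast
  then obtain ws where ws: "?P ws" "\<And>vs. ?P vs \<Longrightarrow> length ws \<le> length vs"
    using ex_has_least_nat [of ?P _ length] by blast
  have add: "len (d \<otimes> u) = len d + length ws" if "d \<in> min_coset_reps (generate W J)" for d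
    using min_coset_rep_word_len [OF J that, of ws] ws by auto
  \<comment> \<open>The case \<open>d = \<one>\<close>: a shortest word over \<open>J\<close> is
    reduced over \<open>S\<close>.\<close>
  have "len u = length ws"
    using add [OF one_min_coset_reps] parabolic_closed [OF J u] by simp
  then show ?thesis using ws(1) add by auto
qed

lemma parabolic_reduced_word:
  assumes "J \<subseteq> S" "u \<in> generate W J"
  obtains ws where "set ws \<subseteq> J" "word_prod ws = u" "length ws = len u"
  using parabolic_reduced [OF assms] by blast

lemma min_coset_rep_len:
  "J \<subseteq> S \<Longrightarrow> d \<in> min_coset_reps (generate W J) \<Longrightarrow> u \<in> generate W J \<Longrightarrow>
    len (d \<otimes> u) = len d + len u"
  using parabolic_reduced by blast

lemma coset_decomposition:
  assumes J: "J \<subseteq> S" and w: "w \<in> carrier W"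
  obtains d u where "d \<in> min_coset_reps (generate W J)" "u \<in> generate W J" "w = d \<otimes> u"
proof -
  let ?P = "\<lambda>u. u \<in> generate W J"
  obtain u where u: "?P u" "\<And>v. ?P v \<Longrightarrow> len (w \<otimes> u) \<le> len (w \<otimes> v)"
    using ex_has_least_nat [of ?P \<one> "\<lambda>u. len (w \<otimes> u)"] generate.one by blast
  have uc: "u \<in> carrier W" using u parabolic_closed [OF J] by blast
  have "w \<otimes> u \<in> min_coset_reps (generate W J)"
    unfolding min_coset_reps_def
  proof (intro CollectI conjI ballI)
    show "len (w \<otimes> u) \<le> len (w \<otimes> u \<otimes> v)" if "v \<in> generate W J" for v
      using u(2) [OF parabolic_mult [OF u(1) that]] parabolic_closed [OF J that] uc w
      by (simp add: m_assoc)
  qed (use uc w in simp)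
  moreover have "w = w \<otimes> u \<otimes> inv u" using w uc by (simp add: m_assoc)
  ultimately show thesis using that parabolic_inv [OF J u(1)] by blast
qed

text \<open>Each of \<open>d\<close>, \<open>d'\<close> is the other one times
  \<open>u \<otimes> inv u'\<close> or its inverse, with lengths adding by minimality, so this
  element has length 0.\<close>

lemma coset_rep_unique:
  assumes J: "J \<subseteq> S" and d: "d \<in> min_coset_reps (generate W J)" "d' \<in> min_coset_reps (generate W J)"
    and u: "u \<in> generate W J" "u' \<in> generate W J" and e: "d \<otimes> u = d' \<otimes> u'"
  shows "d = d' \<and> u = u'"
proof -
  have cl: "d \<in> carrier W" "d' \<in> carrier W" "u \<in> carrier W" "u' \<in> carrier W"
    using d u min_coset_reps_closed parabolic_closed [OF J] by auto
  let ?x = "u \<otimes> inv u'"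
  have x: "?x \<in> generate W J" using u J by (intro parabolic_mult parabolic_inv)
  have d': "d' = d \<otimes> ?x" using e cl by (metis inv_solve_right m_assoc m_closed inv_closed)
  then have "d = d' \<otimes> inv ?x" using cl by (simp add: m_assoc inv_mult_group conj_cancel)
  then have "len d = len d' + len ?x"
    using min_coset_rep_len [OF J d(2) parabolic_inv [OF J x]] cl by simp
  moreover have "len d' = len d + len ?x" using min_coset_rep_len [OF J d(1) x] d' by simp
  ultimately have "len ?x = 0" by simp
  then have "?x = \<one>" using len_zero cl by simp
  then have "d' = d" using d' cl by simp
  then show ?thesis using e cl by simp
qed

text \<open>By strong exchange a step down in the Bruhat order deletes a letter of a word over
  \<open>J\<close>.\<close>

lemma parabolic_lower:
  assumes J: "J \<subseteq> S" and "bruhat u w" "w \<in> generate W J"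
  shows "u \<in> generate W J"
proof -
  have "w \<in> generate W J \<longrightarrow> u \<in> generate W J"
    using assms(2)
  proof (induction rule: bruhat_induct)
    case (step x y)
    have "x \<in> generate W J" if y: "y \<in> generate W J"
    proof -
      obtain t where t: "t \<in> reflections" "y = t \<otimes> x" "len x < len y"
        using step bruhat_step_iff by blast
      have x: "x = t \<otimes> y" using t step by (simp add: reflection_square)
      obtain ws where ws: "set ws \<subseteq> J" "word_prod ws = y" using generate_words [OF J] y by blast
      have "len (t \<otimes> y) < len y" using t x by simp
      then obtain us r vs where "ws = us @ r # vs" "x = word_prod (us @ vs)"
        using strong_exchange [OF t(1) step(4) _ subset_trans [OF ws(1) J] ws(2)] x by metis
      then show ?thesis using ws unfolding generate_words [OF J] by (intro exI [of _ "us @ vs"]) auto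
    qed
    then show ?case using step by blast
  qed simp
  then show ?thesis using assms by blast
qed

text \<open>Left multiplication by \<open>d\<close> conjugates the reflection of every step. The
  chain stays in the parabolic subgroup, where all lengths grow by \<open>len d\<close>, so steps
  remain steps.\<close>

lemma min_coset_rep_mono:
  assumes J: "J \<subseteq> S" and d: "d \<in> min_coset_reps (generate W J)"
    and "bruhat u w" "w \<in> generate W J"
  shows "bruhat (d \<otimes> u) (d \<otimes> w)"
proof -
  have dc: "d \<in> carrier W" by (rule min_coset_reps_closed [OF d])
  have "w \<in> generate W J \<longrightarrow> bruhat (d \<otimes> u) (d \<otimes> w)"
    using assms(3)
  proof (induction rule: bruhat_induct)
    case refl
    then show ?case using dc by simp
  next
    case (step x y)
    have "bruhat (d \<otimes> u) (d \<otimes> y)" if y: "y \<in> generate W J"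
    proof -
      have x: "x \<in> generate W J"
        using parabolic_lower [OF J bruhat_step_bruhat y] step by blast
      obtain t where t: "t \<in> reflections" "y = t \<otimes> x" "len x < len y"
        using step bruhat_step_iff by blast
      have "d \<otimes> y = (d \<otimes> t \<otimes> inv d) \<otimes> (d \<otimes> x)"
        using t dc step by (simp add: m_assoc conj_cancel)
      then have "\<exists>t\<in>reflections. d \<otimes> y = t \<otimes> (d \<otimes> x)" using reflection_conj [OF t(1) dc] by blast
      then have "bruhat_step (d \<otimes> x) (d \<otimes> y)"
        using min_coset_rep_len [OF J d x] min_coset_rep_len [OF J d y] t(3) dc step(3)
        by (simp add: bruhat_step_iff)
      then show ?thesis using step x dc bruhat_trans bruhat_step_bruhat by blast
    qed
    then show ?case by blast
  qed
  then show ?thesis using assms by blast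
qed

text \<open>Deodhar's lemma. Write \<open>s \<otimes> d = d' \<otimes> u\<close> with
  \<open>u\<close> different from \<open>\<one>\<close>. The last letter \<open>r\<close> of a
  \<open>J\<close>-word of \<open>u\<close> lowers \<open>s \<otimes> d\<close> but raises
  \<open>d\<close>, which is the situation of \<open>folding\<close>.\<close>

lemma deodhar:
  assumes J: "J \<subseteq> S" and d: "d \<in> min_coset_reps (generate W J)" and s: "s \<in> S"
    and n: "s \<otimes> d \<notin> min_coset_reps (generate W J)"
  shows "len d < len (s \<otimes> d)" "\<exists>r\<in>J. s \<otimes> d = d \<otimes> r"
proof -
  have dc: "d \<in> carrier W" by (rule min_coset_reps_closed [OF d])
  obtain d' u where du: "d' \<in> min_coset_reps (generate W J)" "u \<in> generate W J" "s \<otimes> d = d' \<otimes> u"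
    using coset_decomposition [OF J, of "s \<otimes> d"] s dc by blast
  have d'c: "d' \<in> carrier W" by (rule min_coset_reps_closed [OF du(1)])
  obtain ws where ws: "set ws \<subseteq> J" "word_prod ws = u" "length ws = len u"
    using parabolic_reduced_word [OF J du(2)] by blast
  have "ws \<noteq> []" using ws du n d'c by auto
  then obtain r vs where vs: "ws = vs @ [r]" by (metis rev_exhaust)
  have r: "r \<in> J" "r \<in> S" and vsJ: "set vs \<subseteq> J" "set vs \<subseteq> S" using ws vs J by auto
  have vg: "word_prod vs \<in> generate W J" using generate_words [OF J] vsJ by blast
  have "u = word_prod vs \<otimes> r" using ws(2) vs vsJ r by (simp add: word_prod_append)
  then have "s \<otimes> d \<otimes> r = d' \<otimes> word_prod vs"
    using du(3) vsJ r d'c by (simp add: m_assoc S_square)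
  then have "len (s \<otimes> d \<otimes> r) \<le> len d' + length vs"
    using min_coset_rep_len [OF J du(1) vg] len_word_le [OF vsJ(2)] by simp
  also have "\<dots> < len (s \<otimes> d)" using min_coset_rep_len [OF J du(1,2)] du ws vs by simp
  finally have desc: "len (s \<otimes> d \<otimes> r) < len (s \<otimes> d)" .
  have dr: "len (d \<otimes> r) = Suc (len d)"
    using min_coset_rep_len [OF J d generate.incl [OF r(1)]] r by simp
  have "len (d \<otimes> r) \<le> Suc (len (s \<otimes> d \<otimes> r))"
    using len_le_gen_mult [of s "d \<otimes> r"] s r dc by (simp add: m_assoc)
  then show asc: "len d < len (s \<otimes> d)" using desc dr by simp
  then have "len (s \<otimes> d \<otimes> r) < len (d \<otimes> r)"
    using desc dr len_gen_mult_le [OF s dc] by simp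
  then show "\<exists>r\<in>J. s \<otimes> d = d \<otimes> r" using folding [OF s r(2) dc asc] r by blast
qed

lemma min_coset_rep_descent:
  assumes J: "J \<subseteq> S" and d: "s \<otimes> d \<in> min_coset_reps (generate W J)" and s: "s \<in> S" "d \<in> carrier W"
    and l: "len d < len (s \<otimes> d)"
  shows "d \<in> min_coset_reps (generate W J)"
  using deodhar(1) [OF J d s(1)] l s by fastforce

lemma dem_word_right:
  assumes "set ws \<subseteq> S" "len (word_prod ws) = length ws" "a \<in> carrier W"
  shows "dem a (word_prod ws) = rup_word a ws"
proof -
  have "dem a (word_prod ws) = up_word (reduced_word a) (rup_word \<one> ws)"
    using rup_word_one assms by (simp add: dem_def)
  also have "\<dots> = rup_word (dem a \<one>) ws"
    unfolding dem_def using up_word_rup_word [of "reduced_word a" ws \<one>] reduced_word assms by simp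
  finally show ?thesis using assms by simp
qed

text \<open>Every letter of \<open>J\<close> raises the minimal representative \<open>u\<close>, so
  the letters of \<open>m\<close> can be removed one at a time by
  \<open>le_rup_ascent\<close>.\<close>

lemma le_dem_parabolic:
  assumes J: "J \<subseteq> S" and u: "u \<in> min_coset_reps (generate W J)" and m: "m \<in> generate W J"
    and g: "g \<in> carrier W" and le: "bruhat u (dem g m)"
  shows "bruhat u g"
proof -
  obtain ws where ws: "set ws \<subseteq> J" "word_prod ws = m" "length ws = len m"
    using parabolic_reduced_word [OF J m] by blast
  have uc: "u \<in> carrier W" by (rule min_coset_reps_closed [OF u])
  have "dem g m = rup_word g ws" using dem_word_right [of ws g] ws J g by auto
  then have "bruhat u (rup_word g ws)" using le by simp
  then show ?thesis using ws(1)
  proof (induction ws rule: rev_induct)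
    case (snoc r ws)
    have r: "r \<in> J" "r \<in> S" "set ws \<subseteq> J" "set ws \<subseteq> S" using snoc.prems J by auto
    have "len u < len (u \<otimes> r)"
      using min_coset_rep_len [OF J u generate.incl [OF r(1)]] r by simp
    then have "bruhat u (rup_word g ws)"
      using le_rup_ascent [of r u "rup_word g ws"] snoc.prems r uc g by simp
    then show ?case using snoc.IH r by blast
  qed simp
qed

lemma dem_parabolic:
  assumes "J \<subseteq> S" "a \<in> generate W J" "b \<in> generate W J"
  shows "dem a b \<in> generate W J"
proof -
  obtain c where "bruhat c b" "dem a b = a \<otimes> c"
    using dem_factor parabolic_closed assms by blast
  then show ?thesis using parabolic_lower assms parabolic_mult by metis
qed

lemma dem_min_coset_rep:
  assumes "J \<subseteq> S" "d \<in> min_coset_reps (generate W J)" "b \<in> generate W J"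
  shows "dem d b = d \<otimes> b"
  using assms min_coset_rep_len parabolic_closed min_coset_reps_closed by (intro dem_additive) auto

text \<open>Multiplicativity \<open>K\<^sub>t\<^sub>u = K\<^sub>t K\<^sub>u\<close> when lengths
  add. Both sides obey the recursion of \<open>K_gen_mult\<close> in \<open>t\<close>, and removing
  a left descent keeps \<open>t\<close> minimal in its coset.\<close>

lemma K_coset_mult:
  assumes J: "J \<subseteq> S" and t: "t \<in> min_coset_reps (generate W J)" and u: "u \<in> generate W J"
  shows "K (t \<otimes> u) \<phi> = K t (\<lambda>a. K u (\<lambda>b. \<phi> (dem a b)))"
proof -
  have uc: "u \<in> carrier W" using u parabolic_closed [OF J] by blast
  have "t \<in> carrier W" by (rule min_coset_reps_closed [OF t])
  then show ?thesis using t
  proof (induction arbitrary: \<phi> rule: coxeter_induct)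
    case one
    have "K u (\<lambda>b. \<phi> (dem \<one> b)) = K u \<phi>" by (rule K_cong) simp
    then show ?case using uc by (simp add: K_one)
  next
    case (gen s t)
    have t: "t \<in> min_coset_reps (generate W J)"
      by (rule min_coset_rep_descent [OF J gen.prems gen.hyps])
    have a: "s \<otimes> t \<otimes> u = s \<otimes> (t \<otimes> u)" using gen uc by (simp add: m_assoc)
    have "len (t \<otimes> u) < len (s \<otimes> (t \<otimes> u))"
      using min_coset_rep_len [OF J t u] min_coset_rep_len [OF J gen.prems u] gen a by simp
    then have "K (s \<otimes> t \<otimes> u) \<phi> = K (t \<otimes> u) (\<lambda>a. \<phi> (up s a)) - K (t \<otimes> u) \<phi>"
      using gen uc by (simp add: a K_gen_mult)
    also have "\<dots> = K t (\<lambda>a. K u (\<lambda>b. \<phi> (up s (dem a b)))) - K t (\<lambda>a. K u (\<lambda>b. \<phi> (dem a b)))"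
      by (simp add: gen.IH [OF t])
    also have "K t (\<lambda>a. K u (\<lambda>b. \<phi> (up s (dem a b)))) = K t (\<lambda>a. K u (\<lambda>b. \<phi> (dem (up s a) b)))"
      by (intro K_cong) (simp add: dem_up gen)
    finally show ?case using gen by (simp add: K_gen_mult)
  qed
qed

text \<open>In the 0-Hecke algebra, viewed as a free right module over its parabolic subalgebra, the
  bases \<open>A\<close> and \<open>K\<close> indexed by minimal coset representatives are related by mutually inverse
  matrices. This is an entry of the product of these matrices.\<close>

lemma parabolic_inversion:
  assumes fin: "finite (carrier W)" and J: "J \<subseteq> S"
    and t: "t \<in> min_coset_reps (generate W J)" and v: "v \<in> min_coset_reps (generate W J)"
  shows "(\<Sum>y\<in>min_coset_reps (generate W J). \<Sum>z\<in>generate W J. mob y (t \<otimes> z) *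
      (\<Sum>w\<in>{w \<in> generate W J. bruhat (y \<otimes> w) v}. K w (\<lambda>b. \<psi> (dem z b)))) =
    of_bool (t = v) * \<psi> \<one>"
proof -
  let ?P = "generate W J" and ?D = "min_coset_reps (generate W J)"
  have Pc: "?P \<subseteq> carrier W" and Dc: "?D \<subseteq> carrier W"
    using parabolic_closed [OF J] min_coset_reps_closed by auto
  have finP: "finite ?P" and finD: "finite ?D" using fin Pc Dc finite_subset by auto
  have tc: "t \<in> carrier W" and vc: "v \<in> carrier W" using t v Dc by auto
  define I where "I = (\<lambda>y. {w \<in> ?P. bruhat (y \<otimes> w) v})"
  have finI: "finite (I y)" for y using finP by (simp add: I_def)
  \<comment> \<open>\<open>\<phi>\<close> is \<open>\<psi>\<close> transported to the coset of
    \<open>t\<close> and zero elsewhere. The claim is the expansion of \<open>\<phi> v\<close> by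
    \<open>K_inversion\<close>, with the elements below \<open>v\<close> grouped as
    \<open>y \<otimes> w\<close> for minimal \<open>y\<close>.\<close>
  define \<phi> where "\<phi> c = (if c \<in> (\<otimes>) t ` ?P then \<psi> (inv t \<otimes> c) else 0)" for c
  have phi: "\<phi> (d \<otimes> z) = of_bool (d = t) * \<psi> z" if "d \<in> ?D" "z \<in> ?P" for d z
  proof (cases "d = t")
    case True
    then show ?thesis using that Pc tc by (auto simp: \<phi>_def conj_cancel)
  next
    case False
    then have "d \<otimes> z \<notin> (\<otimes>) t ` ?P" using coset_rep_unique [OF J that(1) t that(2)] by blast
    then show ?thesis using False by (simp add: \<phi>_def)
  qed
  have "\<phi> v = of_bool (t = v) * \<psi> \<one>"
    using phi [OF v generate.one] vc by (auto simp: eq_commute)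
  moreover have "\<phi> v = (\<Sum>(y, w)\<in>Sigma ?D I. K (y \<otimes> w) \<phi>)"
  proof -
    have inj: "inj_on (\<lambda>(y, w). y \<otimes> w) (Sigma ?D I)"
    proof (rule inj_onI, clarify)
      fix y w y' w' assume "y \<in> ?D" "w \<in> I y" "y' \<in> ?D" "w' \<in> I y'" "y \<otimes> w = y' \<otimes> w'"
      then show "y = y' \<and> w = w'" using coset_rep_unique [OF J, of y y' w w'] by (simp add: I_def)
    qed
    have "(\<lambda>(y, w). y \<otimes> w) ` (Sigma ?D I) = {a. bruhat a v}"
    proof
      show "(\<lambda>(y, w). y \<otimes> w) ` (Sigma ?D I) \<subseteq> {a. bruhat a v}" by (auto simp: I_def)
      show "{a. bruhat a v} \<subseteq> (\<lambda>(y, w). y \<otimes> w) ` (Sigma ?D I)"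
      proof
        fix a assume a: "a \<in> {a. bruhat a v}"
        then have ac: "a \<in> carrier W" using bruhat_carrier by blast
        obtain d u where "d \<in> ?D" "u \<in> ?P" "a = d \<otimes> u"
          by (rule coset_decomposition [OF J ac])
        then show "a \<in> (\<lambda>(y, w). y \<otimes> w) ` (Sigma ?D I)"
          using a by (intro image_eqI [of _ _ "(d, u)"]) (auto simp: I_def)
      qed
    qed
    then have "(\<Sum>a\<in>{a. bruhat a v}. K a \<phi>) = (\<Sum>(y, w)\<in>Sigma ?D I. K (y \<otimes> w) \<phi>)"
      using sum.reindex [OF inj, of "\<lambda>a. K a \<phi>"] by (simp add: case_prod_unfold)
    then show ?thesis using K_inversion [OF vc] by simp
  qed
  moreover have "(\<Sum>(y, w)\<in>Sigma ?D I. K (y \<otimes> w) \<phi>) = (\<Sum>y\<in>?D. \<Sum>w\<in>I y. K (y \<otimes> w) \<phi>)"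
    using finD finI by (subst sum.Sigma) auto
  moreover have "K (y \<otimes> w) \<phi> = (\<Sum>z\<in>?P. mob y (t \<otimes> z) * K w (\<lambda>b. \<psi> (dem z b)))"
    if y: "y \<in> ?D" and w: "w \<in> ?P" for y w
  proof -
    have wc: "w \<in> carrier W" using w Pc by blast
    \<comment> \<open>Demazure multiplication on the right by elements of the parabolic subgroup
      does not leave the coset of \<open>d\<close>, so only the coset of \<open>t\<close>, where
      \<open>\<phi>\<close> lives, contributes.\<close>
    have val: "K w (\<lambda>b. \<phi> (dem (d \<otimes> z) b)) = of_bool (d = t) * K w (\<lambda>b. \<psi> (dem z b))"
      if d: "d \<in> ?D" and z: "z \<in> ?P" for d z
    proof -
      have cl: "d \<in> carrier W" "z \<in> carrier W" using d z Dc Pc by auto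
      have "\<phi> (dem (d \<otimes> z) b) = of_bool (d = t) * \<psi> (dem z b)" if "bruhat b w" for b
      proof -
        have b: "b \<in> ?P" using parabolic_lower [OF J that w] .
        have "dem (d \<otimes> z) b = dem d (dem z b)"
          using dem_min_coset_rep [OF J d z] dem_assoc cl b Pc by (metis subsetD)
        also have "\<dots> = d \<otimes> dem z b"
          by (rule dem_min_coset_rep [OF J d dem_parabolic [OF J z b]])
        finally show ?thesis using phi [OF d dem_parabolic [OF J z b]] by simp
      qed
      then show ?thesis unfolding K_def sum_distrib_left by (intro sum.cong) auto
    qed
    have "K (y \<otimes> w) \<phi> = (\<Sum>a\<in>carrier W. mob y a * K w (\<lambda>b. \<phi> (dem a b)))"
      using K_coset_mult [OF J y w] K_mob [OF fin] by simp
    also have "\<dots> = (\<Sum>a\<in>(\<otimes>) t ` ?P. mob y a * K w (\<lambda>b. \<phi> (dem a b)))"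
    proof (rule sum.mono_neutral_right [OF fin])
      show "(\<otimes>) t ` ?P \<subseteq> carrier W" using tc Pc by auto
      show "\<forall>a\<in>carrier W - (\<otimes>) t ` ?P. mob y a * K w (\<lambda>b. \<phi> (dem a b)) = 0"
      proof
        fix a assume a: "a \<in> carrier W - (\<otimes>) t ` ?P"
        then obtain d z where dz: "d \<in> ?D" "z \<in> ?P" "a = d \<otimes> z"
          using coset_decomposition [OF J] by blast
        then have "d \<noteq> t" using a by blast
        then show "mob y a * K w (\<lambda>b. \<phi> (dem a b)) = 0" using val [OF dz(1,2)] dz(3) by simp
      qed
    qed
    also have "\<dots> = (\<Sum>z\<in>?P. mob y (t \<otimes> z) * K w (\<lambda>b. \<phi> (dem (t \<otimes> z) b)))"
    proof (subst sum.reindex)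
      show "inj_on ((\<otimes>) t) ?P" using tc Pc by (intro inj_onI) (metis conj_cancel(1) subsetD)
    qed simp
    also have "\<dots> = (\<Sum>z\<in>?P. mob y (t \<otimes> z) * K w (\<lambda>b. \<psi> (dem z b)))"
      using val [OF t] by (intro sum.cong) auto
    finally show ?thesis .
  qed
  then have "(\<Sum>y\<in>?D. \<Sum>w\<in>I y. K (y \<otimes> w) \<phi>) =
      (\<Sum>y\<in>?D. \<Sum>w\<in>I y. \<Sum>z\<in>?P. mob y (t \<otimes> z) * K w (\<lambda>b. \<psi> (dem z b)))"
    by (intro sum.cong) (auto simp: I_def)
  moreover have "\<dots> = (\<Sum>y\<in>?D. \<Sum>z\<in>?P. mob y (t \<otimes> z) * (\<Sum>w\<in>I y. K w (\<lambda>b. \<psi> (dem z b))))"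
    unfolding sum_distrib_left by (intro sum.cong refl sum.swap)
  ultimately show ?thesis by (simp add: I_def)
qed

end

section \<open>Laurent coefficients\<close>

lemma qpow_mult: "qpow a * qpow b = qpow (a + b)"
  by (simp add: qpow_def mult_single algebra_simps)

lemma qpow_zero [simp]: "qpow 0 = 1"
  by (simp add: qpow_def)

lemma qpow_power: "qpow a ^ n = qpow (int n * a)"
  by (induction n) (simp_all add: qpow_mult algebra_simps)

lemma laurent_bar_add: "laurent_bar (f + g) = laurent_bar f + laurent_bar g"
  unfolding laurent_bar_def by (rule map_key_plus) simp

lemma laurent_bar_single: "laurent_bar (Poly_Mapping.single k c) = Poly_Mapping.single (- k) c"
  unfolding laurent_bar_def using map_key_single [of uminus "- k" c] by simp

lemma laurent_bar_sum: "laurent_bar (sum f A) = (\<Sum>x\<in>A. laurent_bar (f x))"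
proof -
  have "laurent_bar 0 = 0" using laurent_bar_single [of 0 0] by simp
  then show ?thesis by (induction A rule: infinite_finite_induct) (simp_all add: laurent_bar_add)
qed

abbreviation qinv :: laurent where
  "qinv \<equiv> qpow (- 1)"

text \<open>Substitution of \<open>q\<^sup>-\<^sup>1\<close> for the variable. It is an injective
  ring homomorphism, so the Hecke computations can be done over \<open>int poly\<close> with the
  variable in the role of \<open>q\<^sup>-\<^sup>1\<close>, and then be evaluated at 0.\<close>

definition inv_poly :: "int poly \<Rightarrow> laurent" where
  "inv_poly r = laurent_bar (laurent_of_poly r)"

lemma inv_poly_altdef: "inv_poly r = (\<Sum>k\<le>degree r. of_int (coeff r k) * qinv ^ k)"
proof -
  have deg: "degree (map_poly (of_int :: int \<Rightarrow> laurent) r) = degree r"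
    by (rule degree_map_poly) simp
  have s: "of_int c * qpow a = Poly_Mapping.single (2 * a) c" for c a
    using mult_single [of 0 c "2 * a" "1::int"] single_of_int [of c, where 'a = int and 'b = int]
    by (simp add: qpow_def)
  show ?thesis
    by (simp add: inv_poly_def laurent_of_poly_def poly_altdef deg coeff_map_poly qpow_power s
        laurent_bar_sum laurent_bar_single)
qed

lemma inv_poly_eq: "inv_poly r = poly (map_poly of_int r) qinv"
proof -
  have "degree (map_poly (of_int :: int \<Rightarrow> laurent) r) = degree r"
    by (rule degree_map_poly) simp
  then show ?thesis by (simp add: inv_poly_altdef poly_altdef coeff_map_poly)
qed

lemma inv_poly_pCons: "inv_poly (pCons a p) = of_int a + qinv * inv_poly p"
  by (simp add: inv_poly_eq map_poly_pCons)

lemma inv_poly_0 [simp]: "inv_poly 0 = 0"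
  by (simp add: inv_poly_eq)

lemma inv_poly_1 [simp]: "inv_poly 1 = 1"
  using inv_poly_pCons [of 1 0] by (simp add: one_pCons)

lemma inv_poly_X [simp]: "inv_poly [:0, 1:] = qinv"
  by (simp add: inv_poly_pCons)

lemma inv_poly_add [simp]: "inv_poly (p + r) = inv_poly p + inv_poly r"
proof (induction p arbitrary: r)
  case (pCons a p)
  then show ?case by (cases r) (simp add: inv_poly_pCons algebra_simps)
qed simp

lemma inv_poly_smult: "inv_poly (smult a p) = of_int a * inv_poly p"
  by (induction p) (simp_all add: inv_poly_pCons algebra_simps)

lemma inv_poly_mult [simp]: "inv_poly (p * r) = inv_poly p * inv_poly r"
  by (induction p) (simp_all add: inv_poly_pCons inv_poly_smult algebra_simps)

lemma inv_poly_minus [simp]: "inv_poly (- p) = - inv_poly p"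
  using inv_poly_add [of p "- p"] by (simp add: eq_neg_iff_add_eq_0 add.commute)

lemma inv_poly_diff [simp]: "inv_poly (p - r) = inv_poly p - inv_poly r"
  using inv_poly_add [of p "- r"] by simp

lemma inv_poly_sum [simp]: "inv_poly (sum f A) = (\<Sum>x\<in>A. inv_poly (f x))"
  by (induction A rule: infinite_finite_induct) simp_all

lemma inv_poly_of_bool [simp]: "inv_poly (of_bool b) = of_bool b"
  by (cases b) simp_all

text \<open>The factor 2 is there because exponents of \<open>laurent\<close> count powers of
  \<open>q^(1/2)\<close>. This recovers the coefficients and hence gives injectivity.\<close>

lemma lookup_inv_poly: "Poly_Mapping.lookup (inv_poly r) (- 2 * int k) = coeff r k"
proof -
  have s: "of_int c * qinv ^ i = Poly_Mapping.single (- 2 * int i) c" for c i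
    using mult_single [of 0 c "- 2 * int i" "1::int"]
      single_of_int [of c, where 'a = int and 'b = int] qpow_power [of "- 1" i]
    by (simp add: qpow_def)
  have "Poly_Mapping.lookup (inv_poly r) (- 2 * int k) =
      (\<Sum>i\<le>degree r. if i = k then coeff r i else 0)"
    unfolding inv_poly_altdef s lookup_sum
    by (intro sum.cong) (auto simp: lookup_single when_def)
  also have "\<dots> = coeff r k" by (simp add: coeff_eq_0)
  finally show ?thesis .
qed

lemma inv_poly_inject: "inv_poly p = inv_poly r \<Longrightarrow> p = r"
  by (rule poly_eqI) (metis lookup_inv_poly)

text \<open>Resolves the definite descriptions behind both kinds of R-polynomials:
  \<open>qpow n\<close> is a unit and \<open>inv_poly\<close> is injective, so any exhibited
  solution is the unique one.\<close>

lemma the_inv_poly: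
  assumes "f = qpow n * inv_poly p"
  shows "(THE r. f = qpow n * laurent_bar (laurent_of_poly r)) = p"
proof (rule the_equality)
  show "f = qpow n * laurent_bar (laurent_of_poly p)" using assms by (simp add: inv_poly_def)
  fix r assume "f = qpow n * laurent_bar (laurent_of_poly r)"
  then have "qpow n * inv_poly r = qpow n * inv_poly p"
    by (metis assms inv_poly_def)
  moreover have "qpow (- n) * (qpow n * g) = g" for g
    by (simp add: mult.assoc [symmetric] qpow_mult)
  ultimately have "inv_poly r = inv_poly p" by metis
  then show "r = p" by (rule inv_poly_inject)
qed


section \<open>The Hecke algebra and its bar involution\<close>

lemma basis_vec_of_bool: "basis_vec a x = of_bool (x = a)"
  by (simp add: basis_vec_def)

context coxeter_group
begin

text \<open>The operators below are the left and right multiplications by \<open>A\<^sub>s\<close>, over any commutative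
  ring with the parameter \<open>q\<close> in place of \<open>q\<^sup>-\<^sup>1\<close>. Taking \<open>q = 0\<close> gives the 0-Hecke algebra.\<close>

definition basis_image :: "'r::comm_ring_1 \<Rightarrow> 'w \<Rightarrow> 'w \<Rightarrow> 'w \<Rightarrow> 'r" where
  "basis_image q s w x = (if len w < len (s \<otimes> w) then of_bool (x = s \<otimes> w)
     else q * of_bool (x = s \<otimes> w) + (1 - q) * of_bool (x = w))"

definition lact :: "'r::comm_ring_1 \<Rightarrow> 'w \<Rightarrow> ('w \<Rightarrow> 'r) \<Rightarrow> 'w \<Rightarrow> 'r" where
  "lact q s h = (\<lambda>x. \<Sum>w\<in>carrier W. h w * basis_image q s w x)"

definition ract :: "'r::comm_ring_1 \<Rightarrow> 'w \<Rightarrow> ('w \<Rightarrow> 'r) \<Rightarrow> 'w \<Rightarrow> 'r" where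
  "ract q r h = (\<lambda>x. if x \<in> carrier W then
     (if len x < len (x \<otimes> r) then q * h (x \<otimes> r) else h (x \<otimes> r) + (1 - q) * h x) else 0)"

text \<open>As \<open>A\<^sub>s\<close> satisfies \<open>X\<^sup>2 = q + (1 - q) X\<close>, the
  operator \<open>A\<^sub>s - (1 - q)\<close> equals \<open>q\<close> times the inverse of
  \<open>A\<^sub>s\<close> for invertible \<open>q\<close>. Unlike the inverse it still makes sense
  at \<open>q = 0\<close>, where it becomes \<open>A\<^sub>s - 1\<close>.\<close>

definition kact :: "'r::comm_ring_1 \<Rightarrow> 'w \<Rightarrow> ('w \<Rightarrow> 'r) \<Rightarrow> 'w \<Rightarrow> 'r" where
  "kact q s h = (\<lambda>x. lact q s h x - (1 - q) * h x)"

definition supported :: "('w \<Rightarrow> 'r::zero) \<Rightarrow> bool" where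
  "supported h \<longleftrightarrow> (\<forall>x. x \<notin> carrier W \<longrightarrow> h x = 0)"

definition unit_vec :: "'w \<Rightarrow> 'w \<Rightarrow> 'r::comm_ring_1" where
  "unit_vec a x = of_bool (x = a)"

definition kvec :: "'r::comm_ring_1 \<Rightarrow> 'w list \<Rightarrow> 'w \<Rightarrow> 'r" where
  "kvec q ws = foldr (kact q) ws (unit_vec \<one>)"

lemma gen_act_lact: "gen_act = lact qinv"
proof -
  have "gen_times_basis s w x = basis_image qinv s w x" for s w x
    by (simp add: gen_times_basis_def basis_image_def basis_vec_of_bool)
  then show ?thesis by (simp add: gen_act_def lact_def fun_eq_iff)
qed

end

locale finite_coxeter_group = coxeter_group +
  assumes W_finite: "finite (carrier W)"
begin

lemma lact_outside: "s \<in> S \<Longrightarrow> x \<notin> carrier W \<Longrightarrow> lact q s h x = 0"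
  unfolding lact_def basis_image_def by (intro sum.neutral) auto

lemma lact_closed_form:
  assumes s: "s \<in> S" and x: "x \<in> carrier W"
  shows "lact q s h x = (if len x < len (s \<otimes> x) then q * h (s \<otimes> x) else h (s \<otimes> x) + (1 - q) * h x)"
proof -
  have sw: "x = s \<otimes> w \<longleftrightarrow> w = s \<otimes> x" if "w \<in> carrier W" for w
    using that s x by auto
  have "lact q s h x = (\<Sum>w\<in>carrier W.
      (if w = s \<otimes> x then h w * (if len w < len (s \<otimes> w) then 1 else q) else 0) +
      (if w = x then h w * (if len w < len (s \<otimes> w) then 0 else 1 - q) else 0))"
    unfolding lact_def
  proof (intro sum.cong refl)
    fix w assume w: "w \<in> carrier W"
    show "h w * basis_image q s w x =
      (if w = s \<otimes> x then h w * (if len w < len (s \<otimes> w) then 1 else q) else 0) +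
      (if w = x then h w * (if len w < len (s \<otimes> w) then 0 else 1 - q) else 0)"
      unfolding basis_image_def sw [OF w] eq_commute [of x w]
      by (simp add: of_bool_def algebra_simps)
  qed
  also have "\<dots> = h (s \<otimes> x) * (if len (s \<otimes> x) < len x then 1 else q) +
      h x * (if len x < len (s \<otimes> x) then 0 else 1 - q)"
    using s x W_finite by (simp add: sum.distrib)
  finally show ?thesis using len_gen_neq [OF s x] by (auto simp: algebra_simps)
qed

lemma lact_cmult: "lact q s (\<lambda>x. c * h x) = (\<lambda>x. c * lact q s h x)"
  by (simp add: lact_def sum_distrib_left mult.assoc)

lemma lact_diff: "lact q s (\<lambda>x. f x - h x) = (\<lambda>x. lact q s f x - lact q s h x)"
  by (simp add: lact_def left_diff_distrib sum_subtractf)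

lemma ract_cmult: "ract q s (\<lambda>x. c * h x) = (\<lambda>x. c * ract q s h x)"
  by (auto simp: ract_def algebra_simps)

lemma ract_diff: "ract q s (\<lambda>x. f x - h x) = (\<lambda>x. ract q s f x - ract q s h x)"
  by (auto simp: ract_def algebra_simps)

lemma ract_sum: "ract q s (\<lambda>x. \<Sum>i\<in>A. f i x) = (\<lambda>x. \<Sum>i\<in>A. ract q s (f i) x)"
  by (auto simp: ract_def sum_distrib_left sum.distrib)

lemma supported_lact [simp]: "s \<in> S \<Longrightarrow> supported (lact q s h)"
  by (simp add: supported_def lact_outside)

lemma supported_kact [simp]: "s \<in> S \<Longrightarrow> supported h \<Longrightarrow> supported (kact q s h)"
  by (simp add: supported_def kact_def lact_outside)

lemma supported_unit_vec [simp]: "a \<in> carrier W \<Longrightarrow> supported (unit_vec a)"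
  by (auto simp: supported_def unit_vec_def)

lemma lact_unit_vec:
  assumes "s \<in> S" "w \<in> carrier W" "len w < len (s \<otimes> w)"
  shows "lact q s (unit_vec w) = unit_vec (s \<otimes> w)"
proof
  fix x
  show "lact q s (unit_vec w) x = unit_vec (s \<otimes> w) x"
  proof (cases "x \<in> carrier W")
    case True
    then have "s \<otimes> x = w \<longleftrightarrow> x = s \<otimes> w" using assms by auto
    then show ?thesis using assms True by (auto simp: lact_closed_form unit_vec_def)
  next
    case False
    then show ?thesis using assms by (auto simp: lact_outside unit_vec_def)
  qed
qed

lemma ract_unit_vec:
  assumes "s \<in> S" "w \<in> carrier W" "len w < len (w \<otimes> s)"
  shows "ract q s (unit_vec w) = unit_vec (w \<otimes> s)"
proof
  fix x
  show "ract q s (unit_vec w) x = unit_vec (w \<otimes> s) x"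
  proof (cases "x \<in> carrier W")
    case True
    then have "x \<otimes> s = w \<longleftrightarrow> x = w \<otimes> s" using assms by auto
    then show ?thesis using assms True by (auto simp: ract_def unit_vec_def)
  next
    case False
    then show ?thesis using assms by (auto simp: ract_def unit_vec_def)
  qed
qed

text \<open>This takes the place of associativity of the Hecke algebra. Among \<open>x\<close>,
  \<open>s \<otimes> x\<close>, \<open>x \<otimes> r\<close> and
  \<open>s \<otimes> x \<otimes> r\<close>, parallel edges point in the same direction, by length
  parity or by folding, unless \<open>s \<otimes> x = x \<otimes> r\<close>; in either case the
  coefficients agree.\<close>

lemma lact_ract_commute:
  assumes s: "s \<in> S" and r: "r \<in> S"
  shows "lact q s (ract q r h) = ract q r (lact q s h)"
proof
  fix x
  show "lact q s (ract q r h) x = ract q r (lact q s h) x"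
  proof (cases "x \<in> carrier W")
    case False
    then show ?thesis using s by (simp add: lact_outside ract_def)
  next
    case x: True
    have cl: "s \<otimes> x \<in> carrier W" "x \<otimes> r \<in> carrier W" "s \<otimes> x \<otimes> r \<in> carrier W" using s r x by auto
    have as: "s \<otimes> (x \<otimes> r) = s \<otimes> x \<otimes> r" using s r x by (simp add: m_assoc)
    note neq = len_gen_neq [OF s x] len_gen_neq_right [OF r x] len_gen_neq_right [OF r cl(1)]
      len_gen_neq [OF s cl(2), unfolded as]
    note le = len_gen_mult_le [OF s x] len_mult_gen_le [OF r x] len_le_gen_mult [OF s x]
      len_le_mult_gen [OF r x] len_mult_gen_le [OF r cl(1)] len_le_mult_gen [OF r cl(1)]
      len_gen_mult_le [OF s cl(2), unfolded as] len_le_gen_mult [OF s cl(2), unfolded as]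
    have L: "lact q s (ract q r h) x =
        (if len x < len (s \<otimes> x)
         then q * (if len (s \<otimes> x) < len (s \<otimes> x \<otimes> r) then q * h (s \<otimes> x \<otimes> r)
           else h (s \<otimes> x \<otimes> r) + (1 - q) * h (s \<otimes> x))
         else (if len (s \<otimes> x) < len (s \<otimes> x \<otimes> r) then q * h (s \<otimes> x \<otimes> r)
           else h (s \<otimes> x \<otimes> r) + (1 - q) * h (s \<otimes> x)) +
           (1 - q) * (if len x < len (x \<otimes> r) then q * h (x \<otimes> r) else h (x \<otimes> r) + (1 - q) * h x))"
      using s x cl by (simp add: lact_closed_form ract_def)
    have R: "ract q r (lact q s h) x =
        (if len x < len (x \<otimes> r)
         then q * (if len (x \<otimes> r) < len (s \<otimes> x \<otimes> r) then q * h (s \<otimes> x \<otimes> r)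
           else h (s \<otimes> x \<otimes> r) + (1 - q) * h (x \<otimes> r))
         else (if len (x \<otimes> r) < len (s \<otimes> x \<otimes> r) then q * h (s \<otimes> x \<otimes> r)
           else h (s \<otimes> x \<otimes> r) + (1 - q) * h (x \<otimes> r)) +
           (1 - q) * (if len x < len (s \<otimes> x) then q * h (s \<otimes> x) else h (s \<otimes> x) + (1 - q) * h x))"
      using s x cl by (simp add: lact_closed_form ract_def as)
    consider (eq) "s \<otimes> x = x \<otimes> r" | (neq) "s \<otimes> x \<noteq> x \<otimes> r" by blast
    then show ?thesis
    proof cases
      case eq
      then show ?thesis unfolding L R by simp
    next
      case neq
      have 1: "len (s \<otimes> x) < len (s \<otimes> x \<otimes> r) \<and> len (x \<otimes> r) < len (s \<otimes> x \<otimes> r)"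
        if a: "len x < len (s \<otimes> x)" "len x < len (x \<otimes> r)"
      proof -
        have "\<not> len (s \<otimes> x \<otimes> r) < len (s \<otimes> x)" "\<not> len (s \<otimes> x \<otimes> r) < len (x \<otimes> r)"
          using folding [OF s r x a(1)] folding_right [OF s r x a(2)] neq by blast+
        then show ?thesis
          using len_gen_neq_right [OF r cl(1)] len_gen_neq [OF s cl(2), unfolded as] by linarith
      qed
      have 2: "\<not> len (s \<otimes> x) < len (s \<otimes> x \<otimes> r) \<and> \<not> len (x \<otimes> r) < len (s \<otimes> x \<otimes> r)"
        if a: "\<not> len x < len (s \<otimes> x)" "\<not> len x < len (x \<otimes> r)"
      proof -
        have xrr: "x \<otimes> r \<otimes> r = x" "s \<otimes> (s \<otimes> x) = x" using s r x by auto
        have "\<not> len (x \<otimes> r) < len (s \<otimes> x \<otimes> r)"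
        proof
          assume l: "len (x \<otimes> r) < len (s \<otimes> x \<otimes> r)"
          have "len (s \<otimes> (x \<otimes> r) \<otimes> r) < len (x \<otimes> r \<otimes> r)"
            using a(1) len_gen_neq [OF s x] r s x by (simp add: as)
          then have "s \<otimes> (x \<otimes> r) = x \<otimes> r \<otimes> r" using folding [OF s r cl(2)] l as by simp
          then have "s \<otimes> (s \<otimes> (x \<otimes> r)) = s \<otimes> x" using xrr by simp
          then show False using neq s cl by simp
        qed
        moreover have "\<not> len (s \<otimes> x) < len (s \<otimes> x \<otimes> r)"
        proof
          assume l: "len (s \<otimes> x) < len (s \<otimes> x \<otimes> r)"
          have "len (s \<otimes> (s \<otimes> x) \<otimes> r) < len (s \<otimes> (s \<otimes> x))"
            using a(2) len_gen_neq_right [OF r x] s x by simp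
          then have "s \<otimes> (s \<otimes> x) = s \<otimes> x \<otimes> r" using folding_right [OF s r cl(1) l] by simp
          then have "x \<otimes> r = s \<otimes> x \<otimes> r \<otimes> r" using xrr by simp
          then show False using neq r cl by simp
        qed
        ultimately show ?thesis by blast
      qed
      show ?thesis
      proof (cases "len x < len (s \<otimes> x)"; cases "len x < len (x \<otimes> r)")
        assume a: "len x < len (s \<otimes> x)" "len x < len (x \<otimes> r)"
        then show ?thesis using 1 [OF a] unfolding L R by (simp add: algebra_simps)
      next
        assume a: "len x < len (s \<otimes> x)" "\<not> len x < len (x \<otimes> r)"
        have "\<not> len (s \<otimes> x) < len (s \<otimes> x \<otimes> r)" "len (x \<otimes> r) < len (s \<otimes> x \<otimes> r)"
          using a le len_gen_neq_right [OF r x] by linarith+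
        then show ?thesis using a unfolding L R by (simp add: algebra_simps)
      next
        assume a: "\<not> len x < len (s \<otimes> x)" "len x < len (x \<otimes> r)"
        have "len (s \<otimes> x) < len (s \<otimes> x \<otimes> r)" "\<not> len (x \<otimes> r) < len (s \<otimes> x \<otimes> r)"
          using a le len_gen_neq [OF s x] by linarith+
        then show ?thesis using a unfolding L R by (simp add: algebra_simps)
      next
        assume a: "\<not> len x < len (s \<otimes> x)" "\<not> len x < len (x \<otimes> r)"
        then show ?thesis using 2 [OF a] unfolding L R by (simp add: algebra_simps)
      qed
    qed
  qed
qed

lemma kact_ract_commute:
  "s \<in> S \<Longrightarrow> r \<in> S \<Longrightarrow> kact q s (ract q r h) = ract q r (kact q s h)"
  by (simp add: kact_def lact_ract_commute ract_diff ract_cmult)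

lemma lact_lact:
  assumes "s \<in> S" "supported h"
  shows "lact q s (lact q s h) = (\<lambda>x. q * h x + (1 - q) * lact q s h x)"
proof
  fix x
  show "lact q s (lact q s h) x = q * h x + (1 - q) * lact q s h x"
    using assms len_gen_neq [of s x]
    by (cases "x \<in> carrier W") (auto simp: lact_closed_form lact_outside supported_def algebra_simps)
qed

lemma lact_kact: "s \<in> S \<Longrightarrow> supported h \<Longrightarrow> lact q s (kact q s h) = (\<lambda>x. q * h x)"
  and kact_lact: "s \<in> S \<Longrightarrow> supported h \<Longrightarrow> kact q s (lact q s h) = (\<lambda>x. q * h x)"
  by (simp_all add: kact_def lact_diff lact_cmult lact_lact)

lemma kact_cmult: "kact q s (\<lambda>x. c * h x) = (\<lambda>x. c * kact q s h x)"
  by (simp add: kact_def lact_cmult algebra_simps)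

lemma foldr_lact_cmult: "foldr (lact q) ws (\<lambda>x. c * h x) = (\<lambda>x. c * foldr (lact q) ws h x)"
  by (induction ws) (simp_all add: lact_cmult)

lemma foldr_kact_cmult: "foldr (kact q) ws (\<lambda>x. c * h x) = (\<lambda>x. c * foldr (kact q) ws h x)"
  by (induction ws) (simp_all add: kact_cmult)

lemma supported_foldr_lact: "set ws \<subseteq> S \<Longrightarrow> supported h \<Longrightarrow> supported (foldr (lact q) ws h)"
  by (induction ws) auto

lemma supported_foldr_kact: "set ws \<subseteq> S \<Longrightarrow> supported h \<Longrightarrow> supported (foldr (kact q) ws h)"
  by (induction ws) auto

text \<open>The reversed word makes mutually inverse factors meet in the middle, and every pair
  leaves one factor \<open>q\<close>.\<close>

lemma foldr_lact_kact:
  "set ws \<subseteq> S \<Longrightarrow> supported h \<Longrightarrow>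
    foldr (lact q) ws (foldr (kact q) (rev ws) h) = (\<lambda>x. q ^ length ws * h x)"
proof (induction ws arbitrary: h)
  case (Cons s ws)
  then show ?case by (simp add: lact_cmult lact_kact mult.left_commute mult.assoc)
qed simp

lemma foldr_kact_lact:
  "set ws \<subseteq> S \<Longrightarrow> supported h \<Longrightarrow>
    foldr (kact q) (rev ws) (foldr (lact q) ws h) = (\<lambda>x. q ^ length ws * h x)"
proof (induction ws arbitrary: h)
  case (Cons s ws)
  then show ?case
    by (simp add: kact_lact supported_foldr_lact foldr_kact_cmult mult.left_commute mult.assoc)
qed simp

definition ract_word :: "'r::comm_ring_1 \<Rightarrow> 'a list \<Rightarrow> ('a \<Rightarrow> 'r) \<Rightarrow> 'a \<Rightarrow> 'r" where
  "ract_word q ws h = foldl (\<lambda>h r. ract q r h) h ws"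

lemma ract_word_simps [simp]: "ract_word q [] h = h"
  "ract_word q (ws @ [r]) h = ract q r (ract_word q ws h)"
  by (simp_all add: ract_word_def)

lemma lact_ract_word:
  "s \<in> S \<Longrightarrow> set ws \<subseteq> S \<Longrightarrow> lact q s (ract_word q ws h) = ract_word q ws (lact q s h)"
  by (induction ws rule: rev_induct) (auto simp: lact_ract_commute)

lemma kact_ract_word:
  "s \<in> S \<Longrightarrow> set ws \<subseteq> S \<Longrightarrow> kact q s (ract_word q ws h) = ract_word q ws (kact q s h)"
  by (induction ws rule: rev_induct) (auto simp: kact_ract_commute)

lemma foldr_lact_ract_word:
  "set us \<subseteq> S \<Longrightarrow> set ws \<subseteq> S \<Longrightarrow>
    foldr (lact q) us (ract_word q ws h) = ract_word q ws (foldr (lact q) us h)"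
  by (induction us) (auto simp: lact_ract_word)

lemma foldr_kact_ract_word:
  "set us \<subseteq> S \<Longrightarrow> set ws \<subseteq> S \<Longrightarrow>
    foldr (kact q) us (ract_word q ws h) = ract_word q ws (foldr (kact q) us h)"
  by (induction us) (auto simp: kact_ract_word)

lemma ract_word_cmult: "ract_word q ws (\<lambda>x. c * h x) = (\<lambda>x. c * ract_word q ws h x)"
  by (induction ws rule: rev_induct) (auto simp: ract_cmult)

lemma ract_word_sum:
  "ract_word q ws (\<lambda>x. \<Sum>i\<in>A. f i x) = (\<lambda>x. \<Sum>i\<in>A. ract_word q ws (f i) x)"
  by (induction ws rule: rev_induct) (auto simp: ract_sum)

lemma foldr_lact_unit_vec:
  "set ws \<subseteq> S \<Longrightarrow> len (word_prod ws) = length ws \<Longrightarrow>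
    foldr (lact q) ws (unit_vec \<one>) = unit_vec (word_prod ws)"
proof (induction ws)
  case (Cons s ws)
  then show ?case using reduced_tail [OF Cons.prems] by (simp add: lact_unit_vec)
qed simp

lemma ract_word_unit_vec:
  "set ws \<subseteq> S \<Longrightarrow> len (word_prod ws) = length ws \<Longrightarrow>
    ract_word q ws (unit_vec \<one>) = unit_vec (word_prod ws)"
proof (induction ws rule: rev_induct)
  case (snoc r ws)
  note l = reduced_init [OF snoc.prems]
  have "ract_word q ws (unit_vec \<one>) = unit_vec (word_prod ws)"
    using snoc.IH snoc.prems(1) l(1) by simp
  then show ?case unfolding l(3) using snoc.prems(1) l(2) by (simp add: ract_unit_vec)
qed simp

section \<open>The bar involution along reduced words\<close>

lemma hecke_mult_basis_vec:
  "w \<in> carrier W \<Longrightarrow> hecke_mult (basis_vec w) h = foldr (lact qinv) (reduced_word w) h"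
  using W_finite by (simp add: hecke_mult_def gen_act_lact basis_vec_def if_distrib [of "\<lambda>x. x * _"] cong: if_cong)

text \<open>The inverse of \<open>A\<close> at \<open>v = inv w\<close> is, up to a power of
  \<open>q\<close>, the product of the \<open>kact\<close> along a reduced word of \<open>v\<close>
  read backwards. Since \<open>hecke_mult\<close> is built from left actions, multiplication by
  \<open>A\<close> at \<open>v\<close> from the right is rewritten as a right action, which commutes
  with them. Uniqueness needs only the left action of \<open>v\<close>.\<close>

lemma hecke_bar_kvec:
  assumes w: "w \<in> carrier W"
  shows "hecke_bar w = (\<lambda>x. qpow (int (len w)) * kvec qinv (rev (reduced_word (inv w))) x)"
proof -
  define v where "v = inv w"
  define vs where "vs = reduced_word v"
  have v: "v \<in> carrier W" using w by (simp add: v_def)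
  have vs: "set vs \<subseteq> S" "length vs = len w" "word_prod vs = v" "len (word_prod vs) = length vs"
    using reduced_word [OF v] w by (auto simp: vs_def v_def)
  have unit: "basis_vec a = (unit_vec a :: 'a \<Rightarrow> laurent)" for a
    by (auto simp: basis_vec_def unit_vec_def)
  let ?n = "qpow (int (len w))"
  have nq: "?n * (qinv ^ length vs * c) = c" for c
    by (simp add: qpow_power vs(2) mult.assoc [symmetric] qpow_mult)
  define h where "h = (\<lambda>x. ?n * kvec qinv (rev vs) x)"
  have k: "supported (kvec qinv (rev vs))" unfolding kvec_def using vs by (intro supported_foldr_kact) auto
  have h_supp: "supported h" using k by (simp add: h_def supported_def)
  have right: "foldr (lact qinv) vs h = unit_vec \<one>"
    unfolding h_def kvec_def foldr_lact_cmult using vs by (simp add: foldr_lact_kact nq [unfolded vs(2)])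
  have v_fold: "unit_vec v = ract_word qinv vs (unit_vec \<one>)"
    by (metis ract_word_unit_vec vs(1,3,4))
  have "hecke_mult h (unit_vec v) = ract_word qinv vs h"
  proof -
    have "foldr (lact qinv) (reduced_word a) (unit_vec v) = ract_word qinv vs (unit_vec a)"
      if "a \<in> carrier W" for a
      using that reduced_word [OF that] vs(1)
      by (simp add: v_fold foldr_lact_ract_word foldr_lact_unit_vec)
    then have "hecke_mult h (unit_vec v) =
        (\<lambda>x. \<Sum>a\<in>carrier W. h a * ract_word qinv vs (unit_vec a) x)"
      unfolding hecke_mult_def gen_act_lact by (intro ext sum.cong) auto
    also have "\<dots> = ract_word qinv vs (\<lambda>x. \<Sum>a\<in>carrier W. h a * unit_vec a x)"
      by (simp add: ract_word_sum ract_word_cmult)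
    also have "(\<lambda>x. \<Sum>a\<in>carrier W. h a * unit_vec a x) = h"
      using h_supp W_finite by (intro ext) (auto simp: unit_vec_def of_bool_def supported_def if_distrib [of "\<lambda>x. _ * x"] cong: if_cong)
    finally show ?thesis .
  qed
  also have "\<dots> = (\<lambda>x. ?n * foldr (kact qinv) (rev vs) (ract_word qinv vs (unit_vec \<one>)) x)"
    unfolding h_def kvec_def ract_word_cmult using vs by (simp add: foldr_kact_ract_word)
  also have "ract_word qinv vs (unit_vec \<one>) = foldr (lact qinv) vs (unit_vec \<one>)"
    using vs by (simp add: ract_word_unit_vec foldr_lact_unit_vec)
  also have "(\<lambda>x. ?n * foldr (kact qinv) (rev vs) \<dots> x) = unit_vec \<one>"
    using vs by (simp add: foldr_kact_lact nq [unfolded vs(2)])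
  finally have left: "hecke_mult h (unit_vec v) = unit_vec \<one>" .
  have hv: "hecke_mult (basis_vec (inv w)) g = foldr (lact qinv) vs g" for g
    using hecke_mult_basis_vec [OF v] by (simp add: v_def vs_def)
  have "hecke_bar w = h"
    unfolding hecke_bar_def
  proof (rule the_equality, intro conjI)
    show "\<forall>x. x \<notin> carrier W \<longrightarrow> h x = 0" using h_supp by (simp add: supported_def)
    show "hecke_mult (basis_vec (inv w)) h = basis_vec \<one>"
      by (simp only: hv right unit [of \<one>])
    show "hecke_mult h (basis_vec (inv w)) = basis_vec \<one>"
      using left by (simp add: unit v_def)
    fix g assume g: "(\<forall>x. x \<notin> carrier W \<longrightarrow> g x = 0) \<and>
      hecke_mult (basis_vec (inv w)) g = basis_vec \<one> \<and> hecke_mult g (basis_vec (inv w)) = basis_vec \<one>"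
    then have "foldr (lact qinv) vs g = unit_vec \<one>"
      by (simp only: hv unit [of \<one>])
    then have "foldr (kact qinv) (rev vs) (unit_vec \<one>) = (\<lambda>x. qinv ^ length vs * g x)"
      using foldr_kact_lact [of vs g qinv] g vs by (simp add: supported_def)
    then show "g = h" unfolding h_def kvec_def by (simp add: nq)
  qed
  then show ?thesis by (simp add: h_def vs_def v_def)
qed

section \<open>Specialising the parameter to q^-1 and to 0\<close>

lemma inv_poly_lact: "inv_poly (lact [:0, 1:] s h x) = lact qinv s (\<lambda>x. inv_poly (h x)) x"
proof -
  have "inv_poly (basis_image [:0, 1:] s w x) = basis_image qinv s w x" for w
    by (auto simp: basis_image_def of_bool_def inv_poly_pCons)
  then show ?thesis by (simp add: lact_def)
qed

lemma kvec_Cons: "kvec q (s # ws) x = lact q s (kvec q ws) x - (1 - q) * kvec q ws x"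
  by (simp add: kvec_def kact_def)

lemma inv_poly_kvec: "inv_poly (kvec [:0, 1:] ws x) = kvec qinv ws x"
proof (induction ws arbitrary: x)
  case Nil
  then show ?case by (simp add: kvec_def unit_vec_def)
next
  case (Cons s ws)
  then show ?case by (simp add: kvec_Cons inv_poly_lact)
qed

lemma poly_lact:
  fixes h :: "'a \<Rightarrow> int poly"
  shows "poly (lact [:0, 1:] s h x) 0 = lact 0 s (\<lambda>x. poly (h x) 0) x"
proof -
  have "poly (basis_image [:0, 1:] s w x) (0 :: int) = basis_image 0 s w x" for w
    by (auto simp: basis_image_def of_bool_def)
  then show ?thesis by (simp add: lact_def poly_sum)
qed

lemma poly_kvec: "poly (kvec [:0, 1:] ws x) (0 :: int) = kvec 0 ws x"
proof (induction ws arbitrary: x)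
  case Nil
  then show ?case by (auto simp: kvec_def unit_vec_def)
next
  case (Cons s ws)
  then show ?case by (simp add: kvec_Cons poly_lact)
qed

text \<open>The recursion of \<open>K_gen_mult\<close> again, now on coefficients:
  \<open>lower_gen_mult\<close> says which of \<open>x\<close> and \<open>s \<otimes> x\<close> lie
  below the shorter element.\<close>

lemma kvec_mob:
  "set ws \<subseteq> S \<Longrightarrow> len (word_prod ws) = length ws \<Longrightarrow> kvec 0 ws = mob (word_prod ws)"
proof (induction ws)
  case Nil
  have "bruhat x \<one> \<longleftrightarrow> x = \<one>" for x using bruhat_len_eq [of x \<one>] by auto
  then show ?case by (auto simp: kvec_def unit_vec_def mob_def)
next
  case (Cons s ws)
  let ?w = "word_prod ws"
  have s: "s \<in> S" and w: "?w \<in> carrier W" using Cons.prems by auto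
  note red = reduced_tail [OF Cons.prems]
  have lw: "len (s \<otimes> ?w) = Suc (len ?w)" using len_gen_mult_le [OF s w] red by simp
  have "kact 0 s (mob ?w) x = mob (s \<otimes> ?w) x" for x
  proof (cases "x \<in> carrier W")
    case False
    then have "\<not> bruhat x ?w" "\<not> bruhat x (s \<otimes> ?w)" using bruhat_carrier by auto
    then show ?thesis using s False by (simp add: kact_def lact_outside mob_def)
  next
    case x: True
    note low = lower_gen_mult [OF s w red(2) x]
    show ?thesis
    proof (rule len_gen_cases [OF s x])
      assume "len (s \<otimes> x) = Suc (len x)"
      then show ?thesis using low s x lw by (simp add: kact_def lact_closed_form mob_def dn_def)
    next
      assume "len x = Suc (len (s \<otimes> x))"
      then show ?thesis using low s x lw by (simp add: kact_def lact_closed_form mob_def dn_def)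
    qed
  qed
  then show ?case using Cons red by (auto simp: kvec_def)
qed

text \<open>The R-polynomials of \<open>W\<close>, computed with a formal parameter. The word is the
  reverse of one for \<open>inv w\<close> because \<open>hecke_bar w\<close> inverts
  \<open>A\<close> at \<open>inv w\<close>; its product is \<open>w\<close>, so the value at 0 is
  \<open>mob w\<close>.\<close>

definition kpoly :: "'a \<Rightarrow> 'a \<Rightarrow> int poly" where
  "kpoly w = kvec [:0, 1:] (rev (reduced_word (inv w)))"

lemma hecke_bar_kpoly: "w \<in> carrier W \<Longrightarrow> hecke_bar w x = qpow (int (len w)) * inv_poly (kpoly w x)"
  by (simp add: hecke_bar_kvec kpoly_def inv_poly_kvec)

lemma KL_R_kpoly: "w \<in> carrier W \<Longrightarrow> KL_R x w = kpoly w x"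
  unfolding KL_R_def by (rule the_inv_poly) (rule hecke_bar_kpoly)

lemma poly_kpoly:
  assumes w: "w \<in> carrier W"
  shows "poly (kpoly w x) 0 = mob w x"
proof -
  let ?ws = "rev (reduced_word (inv w))"
  have "word_prod ?ws = w" "set ?ws \<subseteq> S" "length ?ws = len w"
    using reduced_word [of "inv w"] w by (simp_all add: word_prod_rev)
  then show ?thesis using kvec_mob [of ?ws] by (simp add: kpoly_def poly_kvec)
qed

end

section \<open>The orbit of an idempotent\<close>

text \<open>The rules for computing in the orbit. \<open>I\<close> and \<open>J\<close> are the
  types of \<open>W_e\<close> and \<open>W(e)\<close>. The laws \<open>centralizer_move\<close>,
  \<open>stabilizer_absorb\<close> and \<open>orbit_eqD\<close> together express when two products
  \<open>x e y\<close> agree, with the right factors not yet inverted.\<close>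

locale coxeter_orbit = finite_coxeter_group W S + renner_orbit W S R e
  for W :: "'w monoid" (structure) and S R e +
  fixes I J :: "'w set"
  assumes I_sub: "I \<subseteq> S" and J_sub: "J \<subseteq> S"
    and stabilizer_gen: "stabilizer = generate W I"
    and centralizer_gen: "centralizer = generate W J"
    and stabilizer_sub: "stabilizer \<subseteq> centralizer"
    and stabilizer_normal: "\<lbrakk>c \<in> centralizer; m \<in> stabilizer\<rbrakk> \<Longrightarrow> inv c \<otimes> m \<otimes> c \<in> stabilizer"
    and left_mult: "\<lbrakk>x \<in> carrier W; y \<in> carrier W; z \<in> carrier W\<rbrakk> \<Longrightarrow>
      x \<otimes>\<^bsub>R\<^esub> (y \<otimes>\<^bsub>R\<^esub> e \<otimes>\<^bsub>R\<^esub> z) = (x \<otimes> y) \<otimes>\<^bsub>R\<^esub> e \<otimes>\<^bsub>R\<^esub> z"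
    and centralizer_move: "\<lbrakk>c \<in> centralizer; x \<in> carrier W; y \<in> carrier W\<rbrakk> \<Longrightarrow>
      (x \<otimes> c) \<otimes>\<^bsub>R\<^esub> e \<otimes>\<^bsub>R\<^esub> y = x \<otimes>\<^bsub>R\<^esub> e \<otimes>\<^bsub>R\<^esub> (c \<otimes> y)"
    and stabilizer_absorb: "\<lbrakk>m \<in> stabilizer; x \<in> carrier W; y \<in> carrier W\<rbrakk> \<Longrightarrow>
      (x \<otimes> m) \<otimes>\<^bsub>R\<^esub> e \<otimes>\<^bsub>R\<^esub> y = x \<otimes>\<^bsub>R\<^esub> e \<otimes>\<^bsub>R\<^esub> y"
    and orbit_eqD: "\<lbrakk>x \<in> carrier W; y \<in> carrier W; x' \<in> carrier W; y' \<in> carrier W;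
      x \<otimes>\<^bsub>R\<^esub> e \<otimes>\<^bsub>R\<^esub> y = x' \<otimes>\<^bsub>R\<^esub> e \<otimes>\<^bsub>R\<^esub> y'\<rbrakk> \<Longrightarrow>
      y' \<otimes> inv y \<in> centralizer \<and> (inv x' \<otimes> x) \<otimes> (y \<otimes> inv y') \<in> stabilizer"
begin

abbreviation D\<^sub>e :: "'w set" where "D\<^sub>e \<equiv> min_coset_reps stabilizer"
abbreviation D :: "'w set" where "D \<equiv> min_coset_reps centralizer"

definition orb :: "'w \<Rightarrow> 'w \<Rightarrow> 'w" where
  "orb x y = x \<otimes>\<^bsub>R\<^esub> e \<otimes>\<^bsub>R\<^esub> inv y"

lemma De_closed: "x \<in> D\<^sub>e \<Longrightarrow> x \<in> carrier W"
  and D_closed: "x \<in> D \<Longrightarrow> x \<in> carrier W"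
  by (rule min_coset_reps_closed, assumption)+

lemma stabilizer_closed: "x \<in> stabilizer \<Longrightarrow> x \<in> carrier W"
  and centralizer_closed: "x \<in> centralizer \<Longrightarrow> x \<in> carrier W"
  by (simp_all add: stabilizer_def centralizer_def)

lemma finite_centralizer: "finite centralizer" and finite_D: "finite D"
  by (rule finite_subset [OF _ W_finite], use centralizer_closed D_closed in blast)+

lemma orb_orbit: "x \<in> carrier W \<Longrightarrow> y \<in> carrier W \<Longrightarrow> orb x y \<in> orbit"
  unfolding orbit_def orb_def by blast

lemma orb_centralizer:
  "x \<in> carrier W \<Longrightarrow> y \<in> carrier W \<Longrightarrow> c \<in> centralizer \<Longrightarrow> orb (x \<otimes> c) (y \<otimes> c) = orb x y"
  using centralizer_move [of c x "inv (y \<otimes> c)"] centralizer_closed [of c]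
  by (simp add: orb_def inv_mult_group conj_cancel)

lemma orb_stabilizer:
  "x \<in> carrier W \<Longrightarrow> y \<in> carrier W \<Longrightarrow> m \<in> stabilizer \<Longrightarrow> orb (x \<otimes> m) y = orb x y"
  using stabilizer_absorb [of m x "inv y"] by (simp add: orb_def)

lemma gen_orb: "s \<in> carrier W \<Longrightarrow> x \<in> carrier W \<Longrightarrow> y \<in> carrier W \<Longrightarrow> s \<otimes>\<^bsub>R\<^esub> orb x y = orb (s \<otimes> x) y"
  using left_mult [of s x "inv y"] by (simp add: orb_def)

lemma finite_orbit: "finite orbit"
proof -
  have "orbit = (\<lambda>(x, y). x \<otimes>\<^bsub>R\<^esub> e \<otimes>\<^bsub>R\<^esub> y) ` (carrier W \<times> carrier W)"
    by (auto simp: orbit_def)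
  then show ?thesis using W_finite by simp
qed

lemma orb_eqD:
  assumes "x \<in> D\<^sub>e" "x' \<in> D\<^sub>e" "y \<in> D" "y' \<in> D" "orb x y = orb x' y'"
  shows "x = x' \<and> y = y'"
proof -
  have cl: "x \<in> carrier W" "x' \<in> carrier W" "y \<in> carrier W" "y' \<in> carrier W"
    using assms De_closed D_closed by auto
  have *: "inv y' \<otimes> y \<in> centralizer" "(inv x' \<otimes> x) \<otimes> (inv y \<otimes> y') \<in> stabilizer"
    using orbit_eqD [of x "inv y" x' "inv y'"] assms(5) cl by (auto simp: orb_def)
  have "y' \<otimes> (inv y' \<otimes> y) = y \<otimes> \<one>" using cl by (simp add: conj_cancel)
  then have y: "y = y'"
    using coset_rep_unique [OF J_sub, of y' y "inv y' \<otimes> y" \<one>] assms *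
    by (simp add: centralizer_gen generate.one)
  then have "inv x' \<otimes> x \<in> stabilizer" using * cl by simp
  moreover have "x' \<otimes> (inv x' \<otimes> x) = x \<otimes> \<one>" using cl by (simp add: conj_cancel)
  ultimately have "x = x'"
    using coset_rep_unique [OF I_sub, of x' x "inv x' \<otimes> x" \<one>] assms
    by (simp add: stabilizer_gen generate.one)
  then show ?thesis using y by simp
qed

lemma standard_form_orb:
  assumes "x \<in> D\<^sub>e" "y \<in> D"
  shows "standard_form (orb x y) = (x, y)"
  unfolding standard_form_def
  by (rule the_equality) (use assms orb_eqD in \<open>auto simp: orb_def\<close>)

lemma De_decomposition:
  assumes "c \<in> carrier W"
  obtains d m where "d \<in> D\<^sub>e" "m \<in> stabilizer" "c = d \<otimes> m" "dem d m = c" "bruhat d c"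
proof -
  obtain d m where dm: "d \<in> D\<^sub>e" "m \<in> stabilizer" "c = d \<otimes> m"
    using coset_decomposition [OF I_sub assms] unfolding stabilizer_gen by blast
  moreover have "dem d m = c"
    using dem_min_coset_rep [OF I_sub] dm unfolding stabilizer_gen by simp
  moreover have "bruhat d c"
    using le_dem_left [OF De_closed [OF dm(1)] stabilizer_closed [OF dm(2)]] calculation by simp
  ultimately show thesis using that by blast
qed

lemma orbit_cases:
  assumes "\<sigma> \<in> orbit"
  obtains x y where "x \<in> D\<^sub>e" "y \<in> D" "\<sigma> = orb x y"
proof -
  obtain a b where ab: "a \<in> carrier W" "b \<in> carrier W" "\<sigma> = orb a (inv b)"
    using assms unfolding orbit_def orb_def by force
  obtain y c where yc: "y \<in> D" "c \<in> centralizer" "inv b = y \<otimes> c"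
    using coset_decomposition [OF J_sub inv_closed [OF ab(2)]] unfolding centralizer_gen by blast
  have cl: "y \<in> carrier W" "c \<in> carrier W" using yc D_closed centralizer_closed by auto
  have "\<sigma> = orb (a \<otimes> inv c \<otimes> c) (y \<otimes> c)" using ab yc cl by (simp add: m_assoc)
  then have s: "\<sigma> = orb (a \<otimes> inv c) y" using ab yc cl by (simp only: orb_centralizer m_closed inv_closed)
  have "a \<otimes> inv c \<in> carrier W" using ab cl by simp
  then obtain x m where xm: "x \<in> D\<^sub>e" "m \<in> stabilizer" "a \<otimes> inv c = x \<otimes> m"
    "dem x m = a \<otimes> inv c" "bruhat x (a \<otimes> inv c)"
    by (rule De_decomposition)
  then have "\<sigma> = orb x y" using s cl De_closed by (simp add: orb_stabilizer)
  then show thesis using that xm yc by blast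
qed

lemma orbit_length_orb:
  assumes "x \<in> D\<^sub>e" "y \<in> D"
  shows "orbit_length (orb x y) = int (len x) + idem_length - int (len y)"
  by (simp add: orbit_length_def standard_form_orb [OF assms])


subsection \<open>The order on the orbit\<close>

lemma centralizer_dem: "c \<in> centralizer \<Longrightarrow> d \<in> centralizer \<Longrightarrow> dem c d \<in> centralizer"
  using dem_parabolic [OF J_sub] by (simp add: centralizer_gen)

lemma dem_D: "y \<in> D \<Longrightarrow> w \<in> centralizer \<Longrightarrow> dem y w = y \<otimes> w"
  using dem_min_coset_rep [OF J_sub] by (simp add: centralizer_gen)

lemma D_mono: "y \<in> D \<Longrightarrow> bruhat w' w \<Longrightarrow> w \<in> centralizer \<Longrightarrow> bruhat (y \<otimes> w') (y \<otimes> w)"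
  using min_coset_rep_mono [OF J_sub] by (simp add: centralizer_gen)

lemma centralizer_lower: "bruhat w' w \<Longrightarrow> w \<in> centralizer \<Longrightarrow> w' \<in> centralizer"
  using parabolic_lower [OF J_sub] by (simp add: centralizer_gen)

text \<open>The Demazure product \<open>dem x w\<close> lies above \<open>x \<otimes> w\<close>, and
  conversely equals \<open>x \<otimes> w'\<close> for some \<open>w'\<close> below \<open>w\<close>.
  Since \<open>y\<close> is minimal, \<open>y \<otimes> w'\<close> stays below
  \<open>y \<otimes> w\<close>, so \<open>w'\<close> is a witness for the ordinary product.\<close>

lemma bruhat_chevalley_De:
  assumes "u \<in> D\<^sub>e" "v \<in> D" "x \<in> D\<^sub>e" "y \<in> D"
  shows "bruhat_chevalley (orb u v) (orb x y) \<longleftrightarrow>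
    (\<exists>w\<in>centralizer. bruhat u (dem x w) \<and> bruhat (y \<otimes> w) v)"
proof -
  have cl: "u \<in> carrier W" "v \<in> carrier W" "x \<in> carrier W" "y \<in> carrier W"
    using assms De_closed D_closed by auto
  have "bruhat_chevalley (orb u v) (orb x y) \<longleftrightarrow>
      (\<exists>w\<in>centralizer. bruhat u (x \<otimes> w) \<and> bruhat (y \<otimes> w) v)"
    using cl by (simp add: bruhat_chevalley_def standard_form_orb assms orb_orbit)
  also have "\<dots> \<longleftrightarrow> (\<exists>w\<in>centralizer. bruhat u (dem x w) \<and> bruhat (y \<otimes> w) v)"
  proof
    assume "\<exists>w\<in>centralizer. bruhat u (x \<otimes> w) \<and> bruhat (y \<otimes> w) v"
    then show "\<exists>w\<in>centralizer. bruhat u (dem x w) \<and> bruhat (y \<otimes> w) v"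
      using bruhat_trans mult_le_dem cl centralizer_closed by meson
  next
    assume "\<exists>w\<in>centralizer. bruhat u (dem x w) \<and> bruhat (y \<otimes> w) v"
    then obtain w where w: "w \<in> centralizer" "bruhat u (dem x w)" "bruhat (y \<otimes> w) v" by blast
    obtain w' where w': "bruhat w' w" "dem x w = x \<otimes> w'"
      using dem_factor cl centralizer_closed [OF w(1)] by blast
    then show "\<exists>w\<in>centralizer. bruhat u (x \<otimes> w) \<and> bruhat (y \<otimes> w) v"
      using w D_mono [OF assms(4) w'(1) w(1)] bruhat_trans centralizer_lower by metis
  qed
  finally show ?thesis .
qed

text \<open>The formula for the constant terms contains elements whose left factor \<open>c\<close>
  need not lie in \<open>D\<^sub>e\<close>. With \<open>c = d \<otimes> m\<close> and
  \<open>w = w' \<otimes> m'\<close>, normality moves the factors from \<open>W_e\<close> to the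
  right of \<open>w'\<close>, where minimality of \<open>u\<close> allows them to be
  dropped.\<close>

lemma bruhat_chevalley_orb:
  assumes u: "u \<in> D\<^sub>e" and v: "v \<in> D" and c: "c \<in> carrier W" and y: "y \<in> D"
  shows "bruhat_chevalley (orb u v) (orb c y) \<longleftrightarrow>
    (\<exists>w\<in>centralizer. bruhat u (dem c w) \<and> bruhat (y \<otimes> w) v)"
proof -
  obtain d m where dm: "d \<in> D\<^sub>e" "m \<in> stabilizer" "c = d \<otimes> m" "dem d m = c" "bruhat d c"
    by (rule De_decomposition [OF c])
  have cl: "d \<in> carrier W" "m \<in> carrier W" "u \<in> carrier W"
    using dm u De_closed stabilizer_closed by auto
  have "bruhat_chevalley (orb u v) (orb c y) \<longleftrightarrow>
      (\<exists>w\<in>centralizer. bruhat u (dem d w) \<and> bruhat (y \<otimes> w) v)"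
    using bruhat_chevalley_De [OF u v dm(1) y] dm cl D_closed [OF y] by (simp add: orb_stabilizer)
  also have "\<dots> \<longleftrightarrow> (\<exists>w\<in>centralizer. bruhat u (dem c w) \<and> bruhat (y \<otimes> w) v)"
  proof
    assume "\<exists>w\<in>centralizer. bruhat u (dem d w) \<and> bruhat (y \<otimes> w) v"
    then show "\<exists>w\<in>centralizer. bruhat u (dem c w) \<and> bruhat (y \<otimes> w) v"
      using dem_mono_left [OF _ dm(5)] bruhat_trans centralizer_closed by meson
  next
    assume "\<exists>w\<in>centralizer. bruhat u (dem c w) \<and> bruhat (y \<otimes> w) v"
    then obtain w where w: "w \<in> centralizer" "bruhat u (dem c w)" "bruhat (y \<otimes> w) v" by blast
    have wc: "w \<in> carrier W" by (rule centralizer_closed [OF w(1)])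
    obtain w' m' where w': "w' \<in> D\<^sub>e" "m' \<in> stabilizer" "w = w' \<otimes> m'" "dem w' m' = w" "bruhat w' w"
      by (rule De_decomposition [OF wc])
    have w'c: "w' \<in> carrier W" "m' \<in> carrier W" using w' De_closed stabilizer_closed by auto
    have w'C: "w' \<in> centralizer" using centralizer_lower w'(5) w(1) by blast
    obtain m2 where m2: "bruhat m2 m" "dem m w = m2 \<otimes> w"
      using dem_factor_left [OF cl(2) wc] by blast
    have m2s: "m2 \<in> stabilizer"
      using parabolic_lower [OF I_sub m2(1)] dm by (simp add: stabilizer_gen)
    have m2c: "m2 \<in> carrier W" by (rule stabilizer_closed [OF m2s])
    \<comment> \<open>Chosen so that \<open>m2 \<otimes> w = w' \<otimes> m3\<close>; membership of
      \<open>m3\<close> in \<open>W_e\<close> is the use of normality.\<close>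
    define m3 where "m3 = inv w' \<otimes> m2 \<otimes> w' \<otimes> m'"
    have m3: "m3 \<in> stabilizer"
      using stabilizer_normal [OF w'C m2s] w'(2) unfolding m3_def stabilizer_gen
      by (rule parabolic_mult)
    have "dem m w = w' \<otimes> m3"
      using m2(2) w'(3) w'c m2c by (simp add: m3_def m_assoc conj_cancel)
    also have "\<dots> = dem w' m3"
      using dem_min_coset_rep [OF I_sub] w'(1) m3 by (simp add: stabilizer_gen)
    finally have "dem c w = dem (dem d w') m3"
      using dm cl wc w'c stabilizer_closed [OF m3] dem_assoc by metis
    then have "bruhat u (dem d w')"
      using le_dem_parabolic [OF I_sub, of u m3 "dem d w'"] u m3 w(2) cl w'c
      by (simp add: stabilizer_gen)
    moreover have "bruhat (y \<otimes> w') v" using D_mono [OF y w'(5) w(1)] w(3) bruhat_trans by blast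
    ultimately show "\<exists>w\<in>centralizer. bruhat u (dem d w) \<and> bruhat (y \<otimes> w) v" using w'C by blast
  qed
  finally show ?thesis .
qed

lemma bruhat_chevalley_orbit: "bruhat_chevalley \<theta> \<sigma> \<Longrightarrow> \<theta> \<in> orbit \<and> \<sigma> \<in> orbit"
  by (simp add: bruhat_chevalley_def)

lemma bruhat_chevalley_refl:
  assumes "\<sigma> \<in> orbit"
  shows "bruhat_chevalley \<sigma> \<sigma>"
proof -
  obtain x y where xy: "x \<in> D\<^sub>e" "y \<in> D" "\<sigma> = orb x y" by (rule orbit_cases [OF assms])
  have "\<one> \<in> centralizer" by (simp add: centralizer_gen generate.one)
  then show ?thesis
    using xy De_closed [OF xy(1)] D_closed [OF xy(2)]
    by (auto simp: bruhat_chevalley_De intro!: bexI [of _ \<one>])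
qed

text \<open>In its Demazure form each of the two comparisons is monotone and associative, so the
  witnesses combine to \<open>dem w' w\<close>.\<close>

lemma bruhat_chevalley_trans:
  assumes "bruhat_chevalley \<eta> \<tau>" "bruhat_chevalley \<tau> \<sigma>"
  shows "bruhat_chevalley \<eta> \<sigma>"
proof -
  obtain u v where uv: "u \<in> D\<^sub>e" "v \<in> D" "\<eta> = orb u v"
    using orbit_cases assms bruhat_chevalley_orbit by metis
  obtain a b where ab: "a \<in> D\<^sub>e" "b \<in> D" "\<tau> = orb a b"
    using orbit_cases assms bruhat_chevalley_orbit by metis
  obtain x y where xy: "x \<in> D\<^sub>e" "y \<in> D" "\<sigma> = orb x y"
    using orbit_cases assms bruhat_chevalley_orbit by metis
  obtain w where w: "w \<in> centralizer" "bruhat u (dem a w)" "bruhat (b \<otimes> w) v"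
    using assms(1) uv ab bruhat_chevalley_De by auto
  obtain w' where w': "w' \<in> centralizer" "bruhat a (dem x w')" "bruhat (y \<otimes> w') b"
    using assms(2) ab xy bruhat_chevalley_De by auto
  have cl: "w \<in> carrier W" "w' \<in> carrier W" "x \<in> carrier W" "y \<in> carrier W"
    using w w' xy centralizer_closed De_closed D_closed by auto
  have c: "dem w' w \<in> centralizer" by (rule centralizer_dem [OF w'(1) w(1)])
  have "bruhat (dem a w) (dem (dem x w') w)" by (rule dem_mono_left [OF cl(1) w'(2)])
  then have "bruhat u (dem x (dem w' w))" using bruhat_trans w(2) dem_assoc cl by metis
  moreover have "bruhat (y \<otimes> dem w' w) v"
  proof -
    have "y \<otimes> dem w' w = dem (y \<otimes> w') w"
      using dem_D [OF xy(2) c] dem_D [OF xy(2) w'(1)] dem_assoc cl by metis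
    moreover have "bruhat (dem (y \<otimes> w') w) (dem b w)" by (rule dem_mono_left [OF cl(1) w'(3)])
    ultimately show ?thesis using dem_D [OF ab(2) w(1)] w(3) bruhat_trans by metis
  qed
  ultimately show ?thesis using c uv xy bruhat_chevalley_De by auto
qed


subsection \<open>The constant terms of the \<open>R\<close>-polynomials\<close>

definition orbit_basis_image :: "'r::comm_ring_1 \<Rightarrow> 'w \<Rightarrow> 'w \<Rightarrow> 'w \<Rightarrow> 'r" where
  "orbit_basis_image q s \<sigma> \<tau> = (if orbit_length (s \<otimes>\<^bsub>R\<^esub> \<sigma>) = orbit_length \<sigma> then of_bool (\<tau> = \<sigma>)
     else if orbit_length (s \<otimes>\<^bsub>R\<^esub> \<sigma>) = orbit_length \<sigma> + 1 then of_bool (\<tau> = s \<otimes>\<^bsub>R\<^esub> \<sigma>)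
     else q * of_bool (\<tau> = s \<otimes>\<^bsub>R\<^esub> \<sigma>) + (1 - q) * of_bool (\<tau> = \<sigma>))"

definition oact :: "'r::comm_ring_1 \<Rightarrow> 'w \<Rightarrow> ('w \<Rightarrow> 'r) \<Rightarrow> 'w \<Rightarrow> 'r" where
  "oact q s h = (\<lambda>\<tau>. \<Sum>\<sigma>\<in>orbit. h \<sigma> * orbit_basis_image q s \<sigma> \<tau>)"

lemma orbit_gen_act_oact: "orbit_gen_act = oact qinv"
proof -
  have "orbit_gen_times_basis s \<sigma> \<tau> = orbit_basis_image qinv s \<sigma> \<tau>" for s \<sigma> \<tau>
    by (simp add: orbit_gen_times_basis_def orbit_basis_image_def basis_vec_of_bool)
  then show ?thesis by (simp add: orbit_gen_act_def oact_def fun_eq_iff)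
qed

lemma inv_poly_oact: "inv_poly (oact [:0, 1:] s h \<tau>) = oact qinv s (\<lambda>x. inv_poly (h x)) \<tau>"
proof -
  have "inv_poly (orbit_basis_image [:0, 1:] s \<sigma> \<tau>) = orbit_basis_image qinv s \<sigma> \<tau>" for \<sigma>
    by (auto simp: orbit_basis_image_def of_bool_def inv_poly_pCons)
  then show ?thesis by (simp add: oact_def)
qed

lemma poly_oact:
  fixes h :: "'w \<Rightarrow> int poly"
  shows "poly (oact [:0, 1:] s h \<tau>) 0 = oact 0 s (\<lambda>x. poly (h x) 0) \<tau>"
proof -
  have "poly (orbit_basis_image [:0, 1:] s \<sigma> \<tau>) (0 :: int) = orbit_basis_image 0 s \<sigma> \<tau>" for \<sigma>
    by (auto simp: orbit_basis_image_def of_bool_def)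
  then show ?thesis by (simp add: oact_def poly_sum)
qed

lemma inv_poly_oact_word:
  "inv_poly (foldr (oact [:0, 1:]) ws h \<tau>) = foldr (oact qinv) ws (\<lambda>x. inv_poly (h x)) \<tau>"
  by (induction ws arbitrary: \<tau>) (simp_all add: inv_poly_oact)

lemma poly_oact_word:
  fixes h :: "'w \<Rightarrow> int poly"
  shows "poly (foldr (oact [:0, 1:]) ws h \<tau>) 0 = foldr (oact 0) ws (\<lambda>x. poly (h x) 0) \<tau>"
  by (induction ws arbitrary: \<tau>) (simp_all add: poly_oact)

lemma oact_cmult: "oact q s (\<lambda>x. c * h x) = (\<lambda>x. c * oact q s h x)"
  by (simp add: oact_def sum_distrib_left mult.assoc)

lemma oact_sum: "oact q s (\<lambda>x. \<Sum>i\<in>A. f i x) = (\<lambda>x. \<Sum>i\<in>A. oact q s (f i) x)"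
proof -
  have "oact q s (\<lambda>x. 0) = (\<lambda>x. 0)" by (simp add: oact_def)
  moreover have "oact q s (\<lambda>x. f x + h x) = (\<lambda>x. oact q s f x + oact q s h x)" for f h
    by (simp add: oact_def distrib_right sum.distrib)
  ultimately show ?thesis by (induction A rule: infinite_finite_induct) simp_all
qed

lemma oact_word_cmult: "foldr (oact q) ws (\<lambda>x. c * h x) = (\<lambda>x. c * foldr (oact q) ws h x)"
  by (induction ws) (simp_all add: oact_cmult)

lemma oact_word_sum:
  "foldr (oact q) ws (\<lambda>x. \<Sum>i\<in>A. f i x) = (\<lambda>x. \<Sum>i\<in>A. foldr (oact q) ws (f i) x)"
  by (induction ws) (simp_all add: oact_sum)

text \<open>At parameter 0 a generator acts by \<open>up s\<close> on any left factor
  \<open>c\<close>, minimal or not. Let \<open>c = d \<otimes> m\<close> with \<open>d\<close> in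
  \<open>D\<^sub>e\<close> and \<open>m\<close> in \<open>W_e\<close>. If
  \<open>s \<otimes> d\<close> is in \<open>D\<^sub>e\<close>, then \<open>s\<close> changes the
  lengths of the orbit element, of \<open>d\<close> and of \<open>c\<close> in the same way.
  Otherwise Deodhar's lemma gives \<open>s \<otimes> d = d \<otimes> r\<close> with \<open>r\<close>
  in \<open>W_e\<close>, and \<open>s\<close> fixes the orbit element, which \<open>c\<close> and
  \<open>s \<otimes> c\<close> both represent.\<close>

lemma oact_zero_orb:
  assumes s: "s \<in> S" and c: "c \<in> carrier W" and y: "y \<in> D"
  shows "oact 0 s (\<lambda>\<tau>. of_bool (\<tau> = orb c y)) = (\<lambda>\<tau>. of_bool (\<tau> = orb (up s c) y) :: int)"
proof
  fix \<tau>
  have yc: "y \<in> carrier W" by (rule D_closed [OF y])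
  obtain d m where dm: "d \<in> D\<^sub>e" "m \<in> stabilizer" "c = d \<otimes> m" "dem d m = c" "bruhat d c"
    by (rule De_decomposition [OF c])
  have cl: "d \<in> carrier W" "m \<in> carrier W" using dm De_closed stabilizer_closed by auto
  have lc: "len c = len d + len m"
    using min_coset_rep_len [OF I_sub] dm by (simp add: stabilizer_gen)
  have cd: "orb c y = orb d y" using dm cl yc by (simp add: orb_stabilizer)
  have sc: "s \<otimes> c = s \<otimes> d \<otimes> m" using dm cl s by (simp add: m_assoc)
  have scd: "orb (s \<otimes> c) y = orb (s \<otimes> d) y" unfolding sc using orb_stabilizer [of "s \<otimes> d" y m] dm cl yc s by simp
  have "oact 0 s (\<lambda>\<tau>. of_bool (\<tau> = orb c y)) \<tau> = (orbit_basis_image 0 s (orb c y) \<tau> :: int)"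
    using finite_orbit orb_orbit [OF c yc]
    by (simp add: oact_def of_bool_def if_distrib [of "\<lambda>x. x * _"] cong: if_cong)
  also have "\<dots> = of_bool (\<tau> = orb (up s c) y)"
  proof (cases "s \<otimes> d \<in> D\<^sub>e")
    case True
    have lsc: "len (s \<otimes> c) = len (s \<otimes> d) + len m"
      unfolding sc using min_coset_rep_len [OF I_sub, of "s \<otimes> d" m] dm(2) True
      by (simp add: stabilizer_gen)
    have o: "orbit_length (orb c y) = int (len d) + idem_length - int (len y)"
      "orbit_length (orb (s \<otimes> c) y) = int (len (s \<otimes> d)) + idem_length - int (len y)"
      using orbit_length_orb [OF dm(1) y] orbit_length_orb [OF True y] by (simp_all only: cd scd)
    have "s \<otimes>\<^bsub>R\<^esub> orb c y = orb (s \<otimes> c) y" using gen_orb s c yc by simp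
    moreover have "len (s \<otimes> d) = Suc (len d) \<or> len d = Suc (len (s \<otimes> d))"
      by (rule len_gen_cases [OF s cl(1)]) auto
    ultimately show ?thesis by (auto simp: orbit_basis_image_def up_def o lc lsc)
  next
    case False
    then obtain r where r: "r \<in> I" "s \<otimes> d = d \<otimes> r"
      using deodhar(2) [OF I_sub _ s, of d] dm by (auto simp: stabilizer_gen)
    then have "r \<in> stabilizer" by (simp add: stabilizer_gen generate.incl)
    then have "orb (s \<otimes> d) y = orb d y" using r cl yc by (simp add: orb_stabilizer)
    then show ?thesis
      using s cl yc by (auto simp: orbit_basis_image_def cd gen_orb up_def scd)
  qed
  finally show "oact 0 s (\<lambda>\<tau>. of_bool (\<tau> = orb c y)) \<tau> = (of_bool (\<tau> = orb (up s c) y) :: int)" .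
qed

lemma oact_word_orb:
  "set ws \<subseteq> S \<Longrightarrow> c \<in> carrier W \<Longrightarrow> y \<in> D \<Longrightarrow>
    foldr (oact 0) ws (\<lambda>\<tau>. of_bool (\<tau> = orb c y)) = (\<lambda>\<tau>. of_bool (\<tau> = orb (up_word ws c) y) :: int)"
  by (induction ws) (simp_all add: oact_zero_orb)

text \<open>The bar involution of the orbit module at constant terms: the bar of
  \<open>A\<^sub>x\<close> contributes \<open>mob x a\<close>, the R-polynomials of \<open>W\<close>
  contribute \<open>mob y (t \<otimes> z)\<close>, and \<open>A\<^sub>a\<close> acts on the left
  factor \<open>z\<close> by the Demazure product. The powers of \<open>q\<close> match because
  \<open>orbit_length - idem_length\<close> at \<open>orb x t\<close> is
  \<open>len x - len t\<close>.\<close>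

lemma poly_R_poly:
  assumes x: "x \<in> D\<^sub>e" and t: "t \<in> D"
  shows "poly (R_poly \<theta> (orb x t)) 0 =
    (\<Sum>a\<in>carrier W. \<Sum>z\<in>centralizer. \<Sum>y\<in>D. mob x a * (mob y (t \<otimes> z) * of_bool (\<theta> = orb (dem a z) y)))"
proof -
  have xc: "x \<in> carrier W" by (rule De_closed [OF x])
  define G where "G \<tau> = (\<Sum>z\<in>centralizer. \<Sum>y\<in>D. kpoly y (t \<otimes> z) * of_bool (\<tau> = orb z y))" for \<tau>
  define P where "P = (\<Sum>a\<in>carrier W. kpoly x a * foldr (oact [:0, 1:]) (reduced_word a) G \<theta>)"
  have G: "(\<lambda>\<tau>. \<Sum>z\<in>centralizer. \<Sum>y\<in>D. laurent_bar (laurent_of_poly (KL_R (t \<otimes> z) y)) *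
      basis_vec (z \<otimes>\<^bsub>R\<^esub> e \<otimes>\<^bsub>R\<^esub> inv y) \<tau>) = (\<lambda>\<tau>. inv_poly (G \<tau>))"
    using D_closed by (simp add: G_def KL_R_kpoly inv_poly_def [symmetric] basis_vec_of_bool orb_def)
  have "orbit_bar (orb x t) \<theta> = qpow (- int (len t)) * (\<Sum>a\<in>carrier W.
      qpow (int (len x)) * inv_poly (kpoly x a) * inv_poly (foldr (oact [:0, 1:]) (reduced_word a) G \<theta>))"
    unfolding orbit_bar_def standard_form_orb [OF x t] prod.case G hecke_act_def orbit_gen_act_oact
    by (simp add: hecke_bar_kpoly [OF xc] inv_poly_oact_word)
  also have "\<dots> = qpow (- int (len t)) * (qpow (int (len x)) * inv_poly P)"
    by (simp add: P_def sum_distrib_left mult.assoc)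
  also have "\<dots> = qpow (orbit_length (orb x t) - idem_length) * inv_poly P"
    by (simp add: orbit_length_orb [OF x t] mult.assoc [symmetric] qpow_mult)
  finally have "R_poly \<theta> (orb x t) = P" unfolding R_poly_def by (rule the_inv_poly)
  then have "poly (R_poly \<theta> (orb x t)) 0 =
      (\<Sum>a\<in>carrier W. mob x a * foldr (oact 0) (reduced_word a) (\<lambda>\<tau>. poly (G \<tau>) 0) \<theta>)"
    by (simp add: P_def poly_sum poly_kpoly [OF xc] poly_oact_word)
  also have "(\<lambda>\<tau>. poly (G \<tau>) 0) =
      (\<lambda>\<tau>. \<Sum>z\<in>centralizer. \<Sum>y\<in>D. mob y (t \<otimes> z) * of_bool (\<tau> = orb z y))"
  proof -
    have "poly (of_bool b) (0 :: int) = of_bool b" for b by (simp add: of_bool_def)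
    then show ?thesis using D_closed by (simp add: G_def poly_sum poly_kpoly)
  qed
  also have "(\<Sum>a\<in>carrier W. mob x a * foldr (oact 0) (reduced_word a) \<dots> \<theta>) =
      (\<Sum>a\<in>carrier W. mob x a * (\<Sum>z\<in>centralizer. \<Sum>y\<in>D. mob y (t \<otimes> z) * of_bool (\<theta> = orb (dem a z) y)))"
    using reduced_word centralizer_closed
    by (intro sum.cong) (simp_all add: oact_word_sum oact_word_cmult oact_word_orb dem_def)
  finally show ?thesis by (simp add: sum_distrib_left)
qed

text \<open>A nonzero term of the formula has \<open>a\<close> below \<open>x\<close> and
  \<open>t \<otimes> z\<close> below \<open>y\<close>, so its \<open>z\<close> is a witness for the
  order. This confines the sums over filters to the interval below the upper element.\<close>

lemma R_poly_support:
  assumes x: "x \<in> D\<^sub>e" and t: "t \<in> D" and nz: "poly (R_poly \<theta> (orb x t)) 0 \<noteq> 0"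
  shows "bruhat_chevalley \<theta> (orb x t)"
proof -
  have "\<exists>a\<in>carrier W. \<exists>z\<in>centralizer. \<exists>y\<in>D. mob x a * (mob y (t \<otimes> z) * of_bool (\<theta> = orb (dem a z) y)) \<noteq> 0"
  proof (rule ccontr)
    assume "\<not> ?thesis"
    then have "poly (R_poly \<theta> (orb x t)) 0 = 0"
      unfolding poly_R_poly [OF x t] by (intro sum.neutral ballI) blast
    then show False using nz by contradiction
  qed
  then obtain a z y where azy: "a \<in> carrier W" "z \<in> centralizer" "y \<in> D" "bruhat a x"
    "bruhat (t \<otimes> z) y" "\<theta> = orb (dem a z) y"
    by (auto simp: mob_def split: if_splits)
  have cl: "x \<in> carrier W" "z \<in> carrier W" "y \<in> carrier W"
    using x azy De_closed D_closed centralizer_closed by auto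
  have "dem a z \<in> carrier W" using azy cl by simp
  then obtain d m where dm: "d \<in> D\<^sub>e" "m \<in> stabilizer" "dem a z = d \<otimes> m" "dem d m = dem a z"
    "bruhat d (dem a z)"
    by (rule De_decomposition)
  have "\<theta> = orb d y" using azy dm cl De_closed by (simp add: orb_stabilizer)
  moreover have "bruhat d (dem x z)"
    using dem_mono_left [OF cl(2) azy(4)] dm(5) bruhat_trans by blast
  ultimately show ?thesis using azy dm x t bruhat_chevalley_De by auto
qed

text \<open>Summation over the filter above \<open>\<eta>\<close> turns a term into the statement
  that some \<open>w\<close> in \<open>W(e)\<close> witnesses the order relation.
  \<open>K_lower_set\<close> rewrites this as a sum of values of \<open>K w\<close>,
  \<open>parabolic_inversion\<close> then collapses the sums over \<open>y\<close> and
  \<open>z\<close> to \<open>t = v\<close>, and \<open>verma\<close> collapses the sum over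
  \<open>a\<close> to \<open>u = x\<close>.\<close>

lemma R_poly_inversion:
  assumes \<eta>: "\<eta> \<in> orbit" and \<sigma>: "\<sigma> \<in> orbit"
  shows "(\<Sum>\<tau>\<in>{\<tau> \<in> orbit. bruhat_chevalley \<eta> \<tau>}. poly (R_poly \<tau> \<sigma>) 0) = of_bool (\<eta> = \<sigma>)"
proof -
  obtain u v where uv: "u \<in> D\<^sub>e" "v \<in> D" "\<eta> = orb u v" by (rule orbit_cases [OF \<eta>])
  obtain x t where xt: "x \<in> D\<^sub>e" "t \<in> D" "\<sigma> = orb x t" by (rule orbit_cases [OF \<sigma>])
  have cl: "u \<in> carrier W" "v \<in> carrier W" "x \<in> carrier W" "t \<in> carrier W"
    using uv xt De_closed D_closed by auto
  define I where "I y = {w \<in> centralizer. bruhat (y \<otimes> w) v}" for y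
  define T where "T = {\<tau> \<in> orbit. bruhat_chevalley \<eta> \<tau>}"
  have fin: "finite T" using finite_orbit by (simp add: T_def)
  have "(\<Sum>\<tau>\<in>T. poly (R_poly \<tau> \<sigma>) 0) =
      (\<Sum>\<tau>\<in>T. \<Sum>a\<in>carrier W. \<Sum>z\<in>centralizer. \<Sum>y\<in>D. mob x a * (mob y (t \<otimes> z) * of_bool (\<tau> = orb (dem a z) y)))"
    by (simp add: poly_R_poly [OF xt(1,2)] xt(3))
  also have "\<dots> = (\<Sum>a\<in>carrier W. \<Sum>\<tau>\<in>T. \<Sum>z\<in>centralizer. \<Sum>y\<in>D. mob x a * (mob y (t \<otimes> z) * of_bool (\<tau> = orb (dem a z) y)))"
    by (rule sum.swap)
  also have "\<dots> = (\<Sum>a\<in>carrier W. \<Sum>z\<in>centralizer. \<Sum>\<tau>\<in>T. \<Sum>y\<in>D. mob x a * (mob y (t \<otimes> z) * of_bool (\<tau> = orb (dem a z) y)))"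
    by (rule sum.cong [OF refl], rule sum.swap)
  also have "\<dots> = (\<Sum>a\<in>carrier W. \<Sum>z\<in>centralizer. \<Sum>y\<in>D. \<Sum>\<tau>\<in>T. mob x a * (mob y (t \<otimes> z) * of_bool (\<tau> = orb (dem a z) y)))"
    by (rule sum.cong [OF refl], rule sum.cong [OF refl], rule sum.swap)
  also have "\<dots> = (\<Sum>a\<in>carrier W. \<Sum>z\<in>centralizer. \<Sum>y\<in>D. mob x a * (mob y (t \<otimes> z) *
      of_bool (\<exists>w\<in>I y. bruhat u (dem (dem a z) w))))"
  proof (intro sum.cong refl)
    fix a z y assume a: "a \<in> carrier W" and z: "z \<in> centralizer" and y: "y \<in> D"
    have az: "dem a z \<in> carrier W" using a z centralizer_closed by auto
    have "orb (dem a z) y \<in> T \<longleftrightarrow> (\<exists>w\<in>I y. bruhat u (dem (dem a z) w))"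
      using bruhat_chevalley_orb [OF uv(1,2) az y] orb_orbit [OF az D_closed [OF y]]
      by (auto simp: T_def uv(3) I_def)
    moreover have "(\<Sum>\<tau>\<in>T. of_bool (\<tau> = orb (dem a z) y)) = (of_bool (orb (dem a z) y \<in> T) :: int)"
      using fin by (simp add: of_bool_def)
    ultimately show "(\<Sum>\<tau>\<in>T. mob x a * (mob y (t \<otimes> z) * of_bool (\<tau> = orb (dem a z) y))) =
        mob x a * (mob y (t \<otimes> z) * of_bool (\<exists>w\<in>I y. bruhat u (dem (dem a z) w)))"
      by (simp add: sum_distrib_left [symmetric])
  qed
  also have "\<dots> = (\<Sum>a\<in>carrier W. mob x a * (\<Sum>y\<in>D. \<Sum>z\<in>centralizer. mob y (t \<otimes> z) *
      (\<Sum>w\<in>I y. K w (\<lambda>b. of_bool (bruhat u (dem a (dem z b)))))))"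
  proof (intro sum.cong refl)
    fix a assume a: "a \<in> carrier W"
    have "(\<Sum>w\<in>I y. K w (\<lambda>b. of_bool (bruhat u (dem a (dem z b))))) =
        of_bool (\<exists>w\<in>I y. bruhat u (dem (dem a z) w))"
      if y: "y \<in> D" and z: "z \<in> centralizer" for y z
    proof -
      have zc: "z \<in> carrier W" by (rule centralizer_closed [OF z])
      have "(\<Sum>w\<in>I y. K w (\<lambda>b. of_bool (bruhat u (dem a (dem z b))))) =
          (\<Sum>w\<in>I y. K w (\<lambda>b. of_bool (bruhat u (dem (dem a z) b))))"
        by (intro sum.cong refl K_cong) (simp add: dem_assoc a zc)
      also have "\<dots> = of_bool (\<exists>w\<in>I y. bruhat u (dem (dem a z) w))"
      \<comment> \<open>\<open>I y\<close> is a lower set because multiplication by the minimal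
        representative \<open>y\<close> preserves the order on \<open>W(e)\<close>.\<close>
      proof (rule K_lower_set)
        show "I y \<subseteq> carrier W" "finite (I y)"
          using centralizer_closed finite_centralizer by (auto simp: I_def)
        show "p \<in> I y" if "r \<in> I y" "bruhat p r" for p r
          using that D_mono [OF y] centralizer_lower bruhat_trans unfolding I_def by blast
      qed (use a zc cl in auto)
      finally show ?thesis .
    qed
    then have "(\<Sum>y\<in>D. \<Sum>z\<in>centralizer. mob y (t \<otimes> z) * (\<Sum>w\<in>I y. K w (\<lambda>b. of_bool (bruhat u (dem a (dem z b)))))) =
      (\<Sum>y\<in>D. \<Sum>z\<in>centralizer. mob y (t \<otimes> z) * of_bool (\<exists>w\<in>I y. bruhat u (dem (dem a z) w)))"
      by (intro sum.cong refl) simp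
    also have "\<dots> = (\<Sum>z\<in>centralizer. \<Sum>y\<in>D. mob y (t \<otimes> z) * of_bool (\<exists>w\<in>I y. bruhat u (dem (dem a z) w)))"
      by (rule sum.swap)
    finally show "(\<Sum>z\<in>centralizer. \<Sum>y\<in>D. mob x a * (mob y (t \<otimes> z) *
        of_bool (\<exists>w\<in>I y. bruhat u (dem (dem a z) w)))) =
      mob x a * (\<Sum>y\<in>D. \<Sum>z\<in>centralizer. mob y (t \<otimes> z) *
        (\<Sum>w\<in>I y. K w (\<lambda>b. of_bool (bruhat u (dem a (dem z b))))))"
      by (simp add: sum_distrib_left)
  qed
  also have "\<dots> = (\<Sum>a\<in>carrier W. mob x a * (of_bool (t = v) * of_bool (bruhat u a)))"
  proof (intro sum.cong refl)
    fix a assume a: "a \<in> carrier W"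
    show "mob x a * (\<Sum>y\<in>D. \<Sum>z\<in>centralizer. mob y (t \<otimes> z) *
        (\<Sum>w\<in>I y. K w (\<lambda>b. of_bool (bruhat u (dem a (dem z b)))))) =
      mob x a * (of_bool (t = v) * of_bool (bruhat u a))"
      using parabolic_inversion [OF W_finite J_sub, of t v "\<lambda>c. of_bool (bruhat u (dem a c))"]
        xt(2) uv(2) a by (simp add: centralizer_gen I_def)
  qed
  also have "\<dots> = of_bool (t = v) * K x (\<lambda>a. of_bool (bruhat u a))"
    by (simp add: K_mob [OF W_finite] sum_distrib_left mult.left_commute)
  also have "\<dots> = of_bool (t = v) * of_bool (u = x)" by (simp add: verma cl)
  also have "\<dots> = of_bool (\<eta> = \<sigma>)" using orb_eqD uv xt by (auto simp: of_bool_def)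
  finally show ?thesis by (simp add: T_def)
qed

text \<open>The constant terms \<open>r\<close> and the transported signs \<open>r'\<close> have the
  same sum over every filter of the interval, so they agree by induction from the top; but a sign is
  never 0.\<close>

theorem not_isomorphic_to_bruhat_interval:
  assumes le: "bruhat_chevalley \<theta> \<sigma>" and zero: "poly (R_poly \<theta> \<sigma>) 0 = 0"
    and cox: "coxeter_group W' S'"
  shows "\<not> poset_isomorphic bruhat_chevalley {\<tau>. bruhat_chevalley \<theta> \<tau> \<and> bruhat_chevalley \<tau> \<sigma>}
    (coxeter_data.bruhat W' S') (coxeter_data.bruhat_interval W' S' u v)"
proof
  interpret W': coxeter_group W' S' by (rule cox)
  let ?X = "{\<tau>. bruhat_chevalley \<theta> \<tau> \<and> bruhat_chevalley \<tau> \<sigma>}"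
  let ?Y = "W'.bruhat_interval u v"
  assume "poset_isomorphic bruhat_chevalley ?X W'.bruhat ?Y"
  then obtain f where f: "bij_betw f ?X ?Y"
    and mono: "\<And>x y. x \<in> ?X \<Longrightarrow> y \<in> ?X \<Longrightarrow> bruhat_chevalley x y \<longleftrightarrow> W'.bruhat (f x) (f y)"
    unfolding poset_isomorphic_def by blast
  have orbit: "\<theta> \<in> orbit" "\<sigma> \<in> orbit" using le bruhat_chevalley_orbit by auto
  have ends: "\<theta> \<in> ?X" "\<sigma> \<in> ?X" using le bruhat_chevalley_refl orbit by auto
  have X_orbit: "x \<in> orbit" if "x \<in> ?X" for x using that bruhat_chevalley_orbit by blast
  have fX: "W'.bruhat u (f x)" "W'.bruhat (f x) v" if "x \<in> ?X" for x
    using bij_betwE [OF f] that by (auto simp: W'.bruhat_interval_def)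
  have v: "v \<in> carrier W'" using fX [OF ends(1)] W'.bruhat_carrier by blast
  have "W'.bruhat u v" using fX [OF ends(1)] W'.bruhat_trans by blast
  then have "v \<in> ?Y" using v by (simp add: W'.bruhat_interval_def)
  then have "v \<in> f ` ?X" using bij_betw_imp_surj_on [OF f] by simp
  then obtain x where x: "x \<in> ?X" "f x = v" by blast
  \<comment> \<open>The preimage of \<open>v\<close> lies below \<open>\<sigma>\<close>, so
    \<open>f \<sigma>\<close> is both above and below \<open>v\<close>.\<close>
  have top: "f \<sigma> = v"
    using mono [OF x(1) ends(2)] x fX [OF ends(2)] W'.bruhat_antisym by auto
  define r where "r \<tau> = poly (R_poly \<tau> \<sigma>) 0" for \<tau>
  define r' where "r' \<tau> = ((-1) ^ (W'.len v + W'.len (f \<tau>)) :: int)" for \<tau>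
  have finX: "finite ?X" by (rule finite_subset [OF _ finite_orbit]) (use X_orbit in blast)
  have r_sum: "(\<Sum>\<tau>\<in>{\<tau> \<in> ?X. bruhat_chevalley \<eta> \<tau>}. r \<tau>) = of_bool (\<eta> = \<sigma>)" if \<eta>: "\<eta> \<in> ?X" for \<eta>
  proof -
    obtain p t where pt: "p \<in> D\<^sub>e" "t \<in> D" "\<sigma> = orb p t" by (rule orbit_cases [OF orbit(2)])
    \<comment> \<open>Orbit elements above \<open>\<eta>\<close> but outside the interval are not
      below \<open>\<sigma>\<close>, and there the constant term vanishes.\<close>
    have "(\<Sum>\<tau>\<in>{\<tau> \<in> ?X. bruhat_chevalley \<eta> \<tau>}. r \<tau>) = (\<Sum>\<tau>\<in>{\<tau> \<in> orbit. bruhat_chevalley \<eta> \<tau>}. r \<tau>)"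
    proof (rule sum.mono_neutral_left)
      show "finite {\<tau> \<in> orbit. bruhat_chevalley \<eta> \<tau>}" using finite_orbit by simp
      show "{\<tau> \<in> ?X. bruhat_chevalley \<eta> \<tau>} \<subseteq> {\<tau> \<in> orbit. bruhat_chevalley \<eta> \<tau>}"
        using X_orbit by blast
      show "\<forall>\<tau>\<in>{\<tau> \<in> orbit. bruhat_chevalley \<eta> \<tau>} - {\<tau> \<in> ?X. bruhat_chevalley \<eta> \<tau>}. r \<tau> = 0"
      proof (intro ballI, rule ccontr)
        fix \<tau> assume \<tau>: "\<tau> \<in> {\<tau> \<in> orbit. bruhat_chevalley \<eta> \<tau>} - {\<tau> \<in> ?X. bruhat_chevalley \<eta> \<tau>}"
          and "r \<tau> \<noteq> 0"
        then have "bruhat_chevalley \<tau> \<sigma>" using R_poly_support pt by (simp add: r_def)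
        moreover have "bruhat_chevalley \<theta> \<tau>" using \<eta> \<tau> bruhat_chevalley_trans by blast
        ultimately show False using \<tau> by blast
      qed
    qed
    also have "\<dots> = of_bool (\<eta> = \<sigma>)"
      using R_poly_inversion [OF X_orbit [OF \<eta>] orbit(2)] by (simp add: r_def)
    finally show ?thesis .
  qed
  have r'_sum: "(\<Sum>\<tau>\<in>{\<tau> \<in> ?X. bruhat_chevalley \<eta> \<tau>}. r' \<tau>) = of_bool (\<eta> = \<sigma>)" if \<eta>: "\<eta> \<in> ?X" for \<eta>
  proof -
    let ?L = "{a. W'.bruhat a v}"
    have \<eta>c: "f \<eta> \<in> carrier W'" using fX [OF \<eta>] W'.bruhat_carrier by blast
    have img: "f ` {\<tau> \<in> ?X. bruhat_chevalley \<eta> \<tau>} = {a \<in> ?L. W'.bruhat (f \<eta>) a}"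
    proof
      show "f ` {\<tau> \<in> ?X. bruhat_chevalley \<eta> \<tau>} \<subseteq> {a \<in> ?L. W'.bruhat (f \<eta>) a}"
        using fX mono [OF \<eta>] by blast
      show "{a \<in> ?L. W'.bruhat (f \<eta>) a} \<subseteq> f ` {\<tau> \<in> ?X. bruhat_chevalley \<eta> \<tau>}"
      proof
        fix a assume a: "a \<in> {a \<in> ?L. W'.bruhat (f \<eta>) a}"
        then have "a \<in> ?Y"
          using W'.bruhat_trans [OF fX(1) [OF \<eta>]] by (simp add: W'.bruhat_interval_def)
        then have "a \<in> f ` ?X" using bij_betw_imp_surj_on [OF f] by simp
        then obtain \<tau> where "\<tau> \<in> ?X" "a = f \<tau>" by blast
        then show "a \<in> f ` {\<tau> \<in> ?X. bruhat_chevalley \<eta> \<tau>}" using a mono [OF \<eta>] by blast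
      qed
    qed
    have inj: "inj_on f {\<tau> \<in> ?X. bruhat_chevalley \<eta> \<tau>}"
      by (rule inj_on_subset [OF bij_betw_imp_inj_on [OF f]]) blast
    have "of_bool (f \<eta> = v) = W'.K v (\<lambda>a. of_bool (W'.bruhat (f \<eta>) a))"
      by (rule W'.verma [OF v \<eta>c, symmetric])
    also have "\<dots> = (\<Sum>a\<in>{a \<in> ?L. W'.bruhat (f \<eta>) a}. (-1) ^ (W'.len v + W'.len a))"
      unfolding W'.K_def by (rule sum.mono_neutral_cong_right) (auto simp: W'.finite_lower)
    also have "\<dots> = (\<Sum>\<tau>\<in>{\<tau> \<in> ?X. bruhat_chevalley \<eta> \<tau>}. r' \<tau>)"
      unfolding img [symmetric] sum.reindex [OF inj] r'_def by simp
    finally have "(\<Sum>\<tau>\<in>{\<tau> \<in> ?X. bruhat_chevalley \<eta> \<tau>}. r' \<tau>) = of_bool (f \<eta> = v)" by simp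
    moreover have "f \<eta> = v \<longleftrightarrow> \<eta> = \<sigma>"
      using top ends \<eta> bij_betw_imp_inj_on [OF f] by (auto dest: inj_onD)
    ultimately show ?thesis by simp
  qed
  have "\<eta> \<in> ?X \<Longrightarrow> r \<eta> = r' \<eta>" for \<eta>
  \<comment> \<open>The induction descends from the top: the measure is the distance of
    \<open>f \<eta>\<close> from \<open>v\<close> in length, so elements strictly above
    \<open>\<eta>\<close> are already settled.\<close>
  proof (induction "W'.len v - W'.len (f \<eta>)" arbitrary: \<eta> rule: less_induct)
    case less
    let ?U = "{\<tau> \<in> ?X. bruhat_chevalley \<eta> \<tau>}"
    have fin: "finite ?U" by (rule finite_subset [OF _ finX]) blast
    have mem: "\<eta> \<in> ?U" using less.prems X_orbit bruhat_chevalley_refl by blast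
    have "r \<tau> = r' \<tau>" if \<tau>: "\<tau> \<in> ?U - {\<eta>}" for \<tau>
    proof -
      have "f \<tau> \<noteq> f \<eta>"
        using \<tau> less.prems bij_betw_imp_inj_on [OF f] by (auto dest: inj_onD)
      moreover have "W'.bruhat (f \<eta>) (f \<tau>)" using mono less.prems \<tau> by blast
      ultimately have "W'.len (f \<eta>) < W'.len (f \<tau>)" using W'.bruhat_len_eq by (metis not_le)
      moreover have "W'.len (f \<tau>) \<le> W'.len v" using W'.bruhat_len fX \<tau> by blast
      ultimately show ?thesis using less.hyps [of \<tau>] \<tau> by auto
    qed
    then have "(\<Sum>\<tau>\<in>?U - {\<eta>}. r \<tau>) = (\<Sum>\<tau>\<in>?U - {\<eta>}. r' \<tau>)" by (intro sum.cong) auto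
    moreover have "r \<eta> + (\<Sum>\<tau>\<in>?U - {\<eta>}. r \<tau>) = r' \<eta> + (\<Sum>\<tau>\<in>?U - {\<eta>}. r' \<tau>)"
      using r_sum [OF less.prems] r'_sum [OF less.prems] sum.remove [OF fin mem, of r]
        sum.remove [OF fin mem, of r'] by simp
    ultimately show ?case by simp
  qed
  from this [OF ends(1)] show False using zero by (simp add: r_def r'_def)
qed

end

section \<open>Weyl groups of root systems\<close>

locale based_root_system =
  fixes \<Phi> \<Delta> :: "'v::euclidean_space set"
  assumes roots: "root_system \<Phi>" and base: "root_base \<Phi> \<Delta>"
begin

abbreviation G :: "('v \<Rightarrow> 'v) monoid" where "G \<equiv> BijGroup UNIV"

lemma finite_roots: "finite \<Phi>" and zero_notin_roots: "0 \<notin> \<Phi>"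
  and reflect_root: "\<alpha> \<in> \<Phi> \<Longrightarrow> \<beta> \<in> \<Phi> \<Longrightarrow> root_reflection \<alpha> \<beta> \<in> \<Phi>"
  and reduced_roots: "\<alpha> \<in> \<Phi> \<Longrightarrow> c *\<^sub>R \<alpha> \<in> \<Phi> \<Longrightarrow> c = 1 \<or> c = - 1"
  using roots by (auto simp: root_system_def)

lemma base_roots: "\<Delta> \<subseteq> \<Phi>" and independent_base: "independent \<Delta>"
  using base by (auto simp: root_base_def)

lemma finite_base: "finite \<Delta>"
  by (rule finite_subset [OF base_roots finite_roots])

lemma root_reflection_linear: "linear (root_reflection \<alpha>)"
  by (rule linearI)
    (simp_all add: root_reflection_def inner_add_left add_divide_distrib distrib_left scaleR_add_left
      scaleR_right_diff_distrib)

lemma root_reflection_self: "\<alpha> \<noteq> 0 \<Longrightarrow> root_reflection \<alpha> \<alpha> = - \<alpha>"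
  by (simp add: root_reflection_def scaleR_2)

lemma root_reflection_involution: "\<alpha> \<noteq> 0 \<Longrightarrow> root_reflection \<alpha> (root_reflection \<alpha> x) = x"
  by (simp add: root_reflection_def inner_diff_left scaleR_diff_left [symmetric])

lemma root_reflection_inner:
  "\<alpha> \<noteq> 0 \<Longrightarrow> inner (root_reflection \<alpha> x) (root_reflection \<alpha> y) = inner x y"
  by (simp add: root_reflection_def inner_diff_left inner_diff_right inner_commute field_simps)

lemma root_reflection_uminus: "root_reflection (- \<alpha>) = root_reflection \<alpha>"
  by (simp add: root_reflection_def fun_eq_iff)

lemma uminus_root: "\<alpha> \<in> \<Phi> \<Longrightarrow> - \<alpha> \<in> \<Phi>"
  using reflect_root [of \<alpha> \<alpha>] root_reflection_self [of \<alpha>] zero_notin_roots by (cases "\<alpha> = 0") auto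

lemma root_reflection_Bij: "\<alpha> \<in> \<Phi> \<Longrightarrow> root_reflection \<alpha> \<in> carrier G"
  using zero_notin_roots root_reflection_involution [of \<alpha>]
  by (auto simp: BijGroup_def Bij_def intro!: involuntory_imp_bij)

lemma G_mult: "f \<in> carrier G \<Longrightarrow> g \<in> carrier G \<Longrightarrow> f \<otimes>\<^bsub>G\<^esub> g = f \<circ> g"
  by (auto simp: BijGroup_def compose_def)

lemma G_one: "\<one>\<^bsub>G\<^esub> = id"
  by (auto simp: BijGroup_def)

lemma carrier_G: "carrier G = {f. bij f}"
  by (auto simp: BijGroup_def Bij_def)

interpretation G: group G
  by (rule group_BijGroup)

definition preserving :: "('v \<Rightarrow> 'v) \<Rightarrow> bool" where
  "preserving f \<longleftrightarrow> bij f \<and> linear f \<and> (\<forall>x y. inner (f x) (f y) = inner x y) \<and> (\<forall>\<beta>\<in>\<Phi>. f \<beta> \<in> \<Phi>)"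

lemma root_weyl_group_simps:
  "carrier (root_weyl_group \<Phi>) = generate G (root_reflection ` \<Phi>)"
  "monoid.mult (root_weyl_group \<Phi>) = monoid.mult G" "one (root_weyl_group \<Phi>) = one G"
  by (simp_all add: root_weyl_group_def)

lemma reflections_Bij: "root_reflection ` \<Phi> \<subseteq> carrier G"
  using root_reflection_Bij by blast

lemma subgroup_weyl: "subgroup (carrier (root_weyl_group \<Phi>)) G"
  unfolding root_weyl_group_simps by (rule G.generate_is_subgroup [OF reflections_Bij])

lemma group_weyl: "group (root_weyl_group \<Phi>)"
  using subgroup.subgroup_is_group [OF subgroup_weyl G.group_axioms]
  by (simp add: root_weyl_group_def)

lemma preserving_reflection:
  assumes "\<alpha> \<in> \<Phi>"
  shows "preserving (root_reflection \<alpha>)"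
proof -
  have "\<alpha> \<noteq> 0" using assms zero_notin_roots by auto
  then show ?thesis using root_reflection_Bij [OF assms] assms
    by (simp add: preserving_def carrier_G root_reflection_linear root_reflection_inner reflect_root)
qed

lemma inv_reflection: "\<alpha> \<in> \<Phi> \<Longrightarrow> inv\<^bsub>G\<^esub> root_reflection \<alpha> = root_reflection \<alpha>"
  using zero_notin_roots root_reflection_involution [of \<alpha>] root_reflection_Bij [of \<alpha>]
  by (intro G.inv_equality) (auto simp: G_mult G_one fun_eq_iff)

lemma preserving_weyl:
  assumes "f \<in> carrier (root_weyl_group \<Phi>)"
  shows "preserving f"
  using assms unfolding root_weyl_group_simps
proof induction
  case one
  have "preserving id" by (simp add: preserving_def linear_id [unfolded id_def] bij_id [unfolded id_def] id_def)
  then show ?case by (simp only: G_one)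
next
  case (incl h)
  then show ?case using preserving_reflection by blast
next
  case (inv h)
  then show ?case using preserving_reflection inv_reflection by auto
next
  case (eng f g)
  then have "f \<otimes>\<^bsub>G\<^esub> g = f \<circ> g" by (intro G_mult) (auto simp: preserving_def carrier_G)
  moreover have "bij (f \<circ> g)" "linear (f \<circ> g)"
    using eng by (auto simp: preserving_def intro: bij_comp linear_compose)
  moreover have "\<forall>x y. inner ((f \<circ> g) x) ((f \<circ> g) y) = inner x y" "\<forall>\<beta>\<in>\<Phi>. (f \<circ> g) \<beta> \<in> \<Phi>"
    using eng by (simp_all add: preserving_def)
  ultimately show ?case unfolding preserving_def by metis
qed

lemma reflection_image:
  assumes "preserving f"
  shows "root_reflection (f \<alpha>) \<circ> f = f \<circ> root_reflection \<alpha>"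
  using assms by (auto simp: preserving_def root_reflection_def linear_diff linear_scale fun_eq_iff)

section \<open>Positive roots and simple reflections\<close>

abbreviation coord :: "'v \<Rightarrow> 'v \<Rightarrow> real" where "coord \<beta> \<alpha> \<equiv> representation \<Delta> \<beta> \<alpha>"

definition pos :: "'v \<Rightarrow> bool" where
  "pos \<beta> \<longleftrightarrow> \<beta> \<in> \<Phi> \<and> (\<forall>\<alpha>\<in>\<Delta>. 0 \<le> coord \<beta> \<alpha>)"

lemma root_span: "\<beta> \<in> \<Phi> \<Longrightarrow> \<beta> \<in> span \<Delta>"
proof -
  assume "\<beta> \<in> \<Phi>"
  then obtain c :: "'v \<Rightarrow> int" where "\<beta> = (\<Sum>\<alpha>\<in>\<Delta>. of_int (c \<alpha>) *\<^sub>R \<alpha>)"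
    using base unfolding root_base_def by blast
  then show ?thesis by (simp add: span_sum span_scale span_base)
qed

lemma coord_sum: "\<beta> \<in> \<Phi> \<Longrightarrow> (\<Sum>\<alpha>\<in>\<Delta>. coord \<beta> \<alpha> *\<^sub>R \<alpha>) = \<beta>"
  by (rule real_vector.sum_representation_eq [OF independent_base root_span finite_base]) simp_all

lemma coord_eqI:
  assumes "\<beta> = (\<Sum>\<alpha>\<in>\<Delta>. c \<alpha> *\<^sub>R \<alpha>)" "\<alpha> \<in> \<Delta>"
  shows "coord \<beta> \<alpha> = c \<alpha>"
proof -
  have "coord \<beta> = (\<lambda>\<gamma>. \<Sum>\<alpha>\<in>\<Delta>. coord (c \<alpha> *\<^sub>R \<alpha>) \<gamma>)"
    unfolding assms(1)
    by (rule real_vector.representation_sum [OF independent_base]) (simp add: span_base span_scale)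
  then have "coord \<beta> \<alpha> = (\<Sum>\<gamma>\<in>\<Delta>. coord (c \<gamma> *\<^sub>R \<gamma>) \<alpha>)" by simp
  also have "\<dots> = (\<Sum>\<gamma>\<in>\<Delta>. if \<gamma> = \<alpha> then c \<gamma> else 0)"
    by (intro sum.cong)
      (auto simp: real_vector.representation_scale independent_base span_base
        real_vector.representation_basis)
  finally show ?thesis using assms finite_base by simp
qed

lemma pos_or_neg:
  assumes "\<beta> \<in> \<Phi>"
  shows "pos \<beta> \<or> pos (- \<beta>)"
proof -
  obtain c :: "'v \<Rightarrow> int" where c: "\<beta> = (\<Sum>\<alpha>\<in>\<Delta>. of_int (c \<alpha>) *\<^sub>R \<alpha>)"
    "(\<forall>\<alpha>\<in>\<Delta>. c \<alpha> \<ge> 0) \<or> (\<forall>\<alpha>\<in>\<Delta>. c \<alpha> \<le> 0)"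
    using base assms unfolding root_base_def by blast
  have "coord \<beta> \<alpha> = of_int (c \<alpha>)" if "\<alpha> \<in> \<Delta>" for \<alpha> by (rule coord_eqI [OF c(1) that])
  moreover have "coord (- \<beta>) \<alpha> = - coord \<beta> \<alpha>" for \<alpha>
    by (simp add: real_vector.representation_neg independent_base root_span assms)
  ultimately show ?thesis using c(2) assms uminus_root by (auto simp: pos_def)
qed

lemma not_pos_uminus: "pos \<beta> \<Longrightarrow> \<not> pos (- \<beta>)"
proof
  assume p: "pos \<beta>" "pos (- \<beta>)"
  then have b: "\<beta> \<in> \<Phi>" by (simp add: pos_def)
  have "coord (- \<beta>) \<alpha> = - coord \<beta> \<alpha>" for \<alpha>
    by (simp add: real_vector.representation_neg independent_base root_span b)
  then have "coord \<beta> \<alpha> = 0" if "\<alpha> \<in> \<Delta>" for \<alpha>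
    using p that by (auto simp: pos_def intro: antisym)
  then have "\<beta> = 0" using coord_sum [OF b] by simp
  then show False using b zero_notin_roots by simp
qed

lemma pos_base: "\<alpha> \<in> \<Delta> \<Longrightarrow> pos \<alpha>"
  using base_roots by (auto simp: pos_def real_vector.representation_basis independent_base)

lemma coord_reflection:
  assumes "\<alpha> \<in> \<Delta>" "\<beta> \<in> \<Phi>"
  shows "coord (root_reflection \<alpha> \<beta>) \<gamma> =
    coord \<beta> \<gamma> - (2 * inner \<beta> \<alpha> / inner \<alpha> \<alpha>) * (if \<gamma> = \<alpha> then 1 else 0)"
  using assms independent_base
  by (simp add: root_reflection_def real_vector.representation_diff real_vector.representation_scale
      real_vector.representation_basis span_scale span_base root_span)

text \<open>As the root system is reduced, a positive root other than \<open>\<alpha>\<close> has a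
  positive coordinate at another simple root. The reflection does not change that coordinate, and
  one positive coordinate makes a root positive.\<close>

lemma reflection_pos:
  assumes \<alpha>: "\<alpha> \<in> \<Delta>" and \<beta>: "pos \<beta>" and ne: "\<beta> \<noteq> \<alpha>"
  shows "pos (root_reflection \<alpha> \<beta>)"
proof -
  have b: "\<beta> \<in> \<Phi>" and a: "\<alpha> \<in> \<Phi>" using \<beta> \<alpha> base_roots by (auto simp: pos_def)
  have r: "root_reflection \<alpha> \<beta> \<in> \<Phi>" by (rule reflect_root [OF a b])
  have "\<exists>\<gamma>\<in>\<Delta>. \<gamma> \<noteq> \<alpha> \<and> coord \<beta> \<gamma> \<noteq> 0"
  proof (rule ccontr)
    assume "\<not> ?thesis"
    then have "(\<Sum>\<gamma>\<in>\<Delta>. coord \<beta> \<gamma> *\<^sub>R \<gamma>) = (\<Sum>\<gamma>\<in>\<Delta>. if \<gamma> = \<alpha> then coord \<beta> \<gamma> *\<^sub>R \<gamma> else 0)"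
      by (intro sum.cong) auto
    then have e: "\<beta> = coord \<beta> \<alpha> *\<^sub>R \<alpha>" using coord_sum [OF b] \<alpha> finite_base by simp
    then have "coord \<beta> \<alpha> = 1 \<or> coord \<beta> \<alpha> = - 1" using reduced_roots [OF a] b by metis
    moreover have "0 \<le> coord \<beta> \<alpha>" using \<beta> \<alpha> by (simp add: pos_def)
    ultimately show False using e ne by auto
  qed
  then obtain \<gamma> where \<gamma>: "\<gamma> \<in> \<Delta>" "\<gamma> \<noteq> \<alpha>" "coord \<beta> \<gamma> \<noteq> 0" by blast
  then have "0 < coord \<beta> \<gamma>" using \<beta> by (auto simp: pos_def order_less_le)
  then have "0 < coord (root_reflection \<alpha> \<beta>) \<gamma>" using coord_reflection [OF \<alpha> b] \<gamma> by simp
  then have "\<not> pos (- root_reflection \<alpha> \<beta>)"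
    using \<gamma> r by (auto simp: pos_def real_vector.representation_neg independent_base root_span
        intro!: bexI [of _ \<gamma>])
  then show ?thesis using pos_or_neg [OF r] by blast
qed

text \<open>Take a positive root of least height whose reflection is missing. It has positive inner
  product with some simple root \<open>\<alpha>\<close>, so reflecting it in \<open>\<alpha>\<close>
  lowers its height; the reflection of the lower root is present, and conjugating it by the
  reflection in \<open>\<alpha>\<close> gives the missing one.\<close>

lemma base_generates:
  "generate G (root_reflection ` \<Delta>) = generate G (root_reflection ` \<Phi>)"
proof
  let ?H = "generate G (root_reflection ` \<Delta>)"
  show "?H \<subseteq> generate G (root_reflection ` \<Phi>)"
    using base_roots by (intro G.mono_generate) auto
  define ht where "ht \<beta> = (\<Sum>\<alpha>\<in>\<Delta>. coord \<beta> \<alpha>)" for \<beta>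
  define A where "A = {\<beta>. pos \<beta> \<and> root_reflection \<beta> \<notin> ?H}"
  have "A = {}"
  proof (rule ccontr)
    assume ne: "A \<noteq> {}"
    have fin: "finite A" by (rule finite_subset [OF _ finite_roots]) (auto simp: A_def pos_def)
    define \<beta> where "\<beta> = arg_min_on ht A"
    have b: "\<beta> \<in> A" unfolding \<beta>_def by (rule arg_min_if_finite [OF fin ne])
    have min: "ht \<beta> \<le> ht \<gamma>" if "\<gamma> \<in> A" for \<gamma>
      unfolding \<beta>_def by (rule arg_min_least [OF fin ne that])
    have bp: "pos \<beta>" "\<beta> \<in> \<Phi>" using b by (auto simp: A_def pos_def)
    have "0 < inner \<beta> \<beta>" using bp zero_notin_roots by auto
    also have "inner \<beta> \<beta> = inner (\<Sum>\<alpha>\<in>\<Delta>. coord \<beta> \<alpha> *\<^sub>R \<alpha>) \<beta>" using coord_sum [OF bp(2)] by simp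
    also have "\<dots> = (\<Sum>\<alpha>\<in>\<Delta>. coord \<beta> \<alpha> * inner \<alpha> \<beta>)" by (simp add: inner_sum_left)
    finally have "\<exists>\<alpha>\<in>\<Delta>. 0 < coord \<beta> \<alpha> * inner \<alpha> \<beta>"
      by (meson not_le sum_nonpos)
    then obtain \<alpha> where \<alpha>: "\<alpha> \<in> \<Delta>" "0 < coord \<beta> \<alpha> * inner \<alpha> \<beta>" by blast
    have cp: "0 \<le> coord \<beta> \<alpha>" using bp \<alpha> by (simp add: pos_def)
    then have ip: "0 < inner \<beta> \<alpha>" using \<alpha>(2) by (auto simp: zero_less_mult_iff inner_commute)
    have a: "\<alpha> \<in> \<Phi>" "\<alpha> \<noteq> 0" using \<alpha> base_roots zero_notin_roots by auto
    have sH: "root_reflection \<alpha> \<in> ?H" using \<alpha> by (intro generate.incl) auto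
    then have "\<beta> \<noteq> \<alpha>" using b by (auto simp: A_def)
    then have gp: "pos (root_reflection \<alpha> \<beta>)" using reflection_pos \<alpha> bp by blast
    have "ht (root_reflection \<alpha> \<beta>) = ht \<beta> - 2 * inner \<beta> \<alpha> / inner \<alpha> \<alpha>"
      using \<alpha> finite_base
      by (simp add: ht_def coord_reflection [OF \<alpha>(1) bp(2)] sum_subtractf sum_distrib_left [symmetric]
          del: times_divide_eq_left)
    moreover have "0 < 2 * inner \<beta> \<alpha> / inner \<alpha> \<alpha>" using ip a by simp
    ultimately have "ht (root_reflection \<alpha> \<beta>) < ht \<beta>" by linarith
    then have "root_reflection \<alpha> \<beta> \<notin> A" using min not_le by blast
    then have gH: "root_reflection (root_reflection \<alpha> \<beta>) \<in> ?H" using gp by (simp add: A_def)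
    let ?s = "root_reflection \<alpha>" and ?t = "root_reflection (root_reflection \<alpha> \<beta>)"
    have "?t \<circ> ?s = ?s \<circ> root_reflection \<beta>"
      by (rule reflection_image [OF preserving_reflection [OF a(1)]])
    then have "?s \<circ> (?t \<circ> ?s) = root_reflection \<beta>"
      using root_reflection_involution [OF a(2)] by (simp add: fun_eq_iff)
    moreover have "?t \<otimes>\<^bsub>G\<^esub> ?s = ?t \<circ> ?s" "?s \<otimes>\<^bsub>G\<^esub> (?t \<circ> ?s) = ?s \<circ> (?t \<circ> ?s)"
      using root_reflection_Bij a reflect_root [OF a(1) bp(2)]
      by (auto intro!: G_mult simp: carrier_G bij_comp)
    ultimately have "?s \<otimes>\<^bsub>G\<^esub> (?t \<otimes>\<^bsub>G\<^esub> ?s) = root_reflection \<beta>" by simp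
    then have "root_reflection \<beta> \<in> ?H" using sH gH generate.eng by metis
    then show False using b by (simp add: A_def)
  qed
  have "root_reflection \<beta> \<in> ?H" if "\<beta> \<in> \<Phi>" for \<beta>
    using pos_or_neg [OF that] \<open>A = {}\<close> root_reflection_uminus [of \<beta>] by (auto simp: A_def)
  then have "root_reflection ` \<Phi> \<subseteq> ?H" by blast
  then show "generate G (root_reflection ` \<Phi>) \<subseteq> ?H"
    using base_roots reflections_Bij
    by (intro G.generate_subgroup_incl G.generate_is_subgroup) auto
qed

text \<open>The half-space of a simple root consists of the \<open>w\<close> whose inverse keeps
  that root positive; \<open>P\<close> says this without inverses. If \<open>w\<close> lies in it
  and \<open>w \<otimes> r\<close> does not, then \<open>r\<close> makes the positive root
  \<open>\<beta>\<close> with \<open>w \<beta> = root s\<close> negative, so \<open>\<beta>\<close>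
  is the simple root of \<open>r\<close> and \<open>w\<close> conjugates \<open>r\<close> to
  \<open>s\<close>.\<close>

theorem coxeter_group_weyl: "coxeter_group (root_weyl_group \<Phi>) (root_reflection ` \<Delta>)"
proof -
  let ?W = "root_weyl_group \<Phi>" and ?S = "root_reflection ` \<Delta>"
  have SW: "?S \<subseteq> carrier ?W"
    unfolding root_weyl_group_simps using base_roots by (auto intro: generate.incl)
  have W_mult: "f \<otimes>\<^bsub>?W\<^esub> g = f \<circ> g" if "f \<in> carrier ?W" "g \<in> carrier ?W" for f g
    using that preserving_weyl unfolding root_weyl_group_simps(2)
    by (intro G_mult) (auto simp: preserving_def carrier_G)
  have W_one: "\<one>\<^bsub>?W\<^esub> = id" by (simp add: root_weyl_group_simps G_one)
  have "generate ?W ?S = generate G ?S"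
    using G.generate_consistent [OF SW subgroup_weyl] by (simp add: root_weyl_group_def)
  then have gen: "generate ?W ?S = carrier ?W"
    by (simp add: base_generates root_weyl_group_simps)
  interpret W: group ?W by (rule group_weyl)
  interpret inv: involution_generated ?W ?S
  proof unfold_locales
    show "s \<otimes>\<^bsub>?W\<^esub> s = \<one>\<^bsub>?W\<^esub>" if s: "s \<in> ?S" for s
    proof -
      obtain \<alpha> where "s = root_reflection \<alpha>" "\<alpha> \<noteq> 0"
        using s base_roots zero_notin_roots by auto
      then have "s \<circ> s = id" by (simp add: fun_eq_iff root_reflection_involution)
      then show ?thesis using W_mult s SW W_one by auto
    qed
  qed (use SW gen in auto)
  define root where "root = inv_into \<Delta> root_reflection"
  have root: "root s \<in> \<Delta>" "root_reflection (root s) = s" if "s \<in> ?S" for s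
    using that unfolding root_def by (auto simp: inv_into_into f_inv_into_f)
  define P where "P s = {w. \<exists>\<beta>. pos \<beta> \<and> w \<beta> = root s}" for s
  show ?thesis
  proof (rule inv.coxeter_groupI [where P = P])
    show "finite ?S" using finite_base by simp
    show "\<one>\<^bsub>?W\<^esub> \<in> P s" if "s \<in> ?S" for s
      using root [OF that] pos_base by (auto simp: P_def W_one)
    show "s \<otimes>\<^bsub>?W\<^esub> w \<notin> P s" if s: "s \<in> ?S" and w: "w \<in> carrier ?W" and wP: "w \<in> P s" for s w
    proof
      assume "s \<otimes>\<^bsub>?W\<^esub> w \<in> P s"
      then obtain \<gamma> where \<gamma>: "pos \<gamma>" "s (w \<gamma>) = root s"
        using W_mult [OF subsetD [OF SW s] w] by (auto simp: P_def)
      obtain \<beta> where \<beta>: "pos \<beta>" "w \<beta> = root s" using wP by (auto simp: P_def)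
      have rs: "root s \<noteq> 0" using root [OF s] base_roots zero_notin_roots by auto
      have inv: "s (s x) = x" "s (root s) = - root s" for x
        using root_reflection_involution [OF rs, of x] root_reflection_self [OF rs] root [OF s] by auto
      have p: "preserving w" by (rule preserving_weyl [OF w])
      have "w \<gamma> = - root s" using \<gamma> inv by metis
      also have "\<dots> = w (- \<beta>)" using p \<beta> by (simp add: preserving_def linear_neg)
      finally have "\<gamma> = - \<beta>" using p by (auto simp: preserving_def bij_def dest: injD)
      then show False using \<gamma> \<beta> not_pos_uminus by blast
    qed
    show "s \<otimes>\<^bsub>?W\<^esub> w = w \<otimes>\<^bsub>?W\<^esub> r"
      if s: "s \<in> ?S" and wP: "w \<in> P s" and w: "w \<in> carrier ?W" and r: "r \<in> ?S"
        and n: "w \<otimes>\<^bsub>?W\<^esub> r \<notin> P s" for s w r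
    proof -
      obtain \<beta> where \<beta>: "pos \<beta>" "w \<beta> = root s" using wP by (auto simp: P_def)
      have rr: "root r \<noteq> 0" using root [OF r] base_roots zero_notin_roots by auto
      have "r (r \<beta>) = \<beta>" using root_reflection_involution [OF rr] root [OF r] by simp
      then have "(w \<otimes>\<^bsub>?W\<^esub> r) (r \<beta>) = root s"
        using W_mult [OF w subsetD [OF SW r]] \<beta> by simp
      then have "\<not> pos (r \<beta>)" using n by (auto simp: P_def)
      then have "\<beta> = root r" using reflection_pos [of "root r" \<beta>] root [OF r] \<beta> by auto
      then have "root_reflection (root s) \<circ> w = w \<circ> root_reflection (root r)"
        using reflection_image [OF preserving_weyl [OF w], of "root r"] \<beta> by simp
      then show ?thesis using W_mult s r w SW root by (simp add: subset_iff)
    qed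
  qed
qed

end

section \<open>Groups with a BN-pair\<close>

lemma (in group) finite_closed_subgroup:
  assumes "finite (carrier G)" "Q \<subseteq> carrier G" "\<one> \<in> Q"
    and closed: "\<And>x y. x \<in> Q \<Longrightarrow> y \<in> Q \<Longrightarrow> x \<otimes> y \<in> Q"
  shows "subgroup Q G"
proof (rule subgroupI)
  show "Q \<subseteq> carrier G" "Q \<noteq> {}" using assms by auto
  show "x \<otimes> y \<in> Q" if "x \<in> Q" "y \<in> Q" for x y using closed that .
  show "inv x \<in> Q" if x: "x \<in> Q" for x
  proof -
    have "inj_on ((\<otimes>) x) Q" using x assms(2) by (intro inj_on_subset [OF inj_on_cmult]) auto
    moreover have "(\<otimes>) x ` Q \<subseteq> Q" using x closed by auto
    ultimately have "(\<otimes>) x ` Q = Q" using finite_subset [OF assms(2,1)] by (intro endo_inj_surj)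
    then obtain y where "y \<in> Q" "x \<otimes> y = \<one>" using assms(3) by (metis imageE)
    then show ?thesis using x assms(2) by (metis inv_equality inv_inv subsetD inv_closed)
  qed
qed

locale lie_type_group = finite_group_of_Lie_type G p B N U S
  for G :: "'a monoid" (structure) and p and B N U :: "'a set" and S
begin

abbreviation "W \<equiv> weyl_group"

definition dc :: "'a set \<Rightarrow> 'a set" where
  "dc w = B <#> w <#> B"

lemma N_carrier: "n \<in> N \<Longrightarrow> n \<in> carrier G"
  and B_carrier: "b \<in> B \<Longrightarrow> b \<in> carrier G"
  using subgroup.subset [OF subgroup_N] subgroup.subset [OF subgroup_B] by auto

lemma B_closed: "b \<in> B \<Longrightarrow> b' \<in> B \<Longrightarrow> b \<otimes> b' \<in> B" "b \<in> B \<Longrightarrow> inv b \<in> B" "\<one> \<in> B"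
  and N_closed: "n \<in> N \<Longrightarrow> n' \<in> N \<Longrightarrow> n \<otimes> n' \<in> N" "n \<in> N \<Longrightarrow> inv n \<in> N" "\<one> \<in> N"
  using subgroup_B subgroup_N
  by (auto intro: subgroup.m_closed subgroup.m_inv_closed subgroup.one_closed)

lemma torus_B: "t \<in> torus \<Longrightarrow> t \<in> B" and torus_N: "t \<in> torus \<Longrightarrow> t \<in> N"
  and torus_carrier: "t \<in> torus \<Longrightarrow> t \<in> carrier G"
  by (auto simp: torus_def B_carrier)

lemma torus_closed: "t \<in> torus \<Longrightarrow> t' \<in> torus \<Longrightarrow> t \<otimes> t' \<in> torus" "t \<in> torus \<Longrightarrow> inv t \<in> torus"
  "\<one> \<in> torus"
  by (auto simp: torus_def B_closed N_closed)

lemma torus_conj: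
  assumes "n \<in> N" "t \<in> torus"
  shows "n \<otimes> t \<otimes> inv n \<in> torus" "inv n \<otimes> t \<otimes> n \<in> torus"
proof -
  have i: "inv\<^bsub>G\<lparr>carrier := N\<rparr>\<^esub> x = inv x" if "x \<in> N" for x
    using m_inv_consistent [OF subgroup_N that] .
  show a: "n \<otimes> t \<otimes> inv n \<in> torus"
    using normal.inv_op_closed2 [OF torus_normal, of n t] assms i by simp
  show "inv n \<otimes> t \<otimes> n \<in> torus"
    using normal.inv_op_closed1 [OF torus_normal, of n t] assms i by simp
qed

lemma group_W: "group W"
  unfolding weyl_group_def by (rule normal.factorgroup_is_group [OF torus_normal])

lemma W_mult: "x \<otimes>\<^bsub>W\<^esub> y = x <#> y" and W_one: "\<one>\<^bsub>W\<^esub> = torus"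
  by (simp_all add: weyl_group_def FactGroup_def set_mult_def)

lemma W_cases:
  assumes "w \<in> carrier W"
  obtains n where "n \<in> N" "w = torus #> n"
  using assms by (auto simp: weyl_group_def FactGroup_def RCOSETS_def r_coset_def)

lemma class_W: "n \<in> N \<Longrightarrow> torus #> n \<in> carrier W"
  by (auto simp: weyl_group_def FactGroup_def RCOSETS_def r_coset_def)

lemma mem_class: "n \<in> N \<Longrightarrow> n \<in> torus #> n"
  using torus_closed(3) N_carrier by (force simp: r_coset_def)

lemma W_N: "w \<in> carrier W \<Longrightarrow> n \<in> w \<Longrightarrow> n \<in> N"
  by (erule W_cases) (auto simp: r_coset_def N_closed torus_N)

lemma W_carrier: "w \<in> carrier W \<Longrightarrow> n \<in> w \<Longrightarrow> n \<in> carrier G"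
  using W_N N_carrier by blast

lemma W_nonempty: "w \<in> carrier W \<Longrightarrow> \<exists>n. n \<in> w"
  by (erule W_cases) (use mem_class in blast)

lemma W_eq_class:
  assumes w: "w \<in> carrier W" and n: "n \<in> w"
  shows "w = torus #> n"
proof -
  obtain m where m: "m \<in> N" "w = torus #> m" using W_cases [OF w] .
  then obtain t where t: "t \<in> torus" "n = t \<otimes> m" using n by (auto simp: r_coset_def)
  have cl: "t \<in> carrier G" "m \<in> carrier G" using t m torus_carrier N_carrier by auto
  have "t' \<otimes> m \<in> torus #> n" if t': "t' \<in> torus" for t'
  proof -
    have "t' \<otimes> m = (t' \<otimes> inv t) \<otimes> n" using t' torus_carrier t cl by (simp add: m_assoc [symmetric]) (simp add: m_assoc)
    then show ?thesis using t' t torus_closed by (auto simp: r_coset_def)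
  qed
  moreover have "t' \<otimes> n \<in> w" if t': "t' \<in> torus" for t'
  proof -
    have "t' \<otimes> n = (t' \<otimes> t) \<otimes> m" using t' torus_carrier t cl by (simp add: m_assoc)
    then show ?thesis using t' t m torus_closed by (auto simp: r_coset_def)
  qed
  ultimately show ?thesis using m by (auto simp: r_coset_def)
qed

lemma W_eqI: "w \<in> carrier W \<Longrightarrow> v \<in> carrier W \<Longrightarrow> n \<in> w \<Longrightarrow> n \<in> v \<Longrightarrow> w = v"
  using W_eq_class by metis

lemma W_diff_left:
  assumes "w \<in> carrier W" "n \<in> w" "n' \<in> w"
  obtains t where "t \<in> torus" "n' = t \<otimes> n"
  using W_eq_class [OF assms(1,2)] assms(3) by (auto simp: r_coset_def)

lemma W_diff_right:
  assumes "w \<in> carrier W" "n \<in> w" "n' \<in> w"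
  obtains t where "t \<in> torus" "n' = n \<otimes> t"
proof -
  obtain t where t: "t \<in> torus" "n' = t \<otimes> n" by (rule W_diff_left [OF assms])
  have n: "n \<in> N" "n \<in> carrier G" using W_N W_carrier assms by auto
  have "n \<otimes> (inv n \<otimes> t \<otimes> n) = n'" using t n torus_carrier by (simp add: m_assoc [symmetric])
  then show thesis using that torus_conj(2) [OF n(1) t(1)] by metis
qed

lemma W_torus_right: "w \<in> carrier W \<Longrightarrow> n \<in> w \<Longrightarrow> t \<in> torus \<Longrightarrow> n \<otimes> t \<in> w"
proof -
  assume a: "w \<in> carrier W" "n \<in> w" "t \<in> torus"
  then have n: "n \<in> N" "n \<in> carrier G" using W_N W_carrier by auto
  have "n \<otimes> t = (n \<otimes> t \<otimes> inv n) \<otimes> n" using n a torus_carrier by (simp add: m_assoc)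
  moreover have "(n \<otimes> t \<otimes> inv n) \<otimes> n \<in> torus #> n"
    using torus_conj(1) [OF n(1) a(3)] by (auto simp: r_coset_def)
  ultimately show ?thesis using W_eq_class a by metis
qed

lemma mult_mem: "m \<in> v \<Longrightarrow> n \<in> w \<Longrightarrow> m \<otimes> n \<in> v \<otimes>\<^bsub>W\<^esub> w"
  by (auto simp: W_mult set_mult_def)

lemma inv_mem:
  assumes "w \<in> carrier W" "n \<in> w"
  shows "inv n \<in> inv\<^bsub>W\<^esub> w"
proof -
  interpret W: group W by (rule group_W)
  have n: "n \<in> N" "n \<in> carrier G" using W_N W_carrier assms by auto
  let ?v = "torus #> inv n"
  have v: "?v \<in> carrier W" "inv n \<in> ?v" using class_W mem_class n N_closed by auto
  have "inv n \<otimes> n \<in> ?v \<otimes>\<^bsub>W\<^esub> w" by (rule mult_mem [OF v(2) assms(2)])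
  then have "?v \<otimes>\<^bsub>W\<^esub> w = \<one>\<^bsub>W\<^esub>"
    using n assms v torus_closed W.one_closed
    by (intro W_eqI [of _ _ \<one>] W.m_closed) (auto simp: W_one)
  then show ?thesis using v assms W.inv_equality by metis
qed

lemma W_finite: "finite (carrier W)"
proof -
  have "carrier W \<subseteq> (\<lambda>n. torus #> n) ` N" using W_cases by blast
  moreover have "finite N" using finite_carrier subgroup.subset [OF subgroup_N] finite_subset by blast
  ultimately show ?thesis using finite_subset by blast
qed

section \<open>Double cosets of the Borel subgroup\<close>

lemma mem_dc: "x \<in> dc w \<longleftrightarrow> (\<exists>b\<in>B. \<exists>n\<in>w. \<exists>b'\<in>B. x = b \<otimes> n \<otimes> b')"
  by (auto simp: dc_def set_mult_def)

lemma dc_carrier: "w \<in> carrier W \<Longrightarrow> x \<in> dc w \<Longrightarrow> x \<in> carrier G"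
  by (auto simp: mem_dc B_carrier W_carrier)

lemma dc_rep:
  assumes w: "w \<in> carrier W" and n: "n \<in> w" and x: "x \<in> dc w"
  obtains b b' where "b \<in> B" "b' \<in> B" "x = b \<otimes> n \<otimes> b'"
proof -
  obtain b n' b' where 1: "b \<in> B" "n' \<in> w" "b' \<in> B" "x = b \<otimes> n' \<otimes> b'" using x by (auto simp: mem_dc)
  obtain t where t: "t \<in> torus" "n' = t \<otimes> n" by (rule W_diff_left [OF w n 1(2)])
  have "x = (b \<otimes> t) \<otimes> n \<otimes> b'"
    using 1 t B_carrier torus_carrier W_carrier [OF w n] by (simp add: m_assoc)
  then show thesis using that [of "b \<otimes> t" b'] 1 t B_closed torus_B by auto
qed

lemma W_dc: "w \<in> carrier W \<Longrightarrow> n \<in> w \<Longrightarrow> n \<in> dc w"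
  using B_closed(3) W_carrier by (force simp: mem_dc)

lemma dc_mult_left:
  assumes "w \<in> carrier W" "b \<in> B" "x \<in> dc w"
  shows "b \<otimes> x \<in> dc w"
proof -
  obtain c n c' where 1: "c \<in> B" "n \<in> w" "c' \<in> B" "x = c \<otimes> n \<otimes> c'" using assms by (auto simp: mem_dc)
  then have "b \<otimes> x = (b \<otimes> c) \<otimes> n \<otimes> c'"
    using assms B_carrier W_carrier by (simp add: m_assoc)
  then show ?thesis using 1 assms B_closed(1) [of b c] unfolding mem_dc by blast
qed

lemma dc_mult_right:
  assumes "w \<in> carrier W" "b \<in> B" "x \<in> dc w"
  shows "x \<otimes> b \<in> dc w"
proof -
  obtain c n c' where 1: "c \<in> B" "n \<in> w" "c' \<in> B" "x = c \<otimes> n \<otimes> c'" using assms by (auto simp: mem_dc)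
  then have "x \<otimes> b = c \<otimes> n \<otimes> (c' \<otimes> b)"
    using assms B_carrier W_carrier by (simp add: m_assoc)
  then show ?thesis using 1 assms B_closed(1) [of c' b] unfolding mem_dc by blast
qed

lemma dc_inv:
  assumes "w \<in> carrier W" "x \<in> dc w"
  shows "inv x \<in> dc (inv\<^bsub>W\<^esub> w)"
proof -
  obtain c n c' where 1: "c \<in> B" "n \<in> w" "c' \<in> B" "x = c \<otimes> n \<otimes> c'" using assms by (auto simp: mem_dc)
  then have "inv x = inv c' \<otimes> inv n \<otimes> inv c"
    using assms B_carrier W_carrier by (simp add: m_assoc inv_mult_group)
  then show ?thesis using 1 inv_mem [OF assms(1) 1(2)] B_closed(2) unfolding mem_dc by blast
qed

lemma dc_sub:
  assumes w: "w \<in> carrier W" and v: "v \<in> carrier W" and x: "x \<in> dc w" "x \<in> dc v" and y: "y \<in> dc w"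
  shows "y \<in> dc v"
proof -
  obtain n where n: "n \<in> w" using W_nonempty w by blast
  obtain b c where x1: "b \<in> B" "c \<in> B" "x = b \<otimes> n \<otimes> c" by (rule dc_rep [OF w n x(1)])
  obtain b' c' where y1: "b' \<in> B" "c' \<in> B" "y = b' \<otimes> n \<otimes> c'" by (rule dc_rep [OF w n y])
  have cl: "b \<in> carrier G" "c \<in> carrier G" "b' \<in> carrier G" "c' \<in> carrier G" "n \<in> carrier G"
    using x1 y1 B_carrier W_carrier [OF w n] by auto
  have "b \<otimes> n = x \<otimes> inv c" using x1 cl by (simp add: m_assoc)
  then have "n = inv b \<otimes> (x \<otimes> inv c)" using cl dc_carrier [OF w x(1)] by (metis inv_solve_left m_closed inv_closed)
  then have "y = (b' \<otimes> inv b) \<otimes> (x \<otimes> (inv c \<otimes> c'))"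
    using y1 cl dc_carrier [OF w x(1)] by (simp add: m_assoc)
  then show ?thesis using x1 y1 B_closed x v dc_mult_left dc_mult_right by auto
qed

lemma dc_eq: "w \<in> carrier W \<Longrightarrow> v \<in> carrier W \<Longrightarrow> x \<in> dc w \<Longrightarrow> x \<in> dc v \<Longrightarrow> dc w = dc v"
  using dc_sub by blast

lemma exch:
  assumes s: "s \<in> S" "\<rho> \<in> s" and w: "w \<in> carrier W" and x: "x \<in> dc w"
  shows "\<rho> \<otimes> x \<in> dc w \<or> \<rho> \<otimes> x \<in> dc (s \<otimes>\<^bsub>W\<^esub> w)"
proof -
  interpret W: group W by (rule group_W)
  have sW: "s \<in> carrier W" using s S_subset by blast
  obtain c n c' where 1: "c \<in> B" "n \<in> w" "c' \<in> B" "x = c \<otimes> n \<otimes> c'" using x by (auto simp: mem_dc)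
  have "\<rho> \<otimes> c \<otimes> n \<in> s <#> B <#> w" using s 1 by (auto simp: set_mult_def)
  then have "\<rho> \<otimes> c \<otimes> n \<in> dc w \<or> \<rho> \<otimes> c \<otimes> n \<in> dc (s \<otimes>\<^bsub>W\<^esub> w)"
    using BN_exchange [OF s(1) w] by (auto simp: dc_def)
  moreover have "\<rho> \<otimes> x = \<rho> \<otimes> c \<otimes> n \<otimes> c'"
    using 1 W_carrier [OF sW s(2)] W_carrier [OF w 1(2)] B_carrier by (simp add: m_assoc)
  ultimately show ?thesis using dc_mult_right 1(3) w sW by auto
qed

lemma gen_inv: "s \<in> S \<Longrightarrow> inv\<^bsub>W\<^esub> s = s"
proof -
  interpret W: group W by (rule group_W)
  assume "s \<in> S"
  then show "inv\<^bsub>W\<^esub> s = s" using S_involution [of s] S_subset by (intro W.inv_equality) auto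
qed

lemma exch_right:
  assumes s: "s \<in> S" "\<rho> \<in> s" and w: "w \<in> carrier W" and x: "x \<in> dc w"
  shows "x \<otimes> \<rho> \<in> dc w \<or> x \<otimes> \<rho> \<in> dc (w \<otimes>\<^bsub>W\<^esub> s)"
proof -
  interpret W: group W by (rule group_W)
  have sW: "s \<in> carrier W" using s S_subset by blast
  have cl: "\<rho> \<in> carrier G" "x \<in> carrier G" using W_carrier [OF sW s(2)] dc_carrier [OF w x] by auto
  have "inv \<rho> \<in> s" using inv_mem [OF sW s(2)] gen_inv [OF s(1)] by simp
  then have "inv \<rho> \<otimes> inv x \<in> dc (inv\<^bsub>W\<^esub> w) \<or> inv \<rho> \<otimes> inv x \<in> dc (s \<otimes>\<^bsub>W\<^esub> inv\<^bsub>W\<^esub> w)"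
    using exch [OF s(1) _ _ dc_inv [OF w x]] w by auto
  moreover have "inv \<rho> \<otimes> inv x = inv (x \<otimes> \<rho>)" using cl by (simp add: inv_mult_group)
  ultimately have "inv (x \<otimes> \<rho>) \<in> dc (inv\<^bsub>W\<^esub> w) \<or> inv (x \<otimes> \<rho>) \<in> dc (s \<otimes>\<^bsub>W\<^esub> inv\<^bsub>W\<^esub> w)"
    by simp
  then show ?thesis
  proof
    assume "inv (x \<otimes> \<rho>) \<in> dc (inv\<^bsub>W\<^esub> w)"
    then show ?thesis using dc_inv [of "inv\<^bsub>W\<^esub> w" "inv (x \<otimes> \<rho>)"] w cl by simp
  next
    assume "inv (x \<otimes> \<rho>) \<in> dc (s \<otimes>\<^bsub>W\<^esub> inv\<^bsub>W\<^esub> w)"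
    then show ?thesis
      using dc_inv [of "s \<otimes>\<^bsub>W\<^esub> inv\<^bsub>W\<^esub> w" "inv (x \<otimes> \<rho>)"] w sW cl
      by (simp add: W.inv_mult_group gen_inv s)
  qed
qed

lemma dc_one: "dc \<one>\<^bsub>W\<^esub> = B"
proof
  show "dc \<one>\<^bsub>W\<^esub> \<subseteq> B" by (auto simp: mem_dc W_one torus_B B_closed)
  show "B \<subseteq> dc \<one>\<^bsub>W\<^esub>"
    using B_closed(3) torus_closed(3) B_carrier by (force simp: mem_dc W_one)
qed

section \<open>The Weyl group of a BN-pair as a Coxeter group\<close>

lemma involution_generated_W: "involution_generated W S"
proof -
  interpret W: group W by (rule group_W)
  show ?thesis by unfold_locales (use S_subset S_involution S_generates in auto)
qed

text \<open>Induction on the smaller length. Write \<open>w = s w'\<close> with \<open>w'\<close>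
  shorter. By the exchange axiom the double coset of \<open>w'\<close> is that of \<open>v\<close>
  or of \<open>s v\<close>. The first would give \<open>v = w'\<close>, too short; the second gives
  \<open>w' = s v\<close>.\<close>

lemma dc_inject:
  assumes "w \<in> carrier W" "v \<in> carrier W" "x \<in> dc w" "x \<in> dc v"
  shows "w = v"
proof -
  interpret I: involution_generated W S by (rule involution_generated_W)
  have "w = v" if "w \<in> carrier W" "v \<in> carrier W" "I.len w \<le> I.len v" "dc w = dc v" for w v
    using that
  proof (induction "I.len w" arbitrary: w v)
    case 0
    then have w: "w = \<one>\<^bsub>W\<^esub>" using I.len_zero [of w] by simp
    obtain n where n: "n \<in> v" using W_nonempty 0 by blast
    then have "n \<in> B" using W_dc [of v n] 0 w dc_one by auto
    then have "n \<in> torus" using W_N [of v n] n 0 by (auto simp: torus_def)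
    then show ?case using W_eqI [of w v n] 0 n w by (simp add: W_one)
  next
    case (Suc k)
    have "set (I.reduced_word w) \<subseteq> S" "length (I.reduced_word w) = Suc k"
      "I.word_prod (I.reduced_word w) = w"
      using I.reduced_word [OF Suc.prems(1)] Suc.hyps by auto
    then obtain s ws where ws: "s \<in> S" "set ws \<subseteq> S" "length ws = k" "w = s \<otimes>\<^bsub>W\<^esub> I.word_prod ws"
      by (cases "I.reduced_word w") auto
    define w' where "w' = I.word_prod ws"
    have w': "w' \<in> carrier W" "w = s \<otimes>\<^bsub>W\<^esub> w'" using ws by (auto simp: w'_def)
    have "I.len w' \<le> k" using I.len_word_le [OF ws(2)] ws by (simp add: w'_def)
    moreover have "I.len w \<le> Suc (I.len w')" using I.len_gen_mult_le [OF ws(1) w'(1)] w' by simp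
    ultimately have lw': "I.len w' = k" using Suc.hyps by simp
    have sW: "s \<in> carrier W" using ws S_subset by blast
    obtain \<rho> where \<rho>1: "\<rho> \<in> s" using W_nonempty [OF sW] by blast
    obtain n where n: "n \<in> w'" using W_nonempty [OF w'(1)] by blast
    note \<rho> = \<rho>1 n
    have cl: "\<rho> \<in> carrier G" "n \<in> carrier G" using W_carrier \<rho> sW w' by auto
    have "\<rho> \<otimes> n \<in> dc w" using W_dc [OF Suc.prems(1)] mult_mem \<rho> w' by auto
    then have "\<rho> \<otimes> n \<in> dc v" using Suc.prems by simp
    moreover have "inv \<rho> \<in> s" using inv_mem [OF sW \<rho>(1)] gen_inv ws by simp
    ultimately have "inv \<rho> \<otimes> (\<rho> \<otimes> n) \<in> dc v \<or> inv \<rho> \<otimes> (\<rho> \<otimes> n) \<in> dc (s \<otimes>\<^bsub>W\<^esub> v)"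
      using exch ws Suc.prems by blast
    moreover have "inv \<rho> \<otimes> (\<rho> \<otimes> n) = n" using cl by (simp add: m_assoc [symmetric])
    ultimately consider "n \<in> dc v" | "n \<in> dc (s \<otimes>\<^bsub>W\<^esub> v)" by auto
    then show ?case
    proof cases
      case 1
      then have "dc w' = dc v" using dc_eq W_dc \<rho> w' Suc.prems by blast
      then have "w' = v" using Suc.hyps(1) [of w' v] lw' w' Suc.prems Suc.hyps(2) by simp
      then show ?thesis using lw' Suc by simp
    next
      case 2
      then have "dc w' = dc (s \<otimes>\<^bsub>W\<^esub> v)" using dc_eq W_dc \<rho> w' sW Suc.prems by blast
      moreover have "I.len w' \<le> I.len (s \<otimes>\<^bsub>W\<^esub> v)"
        using I.len_le_gen_mult [OF ws(1), of v] Suc.prems lw' Suc.hyps(2) by simp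
      ultimately have "w' = s \<otimes>\<^bsub>W\<^esub> v"
        using Suc.hyps(1) [of w' "s \<otimes>\<^bsub>W\<^esub> v"] lw' w' Suc.prems sW by simp
      then show ?thesis using w' ws Suc.prems by simp
    qed
  qed
  moreover have "dc w = dc v" using dc_eq assms by blast
  ultimately show ?thesis using assms by (metis linear)
qed

text \<open>The elements that \<open>s\<close> lengthens, described by double cosets because the
  length comparison is not yet available; \<open>half_len\<close> identifies the two descriptions
  afterwards.\<close>

definition half :: "'a set \<Rightarrow> 'a set set" where
  "half s = {w \<in> carrier W. s <#> B <#> w \<subseteq> dc (s \<otimes>\<^bsub>W\<^esub> w)}"

lemma half_mem:
  assumes "s \<in> S" "w \<in> half s" "\<rho> \<in> s" "x \<in> dc w"
  shows "\<rho> \<otimes> x \<in> dc (s \<otimes>\<^bsub>W\<^esub> w)"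
proof -
  interpret W: group W by (rule group_W)
  have w: "w \<in> carrier W" and sW: "s \<in> carrier W" using assms S_subset by (auto simp: half_def)
  obtain c n c' where 1: "c \<in> B" "n \<in> w" "c' \<in> B" "x = c \<otimes> n \<otimes> c'" using assms(4) by (auto simp: mem_dc)
  have "\<rho> \<otimes> c \<otimes> n \<in> s <#> B <#> w" using assms 1 by (auto simp: set_mult_def)
  then have "\<rho> \<otimes> c \<otimes> n \<in> dc (s \<otimes>\<^bsub>W\<^esub> w)" using assms(2) by (auto simp: half_def)
  moreover have "\<rho> \<otimes> x = \<rho> \<otimes> c \<otimes> n \<otimes> c'"
    using 1 W_carrier [OF sW assms(3)] W_carrier [OF w 1(2)] B_carrier by (simp add: m_assoc)
  ultimately show ?thesis using dc_mult_right 1(3) w sW by auto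
qed

lemma not_half:
  assumes "s \<in> S" "w \<in> carrier W" "w \<notin> half s"
  obtains \<rho> b n where "\<rho> \<in> s" "b \<in> B" "n \<in> w" "\<rho> \<otimes> b \<otimes> n \<in> dc w"
proof -
  obtain y where y: "y \<in> s <#> B <#> w" "y \<notin> dc (s \<otimes>\<^bsub>W\<^esub> w)" using assms by (auto simp: half_def)
  then have "y \<in> dc w" using BN_exchange [OF assms(1,2)] by (auto simp: dc_def)
  moreover obtain \<rho> b n where "\<rho> \<in> s" "b \<in> B" "n \<in> w" "y = \<rho> \<otimes> b \<otimes> n"
    using y(1) by (auto simp: set_mult_def)
  ultimately show thesis using that by blast
qed

text \<open>Thickness provides an element \<open>y\<close> of \<open>sBs\<close> outside
  \<open>B\<close>, hence in \<open>BsB\<close>. If both \<open>w\<close> and \<open>s w\<close> lay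
  in \<open>half s\<close>, then for \<open>n\<close> in \<open>w\<close> the element
  \<open>y n\<close> would be in \<open>BwB\<close>, through two factors from \<open>s\<close>, and
  in \<open>BswB\<close>, through one, forcing \<open>s w = w\<close>.\<close>

lemma half_disjoint:
  assumes s: "s \<in> S" and w: "w \<in> carrier W" "w \<in> half s"
  shows "s \<otimes>\<^bsub>W\<^esub> w \<notin> half s"
proof
  interpret I: involution_generated W S by (rule involution_generated_W)
  assume h: "s \<otimes>\<^bsub>W\<^esub> w \<in> half s"
  have sW: "s \<in> carrier W" using s S_subset by blast
  obtain \<rho> where \<rho>: "\<rho> \<in> s" using W_nonempty sW by blast
  have \<rho>c: "\<rho> \<in> carrier G" using W_carrier sW \<rho> by blast
  have "\<exists>\<rho>1\<in>s. \<exists>b\<in>B. \<exists>\<rho>2\<in>s. \<rho>1 \<otimes> b \<otimes> \<rho>2 \<notin> B"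
  proof (rule ccontr)
    assume "\<not> ?thesis"
    then have sub: "\<rho>1 \<otimes> b \<otimes> \<rho>2 \<in> B" if "\<rho>1 \<in> s" "b \<in> B" "\<rho>2 \<in> s" for \<rho>1 b \<rho>2
      using that by blast
    have "B \<subseteq> s <#> B <#> s"
    proof
      fix b assume b: "b \<in> B"
      have i: "inv \<rho> \<in> s" using inv_mem [OF sW \<rho>] gen_inv s by simp
      have "inv \<rho> \<otimes> b \<otimes> inv \<rho> \<in> B" using sub i b by blast
      moreover have "b = \<rho> \<otimes> (inv \<rho> \<otimes> b \<otimes> inv \<rho>) \<otimes> \<rho>"
        using \<rho>c b B_carrier by (simp add: m_assoc) (simp add: m_assoc [symmetric])
      ultimately show "b \<in> s <#> B <#> s" using \<rho> unfolding set_mult_def by blast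
    qed
    moreover have "s <#> B <#> s \<subseteq> B" using sub by (auto simp: set_mult_def)
    ultimately show False using BN_thick [OF s] by blast
  qed
  then obtain \<rho>1 b \<rho>2 where x: "\<rho>1 \<in> s" "b \<in> B" "\<rho>2 \<in> s" "\<rho>1 \<otimes> b \<otimes> \<rho>2 \<notin> B"
    by blast
  define y where "y = \<rho>1 \<otimes> b \<otimes> \<rho>2"
  have "\<rho>2 \<in> dc s" using W_dc sW x by blast
  then have "b \<otimes> \<rho>2 \<in> dc s" using dc_mult_left sW x by blast
  then have "\<rho>1 \<otimes> (b \<otimes> \<rho>2) \<in> dc s \<or> \<rho>1 \<otimes> (b \<otimes> \<rho>2) \<in> dc (s \<otimes>\<^bsub>W\<^esub> s)"
    using exch s x sW by blast
  moreover have "s \<otimes>\<^bsub>W\<^esub> s = \<one>\<^bsub>W\<^esub>" using S_involution s by blast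
  moreover have xc: "\<rho>1 \<in> carrier G" "b \<in> carrier G" "\<rho>2 \<in> carrier G"
    using x W_carrier sW B_carrier by auto
  then have y2: "y = \<rho>1 \<otimes> (b \<otimes> \<rho>2)" by (simp add: y_def m_assoc)
  ultimately have ys: "y \<in> dc s" using x(4) dc_one by (auto simp: y_def)
  obtain n where n: "n \<in> w" using W_nonempty w by blast
  have nc: "n \<in> carrier G" using W_carrier w n by blast
  have "\<rho>2 \<otimes> n \<in> dc (s \<otimes>\<^bsub>W\<^esub> w)" using half_mem [OF s w(2) x(3)] W_dc w n by blast
  then have "b \<otimes> (\<rho>2 \<otimes> n) \<in> dc (s \<otimes>\<^bsub>W\<^esub> w)" using dc_mult_left x sW w by auto
  then have "\<rho>1 \<otimes> (b \<otimes> (\<rho>2 \<otimes> n)) \<in> dc (s \<otimes>\<^bsub>W\<^esub> (s \<otimes>\<^bsub>W\<^esub> w))" using half_mem [OF s h x(1)] by blast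
  moreover have "s \<otimes>\<^bsub>W\<^esub> (s \<otimes>\<^bsub>W\<^esub> w) = w" using s w by simp
  moreover have "\<rho>1 \<otimes> (b \<otimes> (\<rho>2 \<otimes> n)) = y \<otimes> n" using xc nc by (simp add: y_def m_assoc)
  ultimately have 1: "y \<otimes> n \<in> dc w" by simp
  obtain c c' where c: "c \<in> B" "c' \<in> B" "y = c \<otimes> \<rho> \<otimes> c'" by (rule dc_rep [OF sW \<rho> ys])
  have "c' \<otimes> n \<in> dc w" using dc_mult_left W_dc w n c by blast
  then have "c \<otimes> (\<rho> \<otimes> (c' \<otimes> n)) \<in> dc (s \<otimes>\<^bsub>W\<^esub> w)"
    using half_mem [OF s w(2) \<rho>] dc_mult_left c sW w by auto
  moreover have "c \<otimes> (\<rho> \<otimes> (c' \<otimes> n)) = y \<otimes> n" using c B_carrier \<rho>c nc by (simp add: m_assoc)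
  ultimately have "y \<otimes> n \<in> dc (s \<otimes>\<^bsub>W\<^esub> w)" by simp
  then have "s \<otimes>\<^bsub>W\<^esub> w = w" using 1 dc_inject w sW by blast
  then have "s = \<one>\<^bsub>W\<^esub>" using w sW by (metis I.r_cancel_one)
  then show False using S_involution s by blast
qed

text \<open>If \<open>w r\<close> is not in \<open>half s\<close>, some element of
  \<open>sBwr\<close> lies in \<open>BwrB\<close>. Multiplied on the right by a representative of
  \<open>r\<close> it lies in \<open>BswB\<close>, and also in \<open>BwrB\<close> or
  \<open>BwB\<close>, so disjointness of double cosets leaves only \<open>s w = w r\<close>.\<close>

lemma half_fold:
  assumes s: "s \<in> S" and w: "w \<in> half s" and r: "r \<in> S" and n: "w \<otimes>\<^bsub>W\<^esub> r \<notin> half s"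
  shows "s \<otimes>\<^bsub>W\<^esub> w = w \<otimes>\<^bsub>W\<^esub> r"
proof -
  interpret I: involution_generated W S by (rule involution_generated_W)
  have wW: "w \<in> carrier W" and sW: "s \<in> carrier W" and rW: "r \<in> carrier W"
    using w s r S_subset by (auto simp: half_def)
  obtain \<rho> b m where \<rho>: "\<rho> \<in> s" "b \<in> B" "m \<in> w \<otimes>\<^bsub>W\<^esub> r" "\<rho> \<otimes> b \<otimes> m \<in> dc (w \<otimes>\<^bsub>W\<^esub> r)"
    using not_half [OF s _ n] wW rW by blast
  obtain k l where kl: "k \<in> w" "l \<in> r" "m = k \<otimes> l" using \<rho>(3) by (auto simp: W_mult set_mult_def)
  have cl: "\<rho> \<in> carrier G" "b \<in> carrier G" "k \<in> carrier G" "l \<in> carrier G"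
    using \<rho> kl W_carrier B_carrier wW sW rW by auto
  have li: "inv l \<in> r" using inv_mem [OF rW kl(2)] gen_inv r by simp
  have "b \<otimes> k \<in> dc w" using dc_mult_left W_dc wW \<rho> kl by blast
  then have z: "\<rho> \<otimes> (b \<otimes> k) \<in> dc (s \<otimes>\<^bsub>W\<^esub> w)" by (rule half_mem [OF s w \<rho>(1)])
  have "\<rho> \<otimes> b \<otimes> m \<otimes> inv l \<in> dc (w \<otimes>\<^bsub>W\<^esub> r) \<or> \<rho> \<otimes> b \<otimes> m \<otimes> inv l \<in> dc (w \<otimes>\<^bsub>W\<^esub> r \<otimes>\<^bsub>W\<^esub> r)"
    using exch_right [OF r li _ \<rho>(4)] wW rW by auto
  moreover have "\<rho> \<otimes> b \<otimes> m \<otimes> inv l = \<rho> \<otimes> (b \<otimes> k)" using kl cl by (simp add: m_assoc)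
  moreover have "w \<otimes>\<^bsub>W\<^esub> r \<otimes>\<^bsub>W\<^esub> r = w" using wW r by simp
  ultimately have "s \<otimes>\<^bsub>W\<^esub> w = w \<otimes>\<^bsub>W\<^esub> r \<or> s \<otimes>\<^bsub>W\<^esub> w = w"
    using z dc_inject wW sW rW by (metis I.m_closed)
  moreover have "s \<otimes>\<^bsub>W\<^esub> w \<noteq> w"
  proof
    assume "s \<otimes>\<^bsub>W\<^esub> w = w"
    then have "s = \<one>\<^bsub>W\<^esub>" using wW sW by (metis I.r_cancel_one)
    then show False using S_involution s by blast
  qed
  ultimately show ?thesis by blast
qed

lemma one_half: "s \<in> S \<Longrightarrow> \<one>\<^bsub>W\<^esub> \<in> half s"
proof -
  interpret W: group W by (rule group_W)
  assume s: "s \<in> S"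
  then have sW: "s \<in> carrier W" using S_subset by blast
  have "s <#> B <#> \<one>\<^bsub>W\<^esub> \<subseteq> dc s"
  proof
    fix x assume "x \<in> s <#> B <#> \<one>\<^bsub>W\<^esub>"
    then obtain \<rho> b t where 1: "\<rho> \<in> s" "b \<in> B" "t \<in> torus" "x = \<rho> \<otimes> b \<otimes> t"
      by (auto simp: set_mult_def W_one)
    then show "x \<in> dc s" using dc_mult_right [OF sW] W_dc [OF sW] torus_B by auto
  qed
  then show ?thesis using sW by (simp add: half_def)
qed

lemma finite_coxeter_group_W: "finite_coxeter_group W S"
proof -
  interpret I: involution_generated W S by (rule involution_generated_W)
  interpret coxeter_group W S
  proof (rule I.coxeter_groupI [where P = half])
    show "finite S" using W_finite S_subset finite_subset by blast
  qed (use one_half half_disjoint half_fold in auto)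
  show ?thesis by unfold_locales (rule W_finite)
qed

lemma half_len:
  assumes "s \<in> S" "w \<in> carrier W"
  shows "w \<in> half s \<longleftrightarrow> coxeter_data.len W S w < coxeter_data.len W S (s \<otimes>\<^bsub>W\<^esub> w)"
proof -
  interpret I: involution_generated W S by (rule involution_generated_W)
  have "(w \<in> half s \<longrightarrow> I.len w < I.len (s \<otimes>\<^bsub>W\<^esub> w)) \<and> (w \<notin> half s \<longrightarrow> I.len (s \<otimes>\<^bsub>W\<^esub> w) < I.len w)"
    by (rule I.halfspace_len) (use assms one_half half_disjoint half_fold in auto)
  then show ?thesis by auto
qed

end

context lie_type_group
begin

text \<open>For a left descent \<open>s\<close> of the element in question, failure of the
  half-space condition gives an equation that solves a representative of \<open>s\<close> as a
  product of elements of \<open>B\<close> and of a conjugate of an element of \<open>B\<close>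
  assumed to lie in \<open>Q\<close>. So \<open>s\<close> is contained in \<open>Q\<close>, and the
  shorter element inherits the hypothesis.\<close>

lemma subgroup_support:
  assumes Q: "subgroup Q G" "B \<subseteq> Q" and w: "w \<in> carrier W"
    and conj: "\<And>n b. n \<in> w \<Longrightarrow> b \<in> B \<Longrightarrow> n \<otimes> b \<otimes> inv n \<in> Q"
  shows "w \<subseteq> Q"
proof -
  interpret I: finite_coxeter_group W S by (rule finite_coxeter_group_W)
  have Qc: "x \<in> Q \<Longrightarrow> x \<in> carrier G" for x using subgroup.subset [OF Q(1)] by blast
  note Qm = subgroup.m_closed [OF Q(1)] subgroup.m_inv_closed [OF Q(1)]
  show ?thesis
    using w conj
  proof (induction rule: I.coxeter_induct)
    case one
    then show ?case using Q(2) torus_B by (auto simp: W_one)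
  next
    case (gen s w)
    have sW: "s \<in> carrier W" using gen S_subset by blast
    have "s \<otimes>\<^bsub>W\<^esub> w \<notin> half s" using half_len [of s "s \<otimes>\<^bsub>W\<^esub> w"] gen sW by simp
    then obtain \<rho> b m where 1: "\<rho> \<in> s" "b \<in> B" "m \<in> s \<otimes>\<^bsub>W\<^esub> w" "\<rho> \<otimes> b \<otimes> m \<in> dc (s \<otimes>\<^bsub>W\<^esub> w)"
      using not_half [OF gen(1), of "s \<otimes>\<^bsub>W\<^esub> w"] gen sW by blast
    have swW: "s \<otimes>\<^bsub>W\<^esub> w \<in> carrier W" using gen sW by simp
    obtain c c' where c: "c \<in> B" "c' \<in> B" "\<rho> \<otimes> b \<otimes> m = c \<otimes> m \<otimes> c'"
      by (rule dc_rep [OF swW 1(3,4)])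
    have cl: "\<rho> \<in> carrier G" "b \<in> carrier G" "m \<in> carrier G" "c \<in> carrier G" "c' \<in> carrier G"
      using 1 c B_carrier W_carrier sW swW by auto
    have "\<rho> \<otimes> b \<otimes> m \<otimes> inv m \<otimes> inv b = c \<otimes> (m \<otimes> c' \<otimes> inv m) \<otimes> inv b"
      unfolding c(3) using cl by (simp add: m_assoc)
    then have "\<rho> = c \<otimes> (m \<otimes> c' \<otimes> inv m) \<otimes> inv b" using cl by (simp add: m_assoc)
    moreover have "m \<otimes> c' \<otimes> inv m \<in> Q" by (rule gen.prems [OF 1(3) c(2)])
    moreover have "c \<in> Q" "inv b \<in> Q" using Q(2) c(1) B_closed(2) [OF 1(2)] by auto
    ultimately have \<rho>Q: "\<rho> \<in> Q" using Qm(1) by simp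
    have sQ: "s \<subseteq> Q"
    proof
      fix \<rho>' assume "\<rho>' \<in> s"
      then obtain t where "t \<in> torus" "\<rho>' = t \<otimes> \<rho>" by (rule W_diff_left [OF sW 1(1)])
      then show "\<rho>' \<in> Q" using Qm(1) [OF _ \<rho>Q, of t] Q(2) torus_B by auto
    qed
    have "w \<subseteq> Q"
    proof (rule gen.IH)
      fix n d assume n: "n \<in> w" and d: "d \<in> B"
      have nc: "n \<in> carrier G" "d \<in> carrier G" using n d W_carrier gen B_carrier by auto
      have "\<rho> \<otimes> n \<otimes> d \<otimes> inv (\<rho> \<otimes> n) \<in> Q" by (rule gen.prems [OF mult_mem [OF 1(1) n] d])
      then have "inv \<rho> \<otimes> (\<rho> \<otimes> n \<otimes> d \<otimes> inv (\<rho> \<otimes> n)) \<otimes> \<rho> \<in> Q"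
        by (rule Qm(1) [OF Qm(1) [OF Qm(2) [OF \<rho>Q]] \<rho>Q])
      moreover have "inv \<rho> \<otimes> (\<rho> \<otimes> n \<otimes> d \<otimes> inv (\<rho> \<otimes> n)) \<otimes> \<rho> = n \<otimes> d \<otimes> inv n"
        using cl nc by (simp add: m_assoc inv_mult_group conj_cancel)
      ultimately show "n \<otimes> d \<otimes> inv n \<in> Q" by simp
    qed
    then show ?case using sQ Qm(1) by (auto simp: W_mult set_mult_def)
  qed
qed

lemma bruhat_decomposition:
  assumes "g \<in> carrier G"
  obtains w where "w \<in> carrier W" "g \<in> dc w"
proof -
  interpret I: finite_coxeter_group W S by (rule finite_coxeter_group_W)
  define X where "X = (\<Union>w\<in>carrier W. dc w)"
  have Xc: "X \<subseteq> carrier G" using dc_carrier by (auto simp: X_def)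
  have BX: "b \<otimes> x \<in> X" if "b \<in> B" "x \<in> X" for b x
    using that dc_mult_left by (auto simp: X_def)
  have WX: "w \<in> carrier W \<Longrightarrow> \<forall>n x. n \<in> w \<longrightarrow> x \<in> X \<longrightarrow> n \<otimes> x \<in> X" for w
  proof (induction rule: I.coxeter_induct)
    case one
    then show ?case using BX torus_B by (auto simp: W_one)
  next
    case (gen s w)
    have sW: "s \<in> carrier W" using gen S_subset by blast
    show ?case
    proof (intro allI impI)
      fix n x assume "n \<in> s \<otimes>\<^bsub>W\<^esub> w" and x: "x \<in> X"
      then obtain \<rho> m where m: "\<rho> \<in> s" "m \<in> w" "n = \<rho> \<otimes> m" by (auto simp: W_mult set_mult_def)
      have "m \<otimes> x \<in> X" using gen.IH m x by blast
      then obtain v where v: "v \<in> carrier W" "m \<otimes> x \<in> dc v" by (auto simp: X_def)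
      then have "\<rho> \<otimes> (m \<otimes> x) \<in> X" using exch [OF gen(1) m(1) v] sW by (auto simp: X_def)
      moreover have "n \<otimes> x = \<rho> \<otimes> (m \<otimes> x)"
        using m(3) x Xc W_carrier [OF sW m(1)] W_carrier [OF gen(2) m(2)] by (auto simp: m_assoc)
      ultimately show "n \<otimes> x \<in> X" by simp
    qed
  qed
  have NX: "n \<otimes> x \<in> X" if "n \<in> N" "x \<in> X" for n x
    using WX [OF class_W] mem_class that by blast
  have "g \<in> generate G (B \<union> N)" using assms generate_BN by simp
  then have "\<forall>x\<in>X. g \<otimes> x \<in> X"
  proof induction
    case one
    then show ?case using Xc by auto
  next
    case (incl h)
    then show ?case using BX NX by blast
  next
    case (inv h)
    then have "inv h \<in> B \<or> inv h \<in> N" using B_closed(2) N_closed(2) by auto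
    then show ?case using BX NX by blast
  next
    case (eng g h)
    have "g \<in> carrier G" "h \<in> carrier G"
      using eng(1,2) generate_BN by auto
    then show ?case using eng Xc by (auto simp: m_assoc subset_iff)
  qed
  moreover have "\<one> \<in> X"
    using W_dc [of "\<one>\<^bsub>W\<^esub>" \<one>] torus_closed by (force simp: X_def W_one [symmetric] I.one_closed [unfolded W_one])
  ultimately have "g \<otimes> \<one> \<in> X" by blast
  then show thesis using that assms by (auto simp: X_def)
qed

text \<open>Parabolic subgroups that are conjugate and contain a common Borel subgroup are equal. The Borel
  subgroup \<open>n\<^sub>0 B n\<^sub>0\<^sup>-\<^sup>1\<close> is \<open>B\<close> for \<open>P(e)\<close> and \<open>B\<^sup>-\<close> for \<open>P\<^sup>-(e)\<close>.\<close>

lemma conjugate_parabolic: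
  assumes Q: "subgroup Q G" and n0: "n0 \<in> w0" "w0 \<in> carrier W" and BQ: "conjugate n0 B \<subseteq> Q"
    and X: "subgroup X W" and g: "g \<in> carrier G"
    and eq: "Q = conjugate g (\<Union>w\<in>X. conjugate n0 B <#> w <#> conjugate n0 B)"
    and w: "w \<in> carrier W"
  shows "w \<subseteq> Q \<longleftrightarrow> w \<in> X"
proof -
  interpret I: finite_coxeter_group W S by (rule finite_coxeter_group_W)
  have n0N: "n0 \<in> N" "n0 \<in> carrier G" using W_N W_carrier n0 by auto
  have XW: "X \<subseteq> carrier W" using subgroup.subset [OF X] .
  \<comment> \<open>Reduction to \<open>B\<close> itself: with \<open>h = g \<otimes> n0\<close>,
    the group \<open>Q\<close> is the conjugate by \<open>h\<close> of the union \<open>P\<close> of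
    the double cosets \<open>BwB\<close> over the conjugate \<open>X'\<close> of
    \<open>X\<close>.\<close>
  define X' where "X' = (\<lambda>w. inv\<^bsub>W\<^esub> w0 \<otimes>\<^bsub>W\<^esub> w \<otimes>\<^bsub>W\<^esub> w0) ` X"
  have X'W: "X' \<subseteq> carrier W" using XW n0(2) by (auto simp: X'_def)
  define P where "P = (\<Union>w\<in>X'. dc w)"
  define h where "h = g \<otimes> n0"
  have h: "h \<in> carrier G" using g n0N by (simp add: h_def)
  have one: "\<one>\<^bsub>W\<^esub> \<in> X'"
    using subgroup.one_closed [OF X] n0(2) unfolding X'_def by (force simp: image_iff)
  have BP: "B \<subseteq> P" using one dc_one by (auto simp: P_def)
  have Pc: "P \<subseteq> carrier G" using dc_carrier X'W by (auto simp: P_def)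
  have PQ: "x \<in> P \<longleftrightarrow> h \<otimes> x \<otimes> inv h \<in> Q" if x: "x \<in> carrier G" for x
  proof -
    have simp1: "h \<otimes> x \<otimes> inv h = g \<otimes> (n0 \<otimes> x \<otimes> inv n0) \<otimes> inv g"
      using x g n0N by (simp add: h_def m_assoc inv_mult_group)
    show ?thesis
    proof
      assume "x \<in> P"
      then obtain v b n c where v: "v \<in> X" "b \<in> B" "c \<in> B"
        "n \<in> inv\<^bsub>W\<^esub> w0 \<otimes>\<^bsub>W\<^esub> v \<otimes>\<^bsub>W\<^esub> w0" "x = b \<otimes> n \<otimes> c"
        by (auto simp: P_def X'_def mem_dc)
      have vW: "v \<in> carrier W" using v XW by blast
      have nW: "n \<in> carrier G" using W_carrier [OF _ v(4)] n0(2) vW by simp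
      have "n0 \<otimes> n \<otimes> inv n0 \<in> w0 \<otimes>\<^bsub>W\<^esub> (inv\<^bsub>W\<^esub> w0 \<otimes>\<^bsub>W\<^esub> v \<otimes>\<^bsub>W\<^esub> w0) \<otimes>\<^bsub>W\<^esub> inv\<^bsub>W\<^esub> w0"
        by (intro mult_mem inv_mem n0 v(4))
      also have "\<dots> = v" using n0(2) vW by (simp add: I.m_assoc I.conj_cancel)
      finally have nv: "n0 \<otimes> n \<otimes> inv n0 \<in> v" .
      have "n0 \<otimes> x \<otimes> inv n0 =
          (n0 \<otimes> b \<otimes> inv n0) \<otimes> (n0 \<otimes> n \<otimes> inv n0) \<otimes> (n0 \<otimes> c \<otimes> inv n0)"
        using v B_carrier nW n0N by (simp add: m_assoc conj_cancel)
      then have "n0 \<otimes> x \<otimes> inv n0 \<in> conjugate n0 B <#> v <#> conjugate n0 B"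
        using v nv unfolding set_mult_def conjugate_def by blast
      then show "h \<otimes> x \<otimes> inv h \<in> Q"
        using v(1) unfolding eq conjugate_def [of g] simp1 by blast
    next
      assume "h \<otimes> x \<otimes> inv h \<in> Q"
      then obtain v y where v: "v \<in> X" "y \<in> conjugate n0 B <#> v <#> conjugate n0 B"
        "g \<otimes> (n0 \<otimes> x \<otimes> inv n0) \<otimes> inv g = g \<otimes> y \<otimes> inv g"
        unfolding eq conjugate_def [of g] simp1 by blast
      obtain b n c where b: "b \<in> B" "c \<in> B" "n \<in> v"
        "y = (n0 \<otimes> b \<otimes> inv n0) \<otimes> n \<otimes> (n0 \<otimes> c \<otimes> inv n0)"
        using v(2) unfolding set_mult_def conjugate_def by blast
      have vW: "v \<in> carrier W" using v XW by blast
      have cl: "n \<in> carrier G" "b \<in> carrier G" "c \<in> carrier G" using b W_carrier vW B_carrier by auto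
      then have y: "y \<in> carrier G" using b n0N by simp
      have "n0 \<otimes> x \<otimes> inv n0 = y" using v(3) y x g n0N by simp
      moreover have "x = inv n0 \<otimes> (n0 \<otimes> x \<otimes> inv n0) \<otimes> n0"
        using x n0N by (simp add: m_assoc conj_cancel)
      ultimately have "x = inv n0 \<otimes> y \<otimes> n0" by simp
      also have "\<dots> = b \<otimes> (inv n0 \<otimes> n \<otimes> n0) \<otimes> c"
        unfolding b(4) using cl n0N by (simp add: m_assoc conj_cancel)
      finally have "x = b \<otimes> (inv n0 \<otimes> n \<otimes> n0) \<otimes> c" .
      moreover have "inv n0 \<otimes> n \<otimes> n0 \<in> inv\<^bsub>W\<^esub> w0 \<otimes>\<^bsub>W\<^esub> v \<otimes>\<^bsub>W\<^esub> w0"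
        by (intro mult_mem inv_mem n0 b)
      ultimately have "x \<in> dc (inv\<^bsub>W\<^esub> w0 \<otimes>\<^bsub>W\<^esub> v \<otimes>\<^bsub>W\<^esub> w0)"
        unfolding mem_dc using b(1,2) by blast
      then show "x \<in> P" using v(1) unfolding P_def X'_def by blast
    qed
  qed
  have Psub: "subgroup P G"
  proof (rule finite_closed_subgroup [OF finite_carrier Pc])
    show "\<one> \<in> P" using BP B_closed by blast
    show "x \<otimes> y \<in> P" if xy: "x \<in> P" "y \<in> P" for x y
    proof -
      have cl: "x \<in> carrier G" "y \<in> carrier G" using xy Pc by auto
      have "(h \<otimes> x \<otimes> inv h) \<otimes> (h \<otimes> y \<otimes> inv h) \<in> Q"
        using PQ cl xy by (intro subgroup.m_closed [OF Q, of "h \<otimes> x \<otimes> inv h" "h \<otimes> y \<otimes> inv h"]) auto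
      moreover have "(h \<otimes> x \<otimes> inv h) \<otimes> (h \<otimes> y \<otimes> inv h) = h \<otimes> (x \<otimes> y) \<otimes> inv h"
        using cl h by (simp add: m_assoc conj_cancel)
      ultimately show ?thesis using PQ [of "x \<otimes> y"] cl by simp
    qed
  qed
  note Pm = subgroup.m_closed [OF Psub] subgroup.m_inv_closed [OF Psub]
  \<comment> \<open>Since \<open>Q\<close> contains the conjugate of \<open>B\<close> by
    \<open>n0\<close>, conjugation by the inverse of \<open>k\<close> sends \<open>B\<close> into
    \<open>P\<close>. With the Bruhat decomposition of \<open>k\<close>,
    \<open>subgroup_support\<close> then yields \<open>k\<close> in \<open>P\<close>, so that
    \<open>n0\<close> may replace \<open>h\<close>.\<close>
  define k where "k = inv n0 \<otimes> h"
  have k: "k \<in> carrier G" using h n0N by (simp add: k_def)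
  have conjk: "inv k \<otimes> b \<otimes> k \<in> P" if b: "b \<in> B" for b
  proof -
    have bc: "b \<in> carrier G" using b B_carrier by blast
    have "n0 \<otimes> b \<otimes> inv n0 \<in> Q" using BQ b by (auto simp: conjugate_def)
    moreover have "h \<otimes> (inv k \<otimes> b \<otimes> k) \<otimes> inv h = n0 \<otimes> b \<otimes> inv n0"
      using bc h n0N by (simp add: k_def m_assoc inv_mult_group) (simp add: m_assoc [symmetric])
    ultimately show ?thesis using PQ [of "inv k \<otimes> b \<otimes> k"] bc k by simp
  qed
  obtain v where v: "v \<in> carrier W" "k \<in> dc v" by (rule bruhat_decomposition [OF k])
  obtain m where m: "m \<in> v" using W_nonempty v by blast
  obtain b c where bc: "b \<in> B" "c \<in> B" "k = b \<otimes> m \<otimes> c" by (rule dc_rep [OF v(1) m v(2)])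
  have cl: "b \<in> carrier G" "m \<in> carrier G" "c \<in> carrier G" using bc m v W_carrier B_carrier by auto
  have "inv\<^bsub>W\<^esub> v \<subseteq> P"
  proof (rule subgroup_support [OF Psub BP])
    show "inv\<^bsub>W\<^esub> v \<in> carrier W" using v by simp
    fix n d assume n: "n \<in> inv\<^bsub>W\<^esub> v" and d: "d \<in> B"
    have "inv n \<in> v" using inv_mem [OF _ n] v by simp
    then obtain t where t: "t \<in> torus" "inv n = t \<otimes> m" by (rule W_diff_left [OF v(1) m])
    have tB: "t \<in> B" "t \<in> carrier G" using t torus_B torus_carrier by auto
    have nc: "n \<in> carrier G" using W_carrier [of "inv\<^bsub>W\<^esub> v"] v n by simp
    have n: "n = inv m \<otimes> inv t" using arg_cong [OF t(2), of "m_inv G"] nc cl tB by (simp add: inv_mult_group)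
    let ?d = "b \<otimes> (inv t \<otimes> d \<otimes> t) \<otimes> inv b"
    have dc: "d \<in> carrier G" using d B_carrier by blast
    have dB: "?d \<in> B" using bc d tB B_closed by auto
    have cP: "c \<in> P" using BP bc(2) by blast
    have "c \<otimes> (inv k \<otimes> ?d \<otimes> k) \<otimes> inv c \<in> P"
      by (rule Pm(1) [OF Pm(1) [OF cP conjk [OF dB]] Pm(2) [OF cP]])
    moreover have "c \<otimes> (inv k \<otimes> ?d \<otimes> k) \<otimes> inv c = n \<otimes> d \<otimes> inv n"
      unfolding bc(3) n using cl tB dc by (simp add: m_assoc inv_mult_group conj_cancel)
    ultimately show "n \<otimes> d \<otimes> inv n \<in> P" by simp
  qed
  then have "inv m \<in> P" using inv_mem [OF v(1) m] by blast
  then have "inv (inv m) \<in> P" by (rule Pm(2))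
  then have mP: "m \<in> P" using cl by simp
  have "b \<otimes> m \<otimes> c \<in> P" using bc BP mP by (intro Pm(1)) auto
  then have kP: "k \<in> P" using bc(3) by simp
  have QP: "n0 \<otimes> x \<otimes> inv n0 \<in> Q \<longleftrightarrow> x \<in> P" if x: "x \<in> carrier G" for x
  proof -
    have "h \<otimes> (inv k \<otimes> x \<otimes> k) \<otimes> inv h = n0 \<otimes> x \<otimes> inv n0"
      using x h n0N by (simp add: k_def m_assoc inv_mult_group) (simp add: m_assoc [symmetric])
    then have "n0 \<otimes> x \<otimes> inv n0 \<in> Q \<longleftrightarrow> inv k \<otimes> x \<otimes> k \<in> P"
      using PQ [of "inv k \<otimes> x \<otimes> k"] x k by simp
    also have "\<dots> \<longleftrightarrow> x \<in> P"
    proof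
      assume xk: "inv k \<otimes> x \<otimes> k \<in> P"
      have "k \<otimes> (inv k \<otimes> x \<otimes> k) \<otimes> inv k \<in> P"
        by (rule Pm(1) [OF Pm(1) [OF kP xk] Pm(2) [OF kP]])
      then show "x \<in> P" using x k by (simp add: m_assoc conj_cancel)
    qed (intro Pm kP)
    finally show ?thesis .
  qed
  have P_iff: "v \<subseteq> P \<longleftrightarrow> v \<in> X'" if vW: "v \<in> carrier W" for v
  proof
    assume "v \<subseteq> P"
    moreover obtain n where "n \<in> v" using W_nonempty vW by blast
    ultimately obtain v' where "v' \<in> X'" "n \<in> dc v'" "n \<in> dc v" using W_dc vW by (auto simp: P_def)
    then show "v \<in> X'" using dc_inject vW X'W by blast
  qed (use W_dc vW in \<open>auto simp: P_def\<close>)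
  let ?w = "inv\<^bsub>W\<^esub> w0 \<otimes>\<^bsub>W\<^esub> w \<otimes>\<^bsub>W\<^esub> w0"
  have wW: "?w \<in> carrier W" using w n0 by simp
  have wback: "w0 \<otimes>\<^bsub>W\<^esub> ?w \<otimes>\<^bsub>W\<^esub> inv\<^bsub>W\<^esub> w0 = w" using w n0(2) by (simp add: I.m_assoc I.conj_cancel)
  have "w \<subseteq> Q \<longleftrightarrow> ?w \<subseteq> P"
  proof
    assume wQ: "w \<subseteq> Q"
    show "?w \<subseteq> P"
    proof
      fix x assume x: "x \<in> ?w"
      have "n0 \<otimes> x \<otimes> inv n0 \<in> w0 \<otimes>\<^bsub>W\<^esub> ?w \<otimes>\<^bsub>W\<^esub> inv\<^bsub>W\<^esub> w0" by (intro mult_mem inv_mem n0 x)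
      then show "x \<in> P" using wQ wback QP W_carrier [OF wW x] by auto
    qed
  next
    assume wP: "?w \<subseteq> P"
    show "w \<subseteq> Q"
    proof
      fix x assume x: "x \<in> w"
      have xc: "x \<in> carrier G" using W_carrier [OF w x] .
      have "inv n0 \<otimes> x \<otimes> n0 \<in> ?w" by (intro mult_mem inv_mem n0 x)
      then have "inv n0 \<otimes> x \<otimes> n0 \<in> P" using wP by blast
      then have "n0 \<otimes> (inv n0 \<otimes> x \<otimes> n0) \<otimes> inv n0 \<in> Q" using QP xc n0N by simp
      then show "x \<in> Q" using xc n0N by (simp add: m_assoc conj_cancel)
    qed
  qed
  also have "\<dots> \<longleftrightarrow> ?w \<in> X'" by (rule P_iff [OF wW])
  also have "\<dots> \<longleftrightarrow> w \<in> X"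
  proof
    assume "?w \<in> X'"
    then obtain v where v: "v \<in> X" "?w = inv\<^bsub>W\<^esub> w0 \<otimes>\<^bsub>W\<^esub> v \<otimes>\<^bsub>W\<^esub> w0" by (auto simp: X'_def)
    have "w0 \<otimes>\<^bsub>W\<^esub> ?w \<otimes>\<^bsub>W\<^esub> inv\<^bsub>W\<^esub> w0 = v"
      unfolding v(2) using v(1) XW n0(2) by (auto simp: I.m_assoc I.conj_cancel subset_iff)
    then show "w \<in> X" using wback v(1) by simp
  qed (auto simp: X'_def)
  finally show ?thesis .
qed

end

section \<open>Finite monoids of Lie type\<close>

lemma (in monoid) set_mult_assoc_subsets:
  assumes "A \<subseteq> carrier G" "C \<subseteq> carrier G" "D \<subseteq> carrier G"
  shows "A <#> C <#> D = A <#> (C <#> D)"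
proof
  show "A <#> C <#> D \<subseteq> A <#> (C <#> D)"
    using assms unfolding set_mult_def by (auto simp: m_assoc subset_iff)
  show "A <#> (C <#> D) \<subseteq> A <#> C <#> D"
    using assms unfolding set_mult_def by (auto simp: m_assoc [symmetric] subset_iff)
qed

locale lie_monoid_idempotent = finite_monoid_of_Lie_type M p B N U S
  for M :: "'a monoid" (structure) and p B N U S +
  fixes e :: 'a
  assumes e_lattice: "e \<in> cross_section_lattice"
begin

interpretation G: lie_type_group "units_of M" p B N U S ..

abbreviation W where "W \<equiv> weyl_group"
abbreviation eT where "eT \<equiv> e <#\<^bsub>M\<^esub> torus"

lemmas units_simps = units_of_mult units_of_one units_of_carrier

lemma inv_units: "x \<in> Units M \<Longrightarrow> inv\<^bsub>units_of M\<^esub> x = inv x"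
  by (rule units_of_inv)

lemma e_closed: "e \<in> carrier M" and e_idem: "e \<otimes> e = e"
  and B_par: "B \<subseteq> par e" and opposite_par: "opposite_borel \<subseteq> par_minus e"
  using e_lattice by (auto simp: cross_section_lattice_def idempotents_def)

lemma W_units: "w \<in> carrier W \<Longrightarrow> n \<in> w \<Longrightarrow> n \<in> Units M"
  using G.W_carrier [of w n] by (simp add: units_simps)

lemma torus_units: "t \<in> torus \<Longrightarrow> t \<in> Units M"
  using G.torus_carrier [of t] by (simp add: units_simps)

lemma torus_closed_M: "t \<in> torus \<Longrightarrow> t \<in> carrier M"
  using torus_units by blast

lemma W_sub: "w \<in> carrier W \<Longrightarrow> w \<subseteq> carrier M"
  using W_units by blast

lemma W_mult_M: "x \<otimes>\<^bsub>W\<^esub> y = x <#>\<^bsub>M\<^esub> y"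
  by (simp add: G.W_mult set_mult_def units_simps)

lemma R_mult: "x \<otimes>\<^bsub>renner_monoid\<^esub> y = x <#>\<^bsub>M\<^esub> y"
  by (simp add: renner_monoid_def)

section \<open>The opposite parabolics of an idempotent\<close>

lemma opposite_conjugate:
  obtains w0 n0 where "w0 \<in> carrier W" "n0 \<in> w0" "opposite_borel = conjugate n0 B"
proof -
  interpret C: finite_coxeter_group W S by (rule G.finite_coxeter_group_W)
  define w0 where "w0 = C.longest (carrier W)"
  have "\<exists>b. \<forall>y. y \<in> carrier W \<longrightarrow> C.len y < b"
    using finite_nat_set_iff_bounded [of "C.len ` carrier W"] C.W_finite by auto
  then obtain b where "\<forall>y. y \<in> carrier W \<longrightarrow> C.len y < b" by blast
  then have w0: "w0 \<in> carrier W"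
    unfolding w0_def C.longest_def using arg_max_natI [of "\<lambda>w. w \<in> carrier W" "\<one>\<^bsub>W\<^esub>" C.len b] by simp
  obtain n0 where n0: "n0 \<in> w0" using G.W_nonempty [OF w0] by blast
  have cl: "n0 \<in> carrier (units_of M)" using G.W_carrier [OF w0 n0] .
  have "opposite_borel = w0 <#>\<^bsub>units_of M\<^esub> B <#>\<^bsub>units_of M\<^esub> inv\<^bsub>W\<^esub> w0"
    by (simp add: opposite_borel_def w0_def Let_def)
  also have "\<dots> = conjugate n0 B"
  proof
    show "conjugate n0 B \<subseteq> w0 <#>\<^bsub>units_of M\<^esub> B <#>\<^bsub>units_of M\<^esub> inv\<^bsub>W\<^esub> w0"
      using n0 G.inv_mem [OF w0 n0] unfolding conjugate_def set_mult_def by blast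
    show "w0 <#>\<^bsub>units_of M\<^esub> B <#>\<^bsub>units_of M\<^esub> inv\<^bsub>W\<^esub> w0 \<subseteq> conjugate n0 B"
    proof
      fix x assume "x \<in> w0 <#>\<^bsub>units_of M\<^esub> B <#>\<^bsub>units_of M\<^esub> inv\<^bsub>W\<^esub> w0"
      then obtain n c m where 1: "n \<in> w0" "c \<in> B" "m \<in> inv\<^bsub>W\<^esub> w0"
        "x = n \<otimes>\<^bsub>units_of M\<^esub> c \<otimes>\<^bsub>units_of M\<^esub> m"
        unfolding set_mult_def by blast
      obtain t where t: "t \<in> torus" "n = n0 \<otimes>\<^bsub>units_of M\<^esub> t" by (rule G.W_diff_right [OF w0 n0 1(1)])
      obtain t' where t': "t' \<in> torus" "m = t' \<otimes>\<^bsub>units_of M\<^esub> inv\<^bsub>units_of M\<^esub> n0"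
        using G.W_diff_left [OF _ G.inv_mem [OF w0 n0] 1(3)] w0 by auto
      have "x = n0 \<otimes>\<^bsub>units_of M\<^esub> (t \<otimes>\<^bsub>units_of M\<^esub> c \<otimes>\<^bsub>units_of M\<^esub> t') \<otimes>\<^bsub>units_of M\<^esub> inv\<^bsub>units_of M\<^esub> n0"
        using 1 t t' cl G.torus_carrier G.B_carrier by (simp add: units.m_assoc)
      moreover have "t \<otimes>\<^bsub>units_of M\<^esub> c \<otimes>\<^bsub>units_of M\<^esub> t' \<in> B"
        using 1 t t' G.torus_B G.B_closed by simp
      ultimately show "x \<in> conjugate n0 B" unfolding conjugate_def by blast
    qed
  qed
  finally show thesis using that w0 n0 by blast
qed

lemma torus_opposite: "t \<in> torus \<Longrightarrow> t \<in> opposite_borel"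
proof -
  assume t: "t \<in> torus"
  obtain w0 n0 where w0: "w0 \<in> carrier W" "n0 \<in> w0" "opposite_borel = conjugate n0 B"
    by (rule opposite_conjugate)
  have n0: "n0 \<in> N" "n0 \<in> carrier (units_of M)" using G.W_N G.W_carrier w0 by auto
  have "inv\<^bsub>units_of M\<^esub> n0 \<otimes>\<^bsub>units_of M\<^esub> t \<otimes>\<^bsub>units_of M\<^esub> n0 \<in> B"
    using G.torus_conj(2) [OF n0(1) t] G.torus_B by blast
  moreover have "t = n0 \<otimes>\<^bsub>units_of M\<^esub> (inv\<^bsub>units_of M\<^esub> n0 \<otimes>\<^bsub>units_of M\<^esub> t \<otimes>\<^bsub>units_of M\<^esub> n0)
      \<otimes>\<^bsub>units_of M\<^esub> inv\<^bsub>units_of M\<^esub> n0"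
    using n0 G.torus_carrier [OF t] by (simp add: units.m_assoc units.conj_cancel)
  ultimately show ?thesis unfolding w0(3) conjugate_def by blast
qed

lemma torus_comm_e: "t \<in> torus \<Longrightarrow> t \<otimes> e = e \<otimes> t"
proof -
  assume t: "t \<in> torus"
  have "t \<in> par e" "t \<in> par_minus e" using G.torus_B t B_par torus_opposite opposite_par by auto
  then show ?thesis by (simp add: par_def par_minus_def)
qed

lemma par_subgroup: "subgroup (par e) (units_of M)" "subgroup (par_minus e) (units_of M)"
proof -
  note * = units.finite_closed_subgroup [OF units.finite_carrier]
  show "subgroup (par e) (units_of M)"
  proof (rule *)
    show "par e \<subseteq> carrier (units_of M)" "\<one>\<^bsub>units_of M\<^esub> \<in> par e"
      using e_closed e_idem by (auto simp: par_def units_simps)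
    show "x \<otimes>\<^bsub>units_of M\<^esub> y \<in> par e" if xy: "x \<in> par e" "y \<in> par e" for x y
    proof -
      have cl: "x \<in> Units M" "y \<in> Units M" "x \<in> carrier M" "y \<in> carrier M"
        and ex: "x \<otimes> e = e \<otimes> x \<otimes> e" and ey: "y \<otimes> e = e \<otimes> y \<otimes> e"
        using xy by (auto simp: par_def)
      have "x \<otimes> y \<otimes> e = x \<otimes> e \<otimes> (y \<otimes> e)"
        using cl e_closed ey by (simp add: m_assoc)
      also have "\<dots> = e \<otimes> (x \<otimes> e \<otimes> (y \<otimes> e))"
        using cl e_closed by (subst ex) (simp add: m_assoc)
      also have "x \<otimes> e \<otimes> (y \<otimes> e) = x \<otimes> y \<otimes> e"
        using cl e_closed ey by (simp add: m_assoc)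
      finally show ?thesis using cl e_closed by (simp add: par_def units_simps m_assoc)
    qed
  qed
  show "subgroup (par_minus e) (units_of M)"
  proof (rule *)
    show "par_minus e \<subseteq> carrier (units_of M)" "\<one>\<^bsub>units_of M\<^esub> \<in> par_minus e"
      using e_closed e_idem by (auto simp: par_minus_def units_simps)
    show "x \<otimes>\<^bsub>units_of M\<^esub> y \<in> par_minus e" if xy: "x \<in> par_minus e" "y \<in> par_minus e" for x y
    proof -
      have cl: "x \<in> Units M" "y \<in> Units M" "x \<in> carrier M" "y \<in> carrier M"
        and ex: "e \<otimes> x = e \<otimes> x \<otimes> e" and ey: "e \<otimes> y = e \<otimes> y \<otimes> e"
        using xy by (auto simp: par_minus_def)
      have 1: "e \<otimes> (x \<otimes> y) = e \<otimes> x \<otimes> (e \<otimes> y)"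
      proof -
        have "e \<otimes> (x \<otimes> y) = e \<otimes> x \<otimes> y" using cl e_closed by (simp add: m_assoc)
        also have "\<dots> = e \<otimes> x \<otimes> e \<otimes> y" by (simp only: ex [symmetric])
        finally show ?thesis using cl e_closed by (simp add: m_assoc)
      qed
      have "e \<otimes> x \<otimes> (e \<otimes> y) = e \<otimes> x \<otimes> (e \<otimes> y) \<otimes> e"
      proof -
        have "e \<otimes> x \<otimes> (e \<otimes> y) = e \<otimes> x \<otimes> (e \<otimes> y \<otimes> e)" by (simp only: ey [symmetric])
        then show ?thesis using cl e_closed e_idem by (simp add: m_assoc)
      qed
      then show ?thesis using cl e_closed 1 by (simp add: par_minus_def units_simps)
    qed
  qed
qed

text \<open>The axiom provides one \<open>g\<close> that conjugates both groups to opposite standard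
  parabolics of the same type. They contain \<open>B\<close> and its opposite respectively, so
  \<open>conjugate_parabolic\<close> removes \<open>g\<close> on each side; the common
  \<open>K\<close> turns out to be the type of \<open>W(e)\<close>.\<close>

lemma parabolic_type:
  obtains K where "K \<subseteq> S" "\<And>w. w \<in> carrier W \<Longrightarrow> w \<subseteq> par e \<longleftrightarrow> w \<in> generate W K"
    "\<And>w. w \<in> carrier W \<Longrightarrow> w \<subseteq> par_minus e \<longleftrightarrow> w \<in> generate W K"
proof -
  interpret C: finite_coxeter_group W S by (rule G.finite_coxeter_group_W)
  have "e \<in> idempotents" using e_lattice by (simp add: cross_section_lattice_def)
  note opp = par_opposite [OF this, unfolded opposite_parabolics_def]
  obtain g K where K: "g \<in> carrier (units_of M)" "K \<subseteq> S"
    "par e = conjugate g (double_cosets B K)"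
    "par_minus e = conjugate g (double_cosets opposite_borel K)"
    using opp by (elim bexE exE conjE)
  have X: "subgroup (generate W K) W"
    using K(2) C.S_carrier by (intro C.generate_is_subgroup) auto
  have one: "\<one>\<^bsub>units_of M\<^esub> \<in> \<one>\<^bsub>W\<^esub>" by (simp add: G.W_one G.torus_closed(3))
  have "\<one>\<^bsub>units_of M\<^esub> \<otimes>\<^bsub>units_of M\<^esub> b \<otimes>\<^bsub>units_of M\<^esub> inv\<^bsub>units_of M\<^esub> \<one>\<^bsub>units_of M\<^esub> = b" if "b \<in> B" for b
    using G.B_carrier [OF that] by simp
  then have B1: "conjugate \<one>\<^bsub>units_of M\<^esub> B = B"
    unfolding conjugate_def by (simp cong: image_cong)
  have "w \<subseteq> par e \<longleftrightarrow> w \<in> generate W K" if w: "w \<in> carrier W" for w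
    by (rule G.conjugate_parabolic [OF par_subgroup(1) one C.one_closed _ X K(1) _ w])
      (use B_par K(3) in \<open>simp_all add: B1 double_cosets_def\<close>)
  moreover obtain w0 n0 where w0: "w0 \<in> carrier W" "n0 \<in> w0" "opposite_borel = conjugate n0 B"
    by (rule opposite_conjugate)
  have "w \<subseteq> par_minus e \<longleftrightarrow> w \<in> generate W K" if w: "w \<in> carrier W" for w
    by (rule G.conjugate_parabolic [OF par_subgroup(2) w0(2,1) _ X K(1) _ w])
      (use opposite_par K(4) in \<open>simp_all add: w0(3) double_cosets_def\<close>)
  ultimately show thesis using that K(2) by blast
qed

lemma class_par:
  assumes w: "w \<in> carrier W" and n: "n \<in> w"
  shows "n \<in> par e \<Longrightarrow> w \<subseteq> par e" "n \<in> par_minus e \<Longrightarrow> w \<subseteq> par_minus e"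
proof -
  have t: "t \<in> par e" "t \<in> par_minus e" if "t \<in> torus" for t
    using G.torus_B that B_par torus_opposite opposite_par by auto
  show "w \<subseteq> par e" if "n \<in> par e"
  proof
    fix m assume "m \<in> w"
    then obtain t' where "t' \<in> torus" "m = t' \<otimes>\<^bsub>units_of M\<^esub> n" by (rule G.W_diff_left [OF w n])
    then show "m \<in> par e" using subgroup.m_closed [OF par_subgroup(1)] t that by simp
  qed
  show "w \<subseteq> par_minus e" if "n \<in> par_minus e"
  proof
    fix m assume "m \<in> w"
    then obtain t' where "t' \<in> torus" "m = t' \<otimes>\<^bsub>units_of M\<^esub> n" by (rule G.W_diff_left [OF w n])
    then show "m \<in> par_minus e" using subgroup.m_closed [OF par_subgroup(2)] t that by simp
  qed
qed

text \<open>For classes in the Weyl group, lying in P(e) and lying in its opposite are the same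
  condition by \<open>parabolic_type\<close>, and the two together mean commuting with
  \<open>e\<close>.\<close>

lemma par_commute:
  assumes w: "w \<in> carrier W" and n: "n \<in> w" and par: "n \<in> par e \<or> n \<in> par_minus e"
  shows "n \<otimes> e = e \<otimes> n"
proof -
  obtain K where "\<And>w. w \<in> carrier W \<Longrightarrow> w \<subseteq> par e \<longleftrightarrow> w \<in> generate W K"
    "\<And>w. w \<in> carrier W \<Longrightarrow> w \<subseteq> par_minus e \<longleftrightarrow> w \<in> generate W K"
    using parabolic_type by metis
  then have "w \<subseteq> par e \<longleftrightarrow> w \<subseteq> par_minus e" using w by simp
  then have "n \<in> par e" "n \<in> par_minus e" using class_par [OF w n] par n by auto
  then show ?thesis by (simp add: par_def par_minus_def)
qed

section \<open>Renner monoid products as cosets of the torus\<close>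

lemma eT_sub: "eT \<subseteq> carrier M"
  using e_closed torus_units by (auto simp: l_coset_def)

lemma coset_eqD: "a <#\<^bsub>M\<^esub> torus = b <#\<^bsub>M\<^esub> torus \<Longrightarrow> a \<in> carrier M \<Longrightarrow> \<exists>t\<in>torus. a = b \<otimes> t"
proof -
  assume a: "a <#\<^bsub>M\<^esub> torus = b <#\<^bsub>M\<^esub> torus" "a \<in> carrier M"
  have "\<one> \<in> torus" using G.torus_closed(3) by (simp add: units_simps)
  then have "a \<in> a <#\<^bsub>M\<^esub> torus" using a(2) by (force simp: l_coset_def)
  then show ?thesis using a(1) by (auto simp: l_coset_def)
qed

lemma W_eq_lcoset:
  assumes w: "w \<in> carrier W" and n: "n \<in> w"
  shows "w = n <#\<^bsub>M\<^esub> torus"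
proof
  show "w \<subseteq> n <#\<^bsub>M\<^esub> torus"
  proof
    fix m assume "m \<in> w"
    then obtain t where "t \<in> torus" "m = n \<otimes>\<^bsub>units_of M\<^esub> t" by (rule G.W_diff_right [OF w n])
    then show "m \<in> n <#\<^bsub>M\<^esub> torus" by (auto simp: l_coset_def units_simps)
  qed
  show "n <#\<^bsub>M\<^esub> torus \<subseteq> w"
    using G.W_torus_right [OF w n] by (auto simp: l_coset_def units_simps)
qed

text \<open>Set products collapse to a single coset of the torus, given by any representative,
  because the torus commutes with \<open>e\<close>.\<close>

lemma W_eT:
  assumes w: "w \<in> carrier W" and n: "n \<in> w"
  shows "w <#>\<^bsub>M\<^esub> eT = (n \<otimes> e) <#\<^bsub>M\<^esub> torus"
proof
  have nc: "n \<in> carrier M" by (rule Units_closed [OF W_units [OF w n]])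
  show "w <#>\<^bsub>M\<^esub> eT \<subseteq> (n \<otimes> e) <#\<^bsub>M\<^esub> torus"
  proof
    fix x assume "x \<in> w <#>\<^bsub>M\<^esub> eT"
    then obtain t t' where t: "t \<in> torus" "t' \<in> torus" "x = n \<otimes> t \<otimes> (e \<otimes> t')"
      unfolding W_eq_lcoset [OF w n] by (auto simp: set_mult_def l_coset_def)
    then have tc: "t \<in> carrier M" "t' \<in> carrier M" using torus_units by auto
    have "x = n \<otimes> (t \<otimes> e) \<otimes> t'" using t tc nc e_closed by (simp add: m_assoc)
    then have "x = n \<otimes> e \<otimes> (t \<otimes> t')" using t tc nc e_closed by (simp add: torus_comm_e m_assoc)
    moreover have "t \<otimes> t' \<in> torus" using G.torus_closed(1) [OF t(1,2)] by (simp add: units_simps)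
    ultimately show "x \<in> (n \<otimes> e) <#\<^bsub>M\<^esub> torus" by (auto simp: l_coset_def)
  qed
  show "(n \<otimes> e) <#\<^bsub>M\<^esub> torus \<subseteq> w <#>\<^bsub>M\<^esub> eT"
  proof
    fix x assume "x \<in> (n \<otimes> e) <#\<^bsub>M\<^esub> torus"
    then obtain t where t: "t \<in> torus" "x = n \<otimes> e \<otimes> t" by (auto simp: l_coset_def)
    then have "x = n \<otimes> (e \<otimes> t)" using t torus_closed_M nc e_closed by (simp add: m_assoc)
    then show "x \<in> w <#>\<^bsub>M\<^esub> eT" using t n by (auto simp: set_mult_def l_coset_def)
  qed
qed

lemma eT_W:
  assumes w: "w \<in> carrier W" and n: "n \<in> w"
  shows "eT <#>\<^bsub>M\<^esub> w = (e \<otimes> n) <#\<^bsub>M\<^esub> torus"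
proof
  have nc: "n \<in> carrier M" by (rule Units_closed [OF W_units [OF w n]])
  have one: "\<one> \<in> torus" using G.torus_closed(3) by (simp add: units_simps)
  show "eT <#>\<^bsub>M\<^esub> w \<subseteq> (e \<otimes> n) <#\<^bsub>M\<^esub> torus"
  proof
    fix x assume "x \<in> eT <#>\<^bsub>M\<^esub> w"
    then obtain t m where t: "t \<in> torus" "m \<in> w" "x = e \<otimes> t \<otimes> m"
      by (auto simp: set_mult_def l_coset_def)
    interpret C: finite_coxeter_group W S by (rule G.finite_coxeter_group_W)
    have "t \<otimes>\<^bsub>units_of M\<^esub> m \<in> \<one>\<^bsub>W\<^esub> \<otimes>\<^bsub>W\<^esub> w" using t by (intro G.mult_mem) (simp_all add: G.W_one)
    then have "t \<otimes> m \<in> w" using w by (simp add: units_simps)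
    then obtain t' where t': "t' \<in> torus" "t \<otimes> m = n \<otimes> t'"
      using W_eq_lcoset [OF w n] by (auto simp: l_coset_def)
    have "x = e \<otimes> (t \<otimes> m)"
      using t torus_closed_M W_sub [OF w] e_closed by (simp add: m_assoc subset_iff)
    then have "x = e \<otimes> n \<otimes> t'" using t' torus_closed_M nc e_closed by (simp add: m_assoc)
    then show "x \<in> (e \<otimes> n) <#\<^bsub>M\<^esub> torus" using t' by (auto simp: l_coset_def)
  qed
  show "(e \<otimes> n) <#\<^bsub>M\<^esub> torus \<subseteq> eT <#>\<^bsub>M\<^esub> w"
  proof
    fix x assume "x \<in> (e \<otimes> n) <#\<^bsub>M\<^esub> torus"
    then obtain t where t: "t \<in> torus" "x = e \<otimes> n \<otimes> t" by (auto simp: l_coset_def)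
    then have "x = (e \<otimes> \<one>) \<otimes> (n \<otimes> t)" using t torus_closed_M nc e_closed by (simp add: m_assoc)
    moreover have "n \<otimes> t \<in> w" using G.W_torus_right [OF w n t(1)] by (simp add: units_simps)
    ultimately show "x \<in> eT <#>\<^bsub>M\<^esub> w" using one by (auto simp: set_mult_def l_coset_def)
  qed
qed

lemma W_eT_W:
  assumes x: "x \<in> carrier W" "n \<in> x" and y: "y \<in> carrier W" "m \<in> y"
  shows "x <#>\<^bsub>M\<^esub> eT <#>\<^bsub>M\<^esub> y = (n \<otimes> e \<otimes> m) <#\<^bsub>M\<^esub> torus"
proof -
  have cl: "n \<in> carrier M" "m \<in> carrier M" using W_units x y by auto
  have tc: "t \<in> carrier M" if "t \<in> torus" for t using torus_units [OF that] by auto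
  have xn: "x <#>\<^bsub>M\<^esub> eT = {n} <#>\<^bsub>M\<^esub> eT"
    unfolding W_eT [OF x] using cl e_closed tc
    by (auto simp: set_mult_def l_coset_def m_assoc)
  have "x <#>\<^bsub>M\<^esub> eT <#>\<^bsub>M\<^esub> y = {n} <#>\<^bsub>M\<^esub> (eT <#>\<^bsub>M\<^esub> y)"
    unfolding xn using cl eT_sub W_sub [OF y(1)] by (intro set_mult_assoc_subsets) auto
  also have "\<dots> = (n \<otimes> e \<otimes> m) <#\<^bsub>M\<^esub> torus"
    unfolding eT_W [OF y] using cl e_closed tc
    by (auto simp: set_mult_def l_coset_def m_assoc)
  finally show ?thesis .
qed

text \<open>The defining equations of \<open>W(e)\<close> and \<open>W_e\<close> hold only modulo
  the torus, so a representative commutes with \<open>e\<close> or fixes it up to a torus factor.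
  Such an equation still places the representative in P(e), and \<open>par_commute\<close> turns
  this into exact commutation; hence \<open>W(e)\<close> has the type given by
  \<open>parabolic_type\<close>.\<close>

lemma coxeter_orbit_idempotent:
  assumes I: "I \<subseteq> S" "renner_orbit.stabilizer W renner_monoid eT = generate W I"
  shows "\<exists>K. coxeter_orbit W S renner_monoid eT I K"
proof -
  interpret C: finite_coxeter_group W S by (rule G.finite_coxeter_group_W)
  interpret O: renner_orbit W S renner_monoid eT .
  obtain K where K: "K \<subseteq> S" "\<And>w. w \<in> carrier W \<Longrightarrow> w \<subseteq> par e \<longleftrightarrow> w \<in> generate W K"
    "\<And>w. w \<in> carrier W \<Longrightarrow> w \<subseteq> par_minus e \<longleftrightarrow> w \<in> generate W K"
    using parabolic_type by metis
  have assoc: "A <#>\<^bsub>M\<^esub> C <#>\<^bsub>M\<^esub> D = A <#>\<^bsub>M\<^esub> (C <#>\<^bsub>M\<^esub> D)"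
    if "A \<subseteq> carrier M" "C \<subseteq> carrier M" "D \<subseteq> carrier M" for A C D
    using that by (rule set_mult_assoc_subsets)
  have sub_mult: "A <#>\<^bsub>M\<^esub> C \<subseteq> carrier M" if "A \<subseteq> carrier M" "C \<subseteq> carrier M" for A C
    using that by (rule set_mult_closed)
  have Wm: "x <#>\<^bsub>M\<^esub> y \<in> carrier W" if "x \<in> carrier W" "y \<in> carrier W" for x y
    using C.m_closed [OF that] by (simp add: W_mult_M)
  have centI: "w \<in> O.centralizer" if w: "w \<in> carrier W" and n: "n \<in> w" "n \<otimes> e = e \<otimes> n" for w n
    using w W_eT [OF w n(1)] eT_W [OF w n(1)] n(2) by (simp add: O.centralizer_def R_mult)
  have centD: "n \<otimes> e = e \<otimes> n" if w: "w \<in> O.centralizer" and n: "n \<in> w" for w n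
  proof -
    have wW: "w \<in> carrier W" using w by (simp add: O.centralizer_def)
    have nc: "n \<in> Units M" "n \<in> carrier M" using W_units [OF wW n] by auto
    have "(n \<otimes> e) <#\<^bsub>M\<^esub> torus = (e \<otimes> n) <#\<^bsub>M\<^esub> torus"
      using w W_eT [OF wW n] eT_W [OF wW n] by (simp add: O.centralizer_def R_mult)
    then obtain t where t: "t \<in> torus" "n \<otimes> e = e \<otimes> n \<otimes> t"
      using coset_eqD nc e_closed by blast
    have tc: "t \<in> carrier M" using t torus_units by auto
    have "e \<otimes> (n \<otimes> e) = n \<otimes> e"
      unfolding t(2) using nc tc e_closed e_idem by (simp add: m_assoc [symmetric])
    then have "n \<in> par e" using nc e_closed by (simp add: par_def m_assoc)
    then show ?thesis using par_commute [OF wW n] by blast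
  qed
  have stabI: "w \<in> O.stabilizer" if w: "w \<in> carrier W" and n: "n \<in> w" "n \<otimes> e = e" for w n
    using w W_eT [OF w n(1)] n(2) by (simp add: O.stabilizer_def R_mult)
  have stabD: "\<exists>t\<in>torus. n \<otimes> e = e \<otimes> t" if w: "w \<in> O.stabilizer" and n: "n \<in> w" for w n
  proof -
    have wW: "w \<in> carrier W" using w by (simp add: O.stabilizer_def)
    have "(n \<otimes> e) <#\<^bsub>M\<^esub> torus = eT" using w W_eT [OF wW n] by (simp add: O.stabilizer_def R_mult)
    then show ?thesis using coset_eqD W_units [OF wW n] e_closed by blast
  qed
  have stab_cent: "O.stabilizer \<subseteq> O.centralizer"
  proof
    fix w assume w: "w \<in> O.stabilizer"
    then have wW: "w \<in> carrier W" by (simp add: O.stabilizer_def)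
    obtain n where n: "n \<in> w" using G.W_nonempty [OF wW] by blast
    obtain t where t: "t \<in> torus" "n \<otimes> e = e \<otimes> t" using stabD [OF w n] by blast
    have nc: "n \<in> Units M" "n \<in> carrier M" "t \<in> carrier M" using W_units [OF wW n] t torus_units by auto
    have "e \<otimes> (n \<otimes> e) = n \<otimes> e"
      unfolding t(2) using nc e_closed e_idem by (simp add: m_assoc [symmetric])
    then have "n \<in> par e" using nc e_closed by (simp add: par_def m_assoc)
    then show "w \<in> O.centralizer" using centI [OF wW n] par_commute [OF wW n] by blast
  qed
  have cent_gen: "O.centralizer = generate W K"
  proof
    show "O.centralizer \<subseteq> generate W K"
    proof
      fix w assume w: "w \<in> O.centralizer"
      then have wW: "w \<in> carrier W" by (simp add: O.centralizer_def)
      have "n \<in> par e" if n: "n \<in> w" for n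
      proof -
        have nc: "n \<in> Units M" "n \<in> carrier M" using W_units [OF wW n] by auto
        have "e \<otimes> n \<otimes> e = e \<otimes> (e \<otimes> n)" using nc e_closed centD [OF w n] by (simp add: m_assoc)
        also have "\<dots> = n \<otimes> e" using nc e_closed e_idem centD [OF w n] by (simp add: m_assoc [symmetric])
        finally show ?thesis using nc by (simp add: par_def)
      qed
      then show "w \<in> generate W K" using K(2) [OF wW] by blast
    qed
    show "generate W K \<subseteq> O.centralizer"
    proof
      fix w assume w: "w \<in> generate W K"
      then have wW: "w \<in> carrier W" using C.parabolic_closed [OF K(1)] by blast
      obtain n where n: "n \<in> w" using G.W_nonempty [OF wW] by blast
      have "w \<subseteq> par e" using K(2) [OF wW] w by blast
      then have "n \<otimes> e = e \<otimes> n" using par_commute [OF wW n] n by blast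
      then show "w \<in> O.centralizer" by (rule centI [OF wW n])
    qed
  qed
  have "coxeter_orbit W S renner_monoid eT I K"
  proof unfold_locales
    show "I \<subseteq> S" "K \<subseteq> S" by (rule I K)+
    show "O.stabilizer = generate W I" by (rule I)
    show "O.centralizer = generate W K" by (rule cent_gen)
    show "O.stabilizer \<subseteq> O.centralizer" by (rule stab_cent)
    show "inv\<^bsub>W\<^esub> c \<otimes>\<^bsub>W\<^esub> m \<otimes>\<^bsub>W\<^esub> c \<in> O.stabilizer" if c: "c \<in> O.centralizer" and m: "m \<in> O.stabilizer" for c m
    proof -
      have cW: "c \<in> carrier W" "m \<in> carrier W" "inv\<^bsub>W\<^esub> c \<in> carrier W"
        using c m by (auto simp: O.centralizer_def O.stabilizer_def)
      have sub: "c \<subseteq> carrier M" "m \<subseteq> carrier M" "inv\<^bsub>W\<^esub> c \<subseteq> carrier M" using W_sub cW by auto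
      have ce: "c <#>\<^bsub>M\<^esub> eT = eT <#>\<^bsub>M\<^esub> c" and me: "m <#>\<^bsub>M\<^esub> eT = eT"
        using c m by (auto simp: O.centralizer_def O.stabilizer_def R_mult)
      have one: "torus <#>\<^bsub>M\<^esub> eT = eT"
        using W_eT [of "\<one>\<^bsub>W\<^esub>" \<one>] C.one_closed G.torus_closed(3) e_closed by (simp add: G.W_one units_simps)
      have "(inv\<^bsub>W\<^esub> c <#>\<^bsub>M\<^esub> m <#>\<^bsub>M\<^esub> c) <#>\<^bsub>M\<^esub> eT = inv\<^bsub>W\<^esub> c <#>\<^bsub>M\<^esub> (m <#>\<^bsub>M\<^esub> (c <#>\<^bsub>M\<^esub> eT))"
        using sub eT_sub sub_mult by (simp add: assoc)
      also have "\<dots> = inv\<^bsub>W\<^esub> c <#>\<^bsub>M\<^esub> (c <#>\<^bsub>M\<^esub> eT)"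
        unfolding ce using assoc [OF sub(2) eT_sub sub(1)] by (simp add: me)
      also have "\<dots> = (inv\<^bsub>W\<^esub> c \<otimes>\<^bsub>W\<^esub> c) <#>\<^bsub>M\<^esub> eT" using sub eT_sub by (simp add: assoc W_mult_M)
      also have "\<dots> = eT" using cW one by (simp add: G.W_one)
      finally show ?thesis using cW Wm by (simp add: O.stabilizer_def R_mult W_mult_M)
    qed
    show "x \<otimes>\<^bsub>renner_monoid\<^esub> (y \<otimes>\<^bsub>renner_monoid\<^esub> eT \<otimes>\<^bsub>renner_monoid\<^esub> z) =
        (x \<otimes>\<^bsub>W\<^esub> y) \<otimes>\<^bsub>renner_monoid\<^esub> eT \<otimes>\<^bsub>renner_monoid\<^esub> z"
      if "x \<in> carrier W" "y \<in> carrier W" "z \<in> carrier W" for x y z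
      using that W_sub eT_sub sub_mult by (simp add: R_mult W_mult_M assoc)
    show "(x \<otimes>\<^bsub>W\<^esub> c) \<otimes>\<^bsub>renner_monoid\<^esub> eT \<otimes>\<^bsub>renner_monoid\<^esub> y =
        x \<otimes>\<^bsub>renner_monoid\<^esub> eT \<otimes>\<^bsub>renner_monoid\<^esub> (c \<otimes>\<^bsub>W\<^esub> y)"
      if c: "c \<in> O.centralizer" and x: "x \<in> carrier W" and y: "y \<in> carrier W" for c x y
    proof -
      have cW: "c \<in> carrier W" and ce: "c <#>\<^bsub>M\<^esub> eT = eT <#>\<^bsub>M\<^esub> c"
        using c by (auto simp: O.centralizer_def R_mult)
      have sub: "c \<subseteq> carrier M" "x \<subseteq> carrier M" "y \<subseteq> carrier M" using W_sub cW x y by auto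
      have "c <#>\<^bsub>M\<^esub> (eT <#>\<^bsub>M\<^esub> y) = eT <#>\<^bsub>M\<^esub> (c <#>\<^bsub>M\<^esub> y)"
        using assoc [OF sub(1) eT_sub sub(3)] assoc [OF eT_sub sub(1,3)] ce by simp
      then show ?thesis using sub eT_sub sub_mult by (simp add: R_mult W_mult_M assoc)
    qed
    show "(x \<otimes>\<^bsub>W\<^esub> m) \<otimes>\<^bsub>renner_monoid\<^esub> eT \<otimes>\<^bsub>renner_monoid\<^esub> y =
        x \<otimes>\<^bsub>renner_monoid\<^esub> eT \<otimes>\<^bsub>renner_monoid\<^esub> y"
      if m: "m \<in> O.stabilizer" and x: "x \<in> carrier W" and y: "y \<in> carrier W" for m x y
    proof -
      have mW: "m \<in> carrier W" and me: "m <#>\<^bsub>M\<^esub> eT = eT"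
        using m by (auto simp: O.stabilizer_def R_mult)
      have sub: "m \<subseteq> carrier M" "x \<subseteq> carrier M" using W_sub mW x by auto
      show ?thesis using assoc [OF sub(2,1) eT_sub] me by (simp add: R_mult W_mult_M)
    qed
    show "y' \<otimes>\<^bsub>W\<^esub> inv\<^bsub>W\<^esub> y \<in> O.centralizer \<and>
        inv\<^bsub>W\<^esub> x' \<otimes>\<^bsub>W\<^esub> x \<otimes>\<^bsub>W\<^esub> (y \<otimes>\<^bsub>W\<^esub> inv\<^bsub>W\<^esub> y') \<in> O.stabilizer"
      if x: "x \<in> carrier W" and y: "y \<in> carrier W" and x': "x' \<in> carrier W" and y': "y' \<in> carrier W"
        and eq: "x \<otimes>\<^bsub>renner_monoid\<^esub> eT \<otimes>\<^bsub>renner_monoid\<^esub> y =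
          x' \<otimes>\<^bsub>renner_monoid\<^esub> eT \<otimes>\<^bsub>renner_monoid\<^esub> y'" for x y x' y'
    proof -
      obtain n where n: "n \<in> x" using G.W_nonempty [OF x] by blast
      obtain m where m: "m \<in> y" using G.W_nonempty [OF y] by blast
      obtain n' where n': "n' \<in> x'" using G.W_nonempty [OF x'] by blast
      obtain m' where m': "m' \<in> y'" using G.W_nonempty [OF y'] by blast
      have un: "n \<in> Units M" "m \<in> Units M" "n' \<in> Units M" "m' \<in> Units M"
        using W_units x y x' y' n m n' m' by blast+
      then have cl: "n \<in> carrier M" "m \<in> carrier M" "n' \<in> carrier M" "m' \<in> carrier M" by auto
      have "(n \<otimes> e \<otimes> m) <#\<^bsub>M\<^esub> torus = (n' \<otimes> e \<otimes> m') <#\<^bsub>M\<^esub> torus"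
        using eq W_eT_W [OF x n y m] W_eT_W [OF x' n' y' m'] by (simp add: R_mult)
      then obtain t where t: "t \<in> torus" "n \<otimes> e \<otimes> m = n' \<otimes> e \<otimes> m' \<otimes> t"
        using coset_eqD cl e_closed by blast
      have tc: "t \<in> Units M" "t \<in> carrier M" using t torus_units by auto
      \<comment> \<open>Moving units across the equation of representatives gives
        \<open>c \<otimes> e = e \<otimes> d\<close>. Idempotency of \<open>e\<close> puts
        \<open>c\<close> into P(e) and \<open>d\<close> into its opposite, so both commute with
        \<open>e\<close>, and \<open>c \<otimes> inv d\<close> fixes \<open>e\<close>. The torus
        factor \<open>t\<close> is absorbed into \<open>d\<close>, which stays in its class.\<close>
      define c where "c = inv n' \<otimes> n"
      define d where "d = m' \<otimes> t \<otimes> inv m"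
      have cW: "inv\<^bsub>W\<^esub> x' \<otimes>\<^bsub>W\<^esub> x \<in> carrier W" and dW: "y' \<otimes>\<^bsub>W\<^esub> inv\<^bsub>W\<^esub> y \<in> carrier W"
        using x y x' y' by auto
      have cm: "c \<in> inv\<^bsub>W\<^esub> x' \<otimes>\<^bsub>W\<^esub> x"
        using G.mult_mem [OF G.inv_mem [OF x' n'] n] un by (simp add: c_def inv_units units_simps)
      have "m' \<otimes> t \<in> y'" using G.W_torus_right [OF y' m' t(1)] by (simp add: units_simps)
      then have dm: "d \<in> y' \<otimes>\<^bsub>W\<^esub> inv\<^bsub>W\<^esub> y"
        using G.mult_mem [OF _ G.inv_mem [OF y m]] un by (simp add: d_def inv_units units_simps)
      have ucd: "c \<in> Units M" "d \<in> Units M" "c \<in> carrier M" "d \<in> carrier M"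
        using W_units [OF cW cm] W_units [OF dW dm] by auto
      have ced: "c \<otimes> e = e \<otimes> d"
      proof -
        have "inv n' \<otimes> (n \<otimes> e \<otimes> m) \<otimes> inv m = inv n' \<otimes> (n' \<otimes> e \<otimes> m' \<otimes> t) \<otimes> inv m"
          by (simp only: t(2))
        moreover have "inv n' \<otimes> (n \<otimes> e \<otimes> m) \<otimes> inv m = c \<otimes> e"
          using un cl e_closed by (simp add: c_def m_assoc)
        moreover have "inv n' \<otimes> (n' \<otimes> e \<otimes> m' \<otimes> t) \<otimes> inv m = e \<otimes> d"
          using un cl e_closed tc by (simp add: d_def m_assoc) (simp add: m_assoc [symmetric])
        ultimately show ?thesis by simp
      qed
      have "e \<otimes> (c \<otimes> e) = c \<otimes> e"
        unfolding ced using ucd e_closed e_idem by (simp add: m_assoc [symmetric])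
      then have "c \<in> par e" using ucd e_closed by (simp add: par_def m_assoc)
      then have ce: "c \<otimes> e = e \<otimes> c" using par_commute [OF cW cm] by blast
      have "e \<otimes> d \<otimes> e = e \<otimes> d"
        unfolding ced [symmetric] using ucd e_closed e_idem by (simp add: m_assoc)
      then have "d \<in> par_minus e" using ucd by (simp add: par_minus_def)
      then have de: "d \<otimes> e = e \<otimes> d" using par_commute [OF dW dm] by blast
      have i: "inv d \<otimes> e = e \<otimes> inv d"
      proof -
        have "inv d \<otimes> (d \<otimes> e) \<otimes> inv d = inv d \<otimes> (e \<otimes> d) \<otimes> inv d" by (simp only: de)
        moreover have "inv d \<otimes> (d \<otimes> e) = e" using ucd e_closed by (simp add: m_assoc [symmetric])
        moreover have "inv d \<otimes> (e \<otimes> d) \<otimes> inv d = inv d \<otimes> e" using ucd e_closed by (simp add: m_assoc)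
        ultimately show ?thesis by simp
      qed
      have "inv d \<in> inv\<^bsub>W\<^esub> (y' \<otimes>\<^bsub>W\<^esub> inv\<^bsub>W\<^esub> y)"
        using G.inv_mem [OF dW dm] ucd by (simp add: inv_units)
      then have "inv d \<in> y \<otimes>\<^bsub>W\<^esub> inv\<^bsub>W\<^esub> y'" using y y' by (simp add: C.inv_mult_group)
      then have cd: "c \<otimes> inv d \<in> inv\<^bsub>W\<^esub> x' \<otimes>\<^bsub>W\<^esub> x \<otimes>\<^bsub>W\<^esub> (y \<otimes>\<^bsub>W\<^esub> inv\<^bsub>W\<^esub> y')"
        using G.mult_mem [OF cm] by (simp add: units_simps)
      have "c \<otimes> inv d \<otimes> e = c \<otimes> e \<otimes> inv d" using ucd e_closed i by (simp add: m_assoc)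
      also have "\<dots> = e" unfolding ced using ucd e_closed by (simp add: m_assoc)
      finally have "inv\<^bsub>W\<^esub> x' \<otimes>\<^bsub>W\<^esub> x \<otimes>\<^bsub>W\<^esub> (y \<otimes>\<^bsub>W\<^esub> inv\<^bsub>W\<^esub> y') \<in> O.stabilizer"
        using stabI [OF _ cd] cW y y' by simp
      then show ?thesis using centI [OF dW dm de] by blast
    qed
  qed
  then show ?thesis by blast
qed

end

theorem theorem6p1:
  fixes M :: "'a monoid" and p :: nat and B N U :: "'a set" and S :: "'a set set"
    and e :: 'a and \<theta> \<sigma> :: "'a set"
  assumes "finite_monoid_of_Lie_type M p B N U S"
    and "e \<in> lie_monoid_data.cross_section_lattice M B N S"
    and "coxeter_data.standard_parabolic (BN_data.weyl_group (units_of M) B N) S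
           (lie_monoid_data.orbit_stabilizer M B N S e)"
    and "lie_monoid_data.bruhat_chevalley M B N S e \<theta> \<sigma>"
    and "poly (lie_monoid_data.R_polynomial M B N S e \<theta> \<sigma>) 0 = 0"
  shows "\<not> (\<exists>(\<Phi> :: 'v::euclidean_space set) \<Delta> u v.
      root_system \<Phi> \<and> root_base \<Phi> \<Delta> \<and>
      coxeter_data.bruhat (root_weyl_group \<Phi>) (root_reflection ` \<Delta>) u v \<and>
      poset_isomorphic
        (lie_monoid_data.bruhat_chevalley M B N S e)
        (lie_monoid_data.bruhat_chevalley_interval M B N S e \<theta> \<sigma>)
        (coxeter_data.bruhat (root_weyl_group \<Phi>) (root_reflection ` \<Delta>))
        (coxeter_data.bruhat_interval (root_weyl_group \<Phi>) (root_reflection ` \<Delta>) u v))"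
proof -
  interpret L: lie_monoid_idempotent M p B N U S e
    by (intro lie_monoid_idempotent.intro lie_monoid_idempotent_axioms.intro assms)
  obtain I where I: "I \<subseteq> S" "L.orbit_stabilizer e = generate L.weyl_group I"
    using assms(3) unfolding coxeter_data.standard_parabolic_def by blast
  obtain K where "coxeter_orbit L.weyl_group S L.renner_monoid (e <#\<^bsub>M\<^esub> L.torus) I K"
    using L.coxeter_orbit_idempotent I unfolding L.orbit_stabilizer_def by blast
  then interpret O: coxeter_orbit L.weyl_group S L.renner_monoid "e <#\<^bsub>M\<^esub> L.torus" I K .
  have "\<not> poset_isomorphic (L.bruhat_chevalley e) (L.bruhat_chevalley_interval e \<theta> \<sigma>)
      (coxeter_data.bruhat (root_weyl_group \<Phi>) (root_reflection ` \<Delta>))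
      (coxeter_data.bruhat_interval (root_weyl_group \<Phi>) (root_reflection ` \<Delta>) u v)"
    if "root_system \<Phi>" "root_base \<Phi> \<Delta>" for \<Phi> \<Delta> :: "'v set" and u v
    unfolding L.bruhat_chevalley_interval_def L.bruhat_chevalley_def
    using assms(4,5) based_root_system.coxeter_group_weyl [OF based_root_system.intro [OF that]]
    unfolding L.bruhat_chevalley_def L.R_polynomial_def
    by (rule O.not_isomorphic_to_bruhat_interval)
  then show ?thesis by blast
qed

end
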